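(* Let $n\in\mathbb{N}$, $n\ge 2$, and let $\mathcal{B}^{(n)}$ be an $n$-dimensional box of measures $l_1\times l_2\times\cdots\times l_n$, where the ratios of edge lengths are $\frac{l_j}{l_{j+1}}=2^{1/n}$ for $1\le j\le n-1$. Let $0=\lambda_1<\lambda_2\le\lambda_3\le\cdots$ be the eigenvalues of the Neumann Laplacian on $\mathcal{B}^{(n)}$, listed with multiplicity. The Courant-sharp eigenvalues of the Neumann Laplacian on $\mathcal{B}^{(n)}$ are exactly $\lambda_1,\lambda_2,\lambda_4,\lambda_6$ for $n=2$, and exactly $\lambda_1,\lambda_2$ for $n\ge 3$.
   Context: The Neumann eigenvalue problem on a bounded domain $\Omega$ is $-\Delta\varphi=\lambda\varphi$ in $\Omega$ with $\partial\varphi/\partial\vec n=0$ on $\partial\Omega$. For an eigenvalue $\lambda$ put $N(\lambda):=|\{j : \lambda_j<\lambda\}|+1$. For an eigenfunction $\varphi$ let $\nu(\varphi)$ be the number of connected components of $\Omega\setminus\varphi^{-1}(0)$ (nodal domains; $\Omega$ is the open domain). An eigenfunction $\varphi$ with eigenvalue $\lambda$ is Courant-sharp if $\nu(\varphi)=N(\lambda)$; an eigenvalue $\lambda$ is Courant-sharp if it has a Courant-sharp eigenfunction. *)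

theory Defs
  imports "HOL-Analysis.Analysis" "HOL-Library.Function_Algebras"
begin

text \<open>
  Outward unit normal at a boundary point \<open>p\<close> near which the boundary is of class \<open>C\<^sup>1\<close>, i.e. \<open>\<Omega>\<close> is
  locally the sublevel set \<open>{g < 0}\<close> of a \<open>C\<^sup>1\<close> function with \<open>\<nabla>g p \<noteq> 0\<close>. For a box these are exactly
  the points in the relative interior of a facet; no normal exists at the lower-dimensional faces.
\<close>

definition outward_unit_normal :: "'a::euclidean_space set \<Rightarrow> 'a \<Rightarrow> 'a \<Rightarrow> bool" where
  "outward_unit_normal \<Omega> p \<nu> \<longleftrightarrow> p \<in> frontier \<Omega> \<and>
     (\<exists>U g G. open U \<and> p \<in> U \<and> (\<forall>x\<in>U. GDERIV g x :> G x) \<and> continuous_on U G \<and>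
        G p \<noteq> 0 \<and> \<Omega> \<inter> U = {x \<in> U. g x < 0} \<and> \<nu> = sgn (G p))"

text \<open>
  Classical solutions \<open>\<phi> \<in> C\<^sup>2(\<Omega>) \<inter> C\<^sup>1(closure \<Omega>)\<close> of \<open>-\<Delta>\<phi> = \<mu> \<phi>\<close> in \<open>\<Omega>\<close>, \<open>\<partial>\<phi>/\<partial>n = 0\<close> on the boundary.
  \<open>G\<close> is the gradient of \<open>\<phi>\<close>, extended continuously to the closure, and \<open>H x\<close> is the derivative of \<open>G\<close>
  at \<open>x\<close>, so that the Laplacian is the trace of \<open>H x\<close>. Only the values of \<open>\<phi>\<close> on the closure of \<open>\<Omega>\<close>
  matter here.
\<close>

definition neumann_solution :: "'a::euclidean_space set \<Rightarrow> real \<Rightarrow> ('a \<Rightarrow> real) \<Rightarrow> bool" where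
  "neumann_solution \<Omega> \<mu> \<phi> \<longleftrightarrow>
     (\<exists>G H. continuous_on (closure \<Omega>) \<phi> \<and> continuous_on (closure \<Omega>) G \<and>
        (\<forall>x\<in>\<Omega>. GDERIV \<phi> x :> G x) \<and>
        (\<forall>x\<in>\<Omega>. (G has_derivative H x) (at x)) \<and> (\<forall>v. continuous_on \<Omega> (\<lambda>x. H x v)) \<and>
        (\<forall>x\<in>\<Omega>. - (\<Sum>i\<in>Basis. H x i \<bullet> i) = \<mu> * \<phi> x) \<and>
        (\<forall>p \<nu>. outward_unit_normal \<Omega> p \<nu> \<longrightarrow> G p \<bullet> \<nu> = 0))"

text \<open>
  Functions on the closure of \<open>\<Omega>\<close> are represented by their extension by zero, so that equality and
  linear independence of representatives mean equality and linear independence on the closure.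
\<close>

definition neumann_eigenspace :: "'a::euclidean_space set \<Rightarrow> real \<Rightarrow> ('a \<Rightarrow> real) set" where
  "neumann_eigenspace \<Omega> \<mu> = {\<phi>. neumann_solution \<Omega> \<mu> \<phi> \<and> (\<forall>x. x \<notin> closure \<Omega> \<longrightarrow> \<phi> x = 0)}"

definition neumann_eigenfunction :: "'a::euclidean_space set \<Rightarrow> real \<Rightarrow> ('a \<Rightarrow> real) \<Rightarrow> bool" where
  "neumann_eigenfunction \<Omega> \<mu> \<phi> \<longleftrightarrow> \<phi> \<in> neumann_eigenspace \<Omega> \<mu> \<and> \<phi> \<noteq> 0"

lemma vector_space_real_fun: "vector_space (\<lambda>(c::real) (f::'a \<Rightarrow> real) x. c * f x)"
  by unfold_locales (auto simp: algebra_simps)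

definition neumann_multiplicity :: "'a::euclidean_space set \<Rightarrow> real \<Rightarrow> nat" where
  "neumann_multiplicity \<Omega> \<mu> =
     vector_space.dim (\<lambda>(c::real) (f::'a \<Rightarrow> real) x. c * f x) (neumann_eigenspace \<Omega> \<mu>)"

text \<open>
  \<open>lam 1 \<le> lam 2 \<le> \<dots>\<close> lists the Neumann eigenvalues of \<open>\<Omega>\<close> with multiplicity; the value \<open>lam 0\<close> is not
  used. Intended for bounded domains such as boxes, whose eigenspaces are finite-dimensional (the
  library's \<open>dim\<close> is 0 for an infinite-dimensional space). If \<open>\<mu>\<close> is not an eigenvalue, its
  multiplicity is 0 and it does not occur in the list.
\<close>

definition lists_neumann_eigenvalues :: "'a::euclidean_space set \<Rightarrow> (nat \<Rightarrow> real) \<Rightarrow> bool" where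
  "lists_neumann_eigenvalues \<Omega> lam \<longleftrightarrow> mono_on {1..} lam \<and>
     (\<forall>\<mu>. finite {j. 1 \<le> j \<and> lam j = \<mu>} \<and> card {j. 1 \<le> j \<and> lam j = \<mu>} = neumann_multiplicity \<Omega> \<mu>)"

definition counting_number :: "(nat \<Rightarrow> real) \<Rightarrow> real \<Rightarrow> nat" where
  "counting_number lam \<mu> = card {j. 1 \<le> j \<and> lam j < \<mu>} + 1"

definition nodal_domains :: "'a::topological_space set \<Rightarrow> ('a \<Rightarrow> real) \<Rightarrow> 'a set set" where
  "nodal_domains \<Omega> \<phi> = components (\<Omega> - \<phi> -` {0})"

text \<open>
  Since the counting number is positive and \<open>card\<close> of an infinite set is 0, the equation below forces
  the set of nodal domains to be finite.
\<close>

definition courant_sharp_eigenfunction ::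
  "'a::euclidean_space set \<Rightarrow> (nat \<Rightarrow> real) \<Rightarrow> real \<Rightarrow> ('a \<Rightarrow> real) \<Rightarrow> bool" where
  "courant_sharp_eigenfunction \<Omega> lam \<mu> \<phi> \<longleftrightarrow>
     neumann_eigenfunction \<Omega> \<mu> \<phi> \<and> card (nodal_domains \<Omega> \<phi>) = counting_number lam \<mu>"

definition courant_sharp_eigenvalue :: "'a::euclidean_space set \<Rightarrow> (nat \<Rightarrow> real) \<Rightarrow> real \<Rightarrow> bool" where
  "courant_sharp_eigenvalue \<Omega> lam \<mu> \<longleftrightarrow> (\<exists>\<phi>. courant_sharp_eigenfunction \<Omega> lam \<mu> \<phi>)"

end

theory Submission
  imports Defs "HOL-Complex_Analysis.Conformal_Mappings"
begin

text \<open>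
  Every Neumann solution on a box is a finite sum of cosine modes. Courant's nodal domain argument is
  run without gradients: the Dirichlet form is the limit of the second differences of step \<open>h\<close>, taken
  with reflection at the faces, and multiplying an eigenfunction \<open>P\<close> by a function that is constant
  on its nodal domains does not increase it in the limit. A multiple orthogonal to all lower modes is
  therefore again an eigenfunction, and unique continuation gives the bound.

  In units of \<open>(pi / l\<^sub>1)\<^sup>2\<close> the eigenvalues are \<open>\<Sum>j<n. m\<^sub>j\<^sup>2 t\<^sup>j\<close> with \<open>t = r\<^sup>2\<close>, \<open>r = 2\<^sup>1\<^sup>/\<^sup>n\<close>. Modulo
  multiples of \<open>r\<close> in \<open>Z[r]\<close> such a sum determines the parity of \<open>m\<^sub>0\<close>, so every eigenfunction is even or
  odd with respect to the middle of the longest edge. Courant's argument on symmetrised and on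
  antisymmetrised combinations of half-domains then has only the modes of one parity as constraints.
  If an even eigenfunction is Courant-sharp, then so is its restriction to half of the box, which
  is a similar box with the eigenvalue divided by \<open>t\<close>. If an odd one is Courant-sharp, then at most one
  more even than odd mode lies below it, and lowering \<open>m\<^sub>0\<close> by one is an injection from the odd to the
  even modes that misses too much unless the eigenvalue is one of a few small exceptions. These are
  simple, and their nodal domains can be counted.
\<close>

text \<open>An eigenfunction cut off to one nodal domain is only Lipschitz, and no regularity of the
  nodal set is available; second differences make sense for such a function all the same. A jump of
  the multiplier is cheap because two points with different multipliers are separated by a zero of
  \<open>P\<close>, which bounds \<open>P\<close> at both by a multiple of \<open>h\<close>. The
  bookkeeping for an odd eigenvalue: its nodal domains form mirror pairs, so there are at most twice
  (odd modes below + 1) of them, whereas sharpness demands odd + even + 1. The lowered mode of the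
  eigenvalue itself is already one even mode outside the image of the injection, so a single further
  one is fatal. The even case can be iterated because half of the longest edge is the shortest edge
  divided by \<open>r\<close>, the next member of the geometric sequence. Each halving divides the
  normalised eigenvalue by \<open>t > 1\<close>, so a positive eigenvalue cannot stay even
  forever.\<close>

definition freq :: "real^'n \<Rightarrow> real^'n \<Rightarrow> 'n \<Rightarrow> real" where
  "freq a b i = pi / (b $ i - a $ i)"

definition mode :: "real^'n \<Rightarrow> real^'n \<Rightarrow> ('n \<Rightarrow> nat) \<Rightarrow> real^'n \<Rightarrow> real" where
  "mode a b m x = (\<Prod>i\<in>UNIV. cos (real (m i) * freq a b i * (x $ i - a $ i)))"

definition energy :: "real^'n \<Rightarrow> real^'n \<Rightarrow> ('n \<Rightarrow> nat) \<Rightarrow> real" where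
  "energy a b m = (\<Sum>i\<in>UNIV. (real (m i) * freq a b i)\<^sup>2)"

text \<open>The \<open>L^2\<close> inner product of the box, written as an integral over the whole
  space so that a substitution only moves the indicator.\<close>

definition ip :: "real^'n \<Rightarrow> real^'n \<Rightarrow> (real^'n \<Rightarrow> real) \<Rightarrow> (real^'n \<Rightarrow> real) \<Rightarrow> real" where
  "ip a b f g = (LINT x|lborel. indicat_real (box a b) x * (f x * g x))"

text \<open>A class closed under products and under composition with the folding shifts, on which
  \<open>ip\<close> is finite and bilinear. It contains the modes and the indicators of nodal
  domains.\<close>

definition bounded_borel :: "(real^'n \<Rightarrow> real) \<Rightarrow> bool" where
  "bounded_borel f \<longleftrightarrow> f \<in> borel_measurable borel \<and> (\<exists>K. \<forall>x. \<bar>f x\<bar> \<le> K)"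

definition upd :: "real^'n \<Rightarrow> 'n \<Rightarrow> real \<Rightarrow> real^'n" where
  "upd x i v = (\<chi> j. if j = i then v else x $ j)"

text \<open>A step of length \<open>h\<close> along axis \<open>i\<close>, folded back at the upper
  face: \<open>2 * b $ i - h - x $ i\<close> is the mirror image of \<open>x $ i + h\<close>.
  Composing with it amounts to extending a function evenly across the face, which encodes the
  Neumann condition.\<close>

definition shift_up :: "real^'n \<Rightarrow> 'n \<Rightarrow> real \<Rightarrow> real^'n \<Rightarrow> real^'n" where
  "shift_up b i h x = upd x i (if x $ i + h < b $ i then x $ i + h else 2 * b $ i - h - x $ i)"

definition shift_down :: "real^'n \<Rightarrow> 'n \<Rightarrow> real \<Rightarrow> real^'n \<Rightarrow> real^'n" where
  "shift_down a i h x = upd x i (if a $ i < x $ i - h then x $ i - h else 2 * a $ i + h - x $ i)"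

section \<open>Changing one coordinate, and measurability\<close>

lemma upd_nth: "upd x i v $ j = (if j = i then v else x $ j)"
  by (simp add: upd_def)

lemma upd_nth_same [simp]: "upd x i v $ i = v"
  by (simp add: upd_def)

lemma upd_same [simp]: "upd x i (x $ i) = x"
  by (simp add: upd_def vec_eq_iff)

lemma upd_upd [simp]: "upd (upd x i v) i w = upd x i w"
  by (simp add: upd_def vec_eq_iff)

lemma upd_eq_axis: "upd x i v = x + axis i (v - x $ i)"
  by (simp add: upd_def vec_eq_iff axis_def)

lemma norm_upd_diff: fixes x :: "real^'n" shows "norm (upd x i v - x) = \<bar>v - x $ i\<bar>"
proof -
  have "upd x i v - x = (v - x $ i) *\<^sub>R axis i 1"
    by (auto simp: vec_eq_iff axis_def upd_nth)
  thus ?thesis by (simp add: norm_axis_1)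
qed

lemma borel_measurable_vec_nth_comp [measurable]:
  "f \<in> borel_measurable M \<Longrightarrow> (\<lambda>x. f x $ i) \<in> borel_measurable M" for f :: "_ \<Rightarrow> real^'n"
  by (simp add: cart_eq_inner_axis)

lemma measurable_axis [measurable]:
  "f \<in> borel_measurable M \<Longrightarrow> (\<lambda>x. axis i (f x) :: real^'n) \<in> borel_measurable M"
proof -
  assume [measurable]: "f \<in> borel_measurable M"
  have "(\<lambda>x. axis i (f x) :: real^'n) = (\<lambda>x. f x *\<^sub>R axis i 1)"
    by (auto simp: vec_eq_iff axis_def)
  thus ?thesis by simp
qed

lemma measurable_upd [measurable]:
  "f \<in> borel_measurable M \<Longrightarrow> g \<in> borel_measurable M \<Longrightarrow> (\<lambda>x. upd (f x) i (g x)) \<in> borel_measurable M"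
  unfolding upd_eq_axis
  by (intro borel_measurable_add measurable_axis borel_measurable_diff borel_measurable_vec_nth_comp)

lemma measurable_shift_up [measurable]: "shift_up b i h \<in> borel_measurable borel"
  unfolding shift_up_def by measurable

lemma measurable_shift_down [measurable]: "shift_down a i h \<in> borel_measurable borel"
  unfolding shift_down_def by measurable

subsection \<open>Bounded Borel functions\<close>

lemma bounded_borel_measurable: "bounded_borel f \<Longrightarrow> f \<in> borel_measurable borel"
  by (simp add: bounded_borel_def)

lemma bounded_borelE:
  assumes "bounded_borel f" obtains K where "K \<ge> 0" "\<And>x. \<bar>f x\<bar> \<le> K"
proof -
  obtain K where K: "\<And>x. \<bar>f x\<bar> \<le> K" using assms by (auto simp: bounded_borel_def)
  have "K \<ge> 0" using K[of undefined] by linarith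
  with K show ?thesis using that by blast
qed

lemma bounded_borelI: "f \<in> borel_measurable borel \<Longrightarrow> (\<And>x. \<bar>f x\<bar> \<le> K) \<Longrightarrow> bounded_borel f"
  by (auto simp: bounded_borel_def)

lemma bounded_borel_const [simp]: "bounded_borel (\<lambda>x. c)"
  by (auto simp: bounded_borel_def)

lemma bounded_borel_add:
  assumes "bounded_borel f" "bounded_borel g" shows "bounded_borel (\<lambda>x. f x + g x)"
proof -
  obtain K where K: "K \<ge> 0" "\<And>x. \<bar>f x\<bar> \<le> K" using assms(1) bounded_borelE by blast
  obtain L where L: "L \<ge> 0" "\<And>x. \<bar>g x\<bar> \<le> L" using assms(2) bounded_borelE by blast
  have [measurable]: "f \<in> borel_measurable borel" "g \<in> borel_measurable borel"
    using assms by (auto simp: bounded_borel_def)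
  show ?thesis
  proof (rule bounded_borelI)
    show "\<bar>f x + g x\<bar> \<le> K + L" for x using K(2)[of x] L(2)[of x] by linarith
  qed measurable
qed

lemma bounded_borel_mult:
  assumes "bounded_borel f" "bounded_borel g" shows "bounded_borel (\<lambda>x. f x * g x)"
proof -
  obtain K where K: "K \<ge> 0" "\<And>x. \<bar>f x\<bar> \<le> K" using assms(1) bounded_borelE by blast
  obtain L where L: "L \<ge> 0" "\<And>x. \<bar>g x\<bar> \<le> L" using assms(2) bounded_borelE by blast
  have [measurable]: "f \<in> borel_measurable borel" "g \<in> borel_measurable borel"
    using assms by (auto simp: bounded_borel_def)
  show ?thesis
  proof (rule bounded_borelI)
    show "\<bar>f x * g x\<bar> \<le> K * L" for x unfolding abs_mult using K L by (intro mult_mono) auto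
  qed measurable
qed

lemma bounded_borel_cmult: "bounded_borel f \<Longrightarrow> bounded_borel (\<lambda>x. c * f x)"
  by (intro bounded_borel_mult) auto

lemma bounded_borel_diff:
  assumes "bounded_borel f" "bounded_borel g" shows "bounded_borel (\<lambda>x. f x - g x)"
  using bounded_borel_add[OF assms(1) bounded_borel_cmult[OF assms(2), of "-1"]] by simp

lemma bounded_borel_sum: "(\<And>i. i \<in> I \<Longrightarrow> bounded_borel (f i)) \<Longrightarrow> bounded_borel (\<lambda>x. \<Sum>i\<in>I. f i x)"
  by (induction I rule: infinite_finite_induct) (auto intro: bounded_borel_add)

lemma bounded_borel_comp:
  assumes "bounded_borel f" and [measurable]: "T \<in> borel_measurable borel"
  shows "bounded_borel (\<lambda>x. f (T x))"
proof -
  obtain K where K: "K \<ge> 0" "\<And>x. \<bar>f x\<bar> \<le> K" using assms(1) bounded_borelE by blast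
  have [measurable]: "f \<in> borel_measurable borel"
    using assms by (auto simp: bounded_borel_def)
  show ?thesis by (rule bounded_borelI[OF _ K(2)]) measurable
qed

lemma bounded_borel_power: "bounded_borel f \<Longrightarrow> bounded_borel (\<lambda>x. f x ^ k)"
  by (induction k) (auto intro: bounded_borel_mult)

lemma bounded_borel_indicator: "A \<in> sets borel \<Longrightarrow> bounded_borel (indicat_real A)"
  by (rule bounded_borelI[where K = 1]) (auto simp: indicator_def)

lemma integrable_bounded_borel_box:
  assumes "bounded_borel f"
  shows "integrable lborel (\<lambda>x. indicat_real (box a b) x * f x)"
proof -
  obtain K where K: "K \<ge> 0" "\<And>x. \<bar>f x\<bar> \<le> K" using assms(1) bounded_borelE by blast
  have [measurable]: "f \<in> borel_measurable borel"
    using assms by (auto simp: bounded_borel_def)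
  have "integrable lborel (\<lambda>x. indicat_real (box a b) x * K)"
    by (intro integrable_mult_left integrable_real_indicator) (use emeasure_lborel_box_finite[of a b] in \<open>auto simp: top.not_eq_extremum\<close>)
  thus ?thesis
  proof (rule Bochner_Integration.integrable_bound)
    show "AE x in lborel. norm (indicat_real (box a b) x * f x) \<le> norm (indicat_real (box a b) x * K)"
      using K by (auto simp: indicator_def)
  qed measurable
qed

section \<open>The inner product on the box\<close>

lemma integrable_ip:
  "bounded_borel f \<Longrightarrow> bounded_borel g \<Longrightarrow> integrable lborel (\<lambda>x. indicat_real (box a b) x * (f x * g x))"
  by (intro integrable_bounded_borel_box bounded_borel_mult)

lemma ip_commute: "ip a b f g = ip a b g f"
  by (simp add: ip_def mult.commute)

lemma ip_add_right:
  assumes "bounded_borel f" "bounded_borel g" "bounded_borel h"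
  shows "ip a b f (\<lambda>x. g x + h x) = ip a b f g + ip a b f h"
  unfolding ip_def
  by (subst Bochner_Integration.integral_add[symmetric])
     (auto intro: integrable_ip assms intro!: Bochner_Integration.integral_cong simp: distrib_left right_diff_distrib)

lemma ip_cmult_right: "ip a b f (\<lambda>x. c * g x) = c * ip a b f g"
  unfolding ip_def by (subst integral_mult_right_zero[symmetric]) (simp add: mult_ac)

lemma ip_diff_right:
  assumes "bounded_borel f" "bounded_borel g" "bounded_borel h"
  shows "ip a b f (\<lambda>x. g x - h x) = ip a b f g - ip a b f h"
  unfolding ip_def
  by (subst Bochner_Integration.integral_diff[symmetric])
     (auto intro: integrable_ip assms intro!: Bochner_Integration.integral_cong simp: distrib_left right_diff_distrib)

lemma ip_add_left:
  assumes "bounded_borel f" "bounded_borel g" "bounded_borel h"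
  shows "ip a b (\<lambda>x. g x + h x) f = ip a b g f + ip a b h f"
  using ip_add_right[OF assms] by (simp add: ip_commute)

lemma ip_diff_left:
  assumes "bounded_borel f" "bounded_borel g" "bounded_borel h"
  shows "ip a b (\<lambda>x. g x - h x) f = ip a b g f - ip a b h f"
  using ip_diff_right[OF assms] by (simp add: ip_commute)

lemma ip_cmult_left: "ip a b (\<lambda>x. c * g x) f = c * ip a b g f"
  using ip_cmult_right by (simp add: ip_commute)

lemma ip_zero [simp]: "ip a b f (\<lambda>x. 0) = 0" "ip a b (\<lambda>x. 0) f = 0"
  by (simp_all add: ip_def)

lemma ip_sum_right:
  assumes "bounded_borel f" "\<And>i. i \<in> I \<Longrightarrow> bounded_borel (g i)"
  shows "ip a b f (\<lambda>x. \<Sum>i\<in>I. g i x) = (\<Sum>i\<in>I. ip a b f (g i))"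
  using assms(2)
  by (induction I rule: infinite_finite_induct)
     (auto simp: ip_add_right[OF assms(1)] bounded_borel_sum)

lemma ip_sum_left:
  assumes "bounded_borel f" "\<And>i. i \<in> I \<Longrightarrow> bounded_borel (g i)"
  shows "ip a b (\<lambda>x. \<Sum>i\<in>I. g i x) f = (\<Sum>i\<in>I. ip a b (g i) f)"
  using ip_sum_right[OF assms] by (simp add: ip_commute)

lemma ip_cong:
  assumes "\<And>x. x \<in> box a b \<Longrightarrow> f x = f' x" "\<And>x. x \<in> box a b \<Longrightarrow> g x = g' x"
  shows "ip a b f g = ip a b f' g'"
  unfolding ip_def by (rule Bochner_Integration.integral_cong) (auto simp: indicator_def assms)

lemma ip_self_nonneg: "ip a b f f \<ge> 0"
  unfolding ip_def by (rule integral_nonneg_AE) auto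

text \<open>A zero integral would make the open subset of the box where \<open>f\<close> is nonzero
  negligible, and a nonempty open set is not.\<close>

lemma ip_pos_on_box:
  assumes "bounded_borel f" "continuous_on (box a b) f" "x0 \<in> box a b" "f x0 \<noteq> 0"
  shows "ip a b f f > 0"
proof (rule ccontr)
  assume "\<not> ip a b f f > 0"
  hence "ip a b f f = 0" using ip_self_nonneg[of a b f] by linarith
  hence "AE x in lborel. indicat_real (box a b) x * (f x * f x) = 0"
    using integral_nonneg_eq_0_iff_AE[OF integrable_ip[OF assms(1,1)], of a b] unfolding ip_def by simp
  hence "AE x in lborel. x \<notin> {x \<in> box a b. f x \<noteq> 0}"
    by (rule AE_mp) (rule AE_I2, simp add: indicator_def)
  moreover have "f \<in> borel_measurable borel" using assms(1) by (simp add: bounded_borel_def)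
  hence "{x \<in> box a b. f x \<noteq> 0} \<in> sets lborel" by simp
  ultimately have "{x \<in> box a b. f x \<noteq> 0} \<in> null_sets lborel"
    using AE_iff_null_sets by blast
  hence "negligible {x \<in> box a b. f x \<noteq> 0}"
    using negligible_iff_null_sets null_sets_completionI by blast
  moreover have "open {x \<in> box a b. f x \<noteq> 0}"
    using continuous_open_preimage[OF assms(2) open_box, of "-{0}"]
    by (auto simp: vimage_def Int_def)
  ultimately show False
    using open_not_negligible[of "{x \<in> box a b. f x \<noteq> 0}"] assms(3,4) by auto
qed

subsection \<open>Reflecting shifts\<close>

text \<open>A diagonal affine map whose diagonal entries have modulus 1 preserves the measure;
  \<open>s = 1\<close> is a translation and \<open>s = -1\<close> a reflection of one
  coordinate.\<close>

lemma lborel_upd_affine: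
  assumes "\<bar>s\<bar> = 1"
  shows "distr lborel borel (\<lambda>x::real^'n. upd x i (s * x $ i + r)) = lborel"
proof -
  define c :: "real^'n \<Rightarrow> real" where "c j = (if j = axis i 1 then s else 1)" for j
  have eq: "axis i r + (\<Sum>j\<in>Basis. (c j * (x \<bullet> j)) *\<^sub>R j) = upd x i (s * x $ i + r)" for x
  proof -
    have "(\<Sum>j\<in>Basis. (c j * (x \<bullet> j)) *\<^sub>R j) $ k = c (axis k 1) * x $ k" for k
      by (simp add: cart_eq_inner_axis inner_sum_left_Basis axis_in_Basis_iff)
    thus ?thesis
      unfolding vec_eq_iff vector_add_component upd_nth by (simp add: c_def axis_eq_axis) (simp add: axis_def)
  qed
  have 1: "(\<Prod>j\<in>Basis. \<bar>c j\<bar>) = 1"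
    by (rule prod.neutral) (auto simp: c_def assms)
  have "lborel = density (distr lborel borel (\<lambda>x. axis i r + (\<Sum>j\<in>Basis. (c j * (x \<bullet> j)) *\<^sub>R j)))
      (\<lambda>_. (\<Prod>j\<in>Basis. \<bar>c j\<bar>))"
    using assms by (intro lborel_affine_euclidean) (auto simp: c_def)
  thus ?thesis unfolding eq 1 by (simp add: density_1)
qed

lemma lborel_integral_upd:
  fixes F :: "real^'n \<Rightarrow> real"
  assumes "\<bar>s\<bar> = 1" and [measurable]: "F \<in> borel_measurable borel"
  shows "(LINT x|lborel. F (upd x i (s * x $ i + r))) = (LINT x|lborel. F x)"
proof -
  have "(LINT x|lborel. F x) = (LINT x|distr lborel borel (\<lambda>x. upd x i (s * x $ i + r)). F x)"
    by (simp add: lborel_upd_affine[OF assms(1)])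
  also have "\<dots> = (LINT x|lborel. F (upd x i (s * x $ i + r)))"
    by (rule integral_distr) auto
  finally show ?thesis ..
qed

lemma AE_vec_nth_neq: "AE x in lborel. (x::real^'n) $ i \<noteq> c"
proof -
  have "negligible {x::real^'n. x $ i = c}"
    using negligible_standard_hyperplane[of "axis i 1 :: real^'n" c] by (simp add: cart_eq_inner_axis)
  moreover have "{x::real^'n. x $ i = c} \<in> sets borel" by measurable
  ultimately have "{x::real^'n. x $ i = c} \<in> null_sets lborel"
    by (simp add: negligible_iff_null_sets null_sets_def)
  from AE_not_in[OF this] show ?thesis by simp
qed

lemma upd_in_box_iff:
  "upd x i v \<in> box a b \<longleftrightarrow> a $ i < v \<and> v < b $ i \<and> (\<forall>j. j \<noteq> i \<longrightarrow> a $ j < x $ j \<and> x $ j < b $ j)"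
  by (auto simp: mem_box_cart upd_nth)

text \<open>The adjoint of one branch of a folding shift. \<open>A\<close> is the part of the axis
  where the branch applies, \<open>A'\<close> its image, and \<open>r'\<close> the constant of the
  inverse map; \<open>c\<close> and \<open>d\<close> are values where strict and weak inequalities
  disagree, which concerns a null set only.\<close>

lemma ip_substitution:
  fixes a b :: "real^'n"
  assumes s: "\<bar>s\<bar> = 1" and r': "\<And>v. s * (s * v + r) + r' = v"
    and f: "bounded_borel f" and g: "bounded_borel g"
    and [measurable]: "A \<in> sets borel" "A' \<in> sets borel"
    and AA': "\<And>v. v \<noteq> c \<Longrightarrow> v \<noteq> d \<Longrightarrow>
      (a $ i < v \<and> v < b $ i \<and> v \<in> A) \<longleftrightarrow> (a $ i < s * v + r \<and> s * v + r < b $ i \<and> s * v + r \<in> A')"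
  shows "ip a b f (\<lambda>x. indicator A (x $ i) * g (upd x i (s * x $ i + r))) =
    ip a b (\<lambda>x. indicator A' (x $ i) * f (upd x i (s * x $ i + r'))) g"
proof -
  have [measurable]: "f \<in> borel_measurable borel" "g \<in> borel_measurable borel"
    using f g by (auto simp: bounded_borel_def)
  define F where "F x = indicat_real (box a b) x * ((indicator A' (x $ i) * f (upd x i (s * x $ i + r'))) * g x)" for x
  have [measurable]: "F \<in> borel_measurable borel" unfolding F_def by measurable
  have "ip a b (\<lambda>x. indicator A' (x $ i) * f (upd x i (s * x $ i + r'))) g = integral\<^sup>L lborel F"
    by (simp add: ip_def F_def[abs_def])
  also have "\<dots> = (LINT x|lborel. F (upd x i (s * x $ i + r)))"
    by (rule lborel_integral_upd[OF s, symmetric]) measurable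
  also have "\<dots> = ip a b f (\<lambda>x. indicator A (x $ i) * g (upd x i (s * x $ i + r)))"
    unfolding ip_def
  proof (rule integral_cong_AE)
    show "AE x in lborel. F (upd x i (s * x $ i + r)) =
      indicat_real (box a b) x * (f x * (indicator A (x $ i) * g (upd x i (s * x $ i + r))))"
      using AE_vec_nth_neq[of i c] AE_vec_nth_neq[of i d]
    proof eventually_elim
      case (elim x)
      have "upd x i (s * x $ i + r) \<in> box a b \<and> s * x $ i + r \<in> A' \<longleftrightarrow> x \<in> box a b \<and> x $ i \<in> A"
        using AA'[OF elim] upd_in_box_iff[of x i "x $ i" a b] by (auto simp: upd_in_box_iff)
      thus ?case unfolding F_def by (auto simp: indicator_def r')
    qed
  qed measurable
  finally show ?thesis ..
qed

text \<open>The translating branches of the two shifts are adjoint to each other, while each folding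
  branch is its own adjoint; so it is the sum of both shifts that is symmetric. The bound on
  \<open>h\<close> keeps a folded point from leaving through the opposite face.\<close>

lemma ip_reflect_symmetric:
  fixes a b :: "real^'n"
  assumes h: "0 < h" "h < b $ i - a $ i" and f: "bounded_borel f" and g: "bounded_borel g"
  shows "ip a b f (\<lambda>x. g (shift_up b i h x) + g (shift_down a i h x)) =
    ip a b (\<lambda>x. f (shift_up b i h x) + f (shift_down a i h x)) g"
proof -
  have [measurable]: "f \<in> borel_measurable borel" "g \<in> borel_measurable borel"
    using f g by (auto simp: bounded_borel_def)
  define A B where "A = {v. v + h < b $ i}" and "B = {v. a $ i < v - h}"
  have [measurable]: "A \<in> sets borel" "B \<in> sets borel" by (auto simp: A_def B_def)
  have split: "(\<lambda>x. u (shift_up b i h x) + u (shift_down a i h x)) =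
     (\<lambda>x. (indicator A (x $ i) * u (upd x i (1 * x $ i + h)) + indicator (-A) (x $ i) * u (upd x i (-1 * x $ i + (2 * b $ i - h))))
        + (indicator B (x $ i) * u (upd x i (1 * x $ i + (-h))) + indicator (-B) (x $ i) * u (upd x i (-1 * x $ i + (2 * a $ i + h)))))"
    for u :: "real^'n \<Rightarrow> real"
    by (rule ext) (auto simp: shift_up_def shift_down_def A_def B_def indicator_def algebra_simps)
  have bb: "bounded_borel (\<lambda>x. indicator C (x $ i) * u (upd x i (s * x $ i + r)))"
    if "bounded_borel u" "C \<in> sets borel" for u C s r
  proof -
    have [measurable]: "C \<in> sets borel" by fact
    have "bounded_borel (\<lambda>x::real^'n. indicat_real C (x $ i))"
    proof (rule bounded_borelI[where K = 1])
      have "(\<lambda>x::real^'n. x $ i) \<in> borel_measurable borel" by simp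
      from measurable_compose[OF this borel_measurable_indicator[OF that(2)]]
      show "(\<lambda>x::real^'n. indicat_real C (x $ i)) \<in> borel_measurable borel" .
    qed (auto simp: indicator_def)
    moreover have "bounded_borel (\<lambda>x. u (upd x i (s * x $ i + r)))"
      by (rule bounded_borel_comp[OF that(1)]) measurable
    ultimately show ?thesis by (rule bounded_borel_mult)
  qed
  have 1: "ip a b f (\<lambda>x. indicator A (x $ i) * g (upd x i (1 * x $ i + h))) =
    ip a b (\<lambda>x. indicator B (x $ i) * f (upd x i (1 * x $ i + (-h)))) g"
    by (rule ip_substitution[OF _ _ f g, where c = 0 and d = 0]) (use h in \<open>auto simp: A_def B_def\<close>)
  have 2: "ip a b f (\<lambda>x. indicator B (x $ i) * g (upd x i (1 * x $ i + (-h)))) =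
    ip a b (\<lambda>x. indicator A (x $ i) * f (upd x i (1 * x $ i + h))) g"
    by (rule ip_substitution[OF _ _ f g, where c = 0 and d = 0]) (use h in \<open>auto simp: A_def B_def\<close>)
  \<comment> \<open>The fold at the upper face exchanges \<open>b $ i - h\<close> and
    \<open>b $ i\<close>, so these are the exceptional values.\<close>
  have 3: "ip a b f (\<lambda>x. indicator (-A) (x $ i) * g (upd x i (-1 * x $ i + (2 * b $ i - h)))) =
    ip a b (\<lambda>x. indicator (-A) (x $ i) * f (upd x i (-1 * x $ i + (2 * b $ i - h)))) g"
    by (rule ip_substitution[OF _ _ f g, where c = "b $ i" and d = "b $ i - h"]) (use h in \<open>auto simp: A_def B_def\<close>)
  have 4: "ip a b f (\<lambda>x. indicator (-B) (x $ i) * g (upd x i (-1 * x $ i + (2 * a $ i + h)))) =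
    ip a b (\<lambda>x. indicator (-B) (x $ i) * f (upd x i (-1 * x $ i + (2 * a $ i + h)))) g"
    by (rule ip_substitution[OF _ _ f g, where c = "a $ i" and d = "a $ i + h"]) (use h in \<open>auto simp: A_def B_def\<close>)
  have R: "ip a b f (\<lambda>x. (p x + q x) + (r x + s x)) = ip a b f p + ip a b f q + (ip a b f r + ip a b f s)"
    if "bounded_borel p" "bounded_borel q" "bounded_borel r" "bounded_borel s" for p q r s
    using that f by (simp add: ip_add_right bounded_borel_add)
  have L: "ip a b (\<lambda>x. (p x + q x) + (r x + s x)) g = ip a b p g + ip a b q g + (ip a b r g + ip a b s g)"
    if "bounded_borel p" "bounded_borel q" "bounded_borel r" "bounded_borel s" for p q r s
    using that g by (simp add: ip_add_left bounded_borel_add)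
  have m: "A \<in> sets borel" "B \<in> sets borel" "-A \<in> sets borel" "-B \<in> sets borel" by measurable
  show ?thesis
    unfolding split
    unfolding R[OF bb[OF g m(1)] bb[OF g m(3)] bb[OF g m(2)] bb[OF g m(4)]]
      L[OF bb[OF f m(1)] bb[OF f m(3)] bb[OF f m(2)] bb[OF f m(4)]] 1 2 3 4
    by linarith
qed

lemma bounded_borel_shift:
  assumes "bounded_borel f"
  shows "bounded_borel (\<lambda>x. f (shift_up b i h x))" "bounded_borel (\<lambda>x. f (shift_down a i h x))"
  using assms by (auto intro!: bounded_borel_comp)

lemma mode_upd:
  "mode a b m (upd x i v) = cos (real (m i) * freq a b i * (v - a $ i)) *
     (\<Prod>j\<in>UNIV - {i}. cos (real (m j) * freq a b j * (x $ j - a $ j)))"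
  unfolding mode_def
  by (subst prod.remove[of _ i]) (auto intro!: prod.cong simp: upd_nth)

text \<open>At a face the argument of the cosine is a multiple of \<open>pi\<close>, so a mode is
  its own even extension and the fold is invisible. What remains is
  \<open>cos (y + z) + cos (y - z) = 2 * cos y * cos z\<close>.\<close>

lemma mode_shift:
  assumes "a $ i < b $ i"
  shows "mode a b m (shift_up b i h x) + mode a b m (shift_down a i h x) =
    2 * cos (real (m i) * freq a b i * h) * mode a b m x"
proof -
  define c where "c = real (m i) * freq a b i"
  have cb: "c * (b $ i - a $ i) = real (m i) * pi"
    using assms by (simp add: c_def freq_def)
  have U: "cos (c * ((if x $ i + h < b $ i then x $ i + h else 2 * b $ i - h - x $ i) - a $ i)) = cos (c * (x $ i - a $ i) + c * h)"
  proof (cases "x $ i + h < b $ i")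
    case False
    have "c * (2 * b $ i - h - x $ i - a $ i) = 2 * (c * (b $ i - a $ i)) - (c * (x $ i - a $ i) + c * h)"
      by (simp add: algebra_simps)
    also have "cos \<dots> = cos (c * (x $ i - a $ i) + c * h)"
      unfolding cb cos_diff using sin_npi2[of "2 * m i"] cos_npi2[of "2 * m i"] by (simp add: mult_ac)
    finally show ?thesis using False by simp
  qed (simp add: algebra_simps)
  have D: "cos (c * ((if a $ i < x $ i - h then x $ i - h else 2 * a $ i + h - x $ i) - a $ i)) = cos (c * (x $ i - a $ i) - c * h)"
  proof (cases "a $ i < x $ i - h")
    case False
    have "c * (2 * a $ i + h - x $ i - a $ i) = - (c * (x $ i - a $ i) - c * h)"
      by (simp add: algebra_simps)
    thus ?thesis using False by (simp only: cos_minus if_False)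
  qed (simp add: algebra_simps)
  define R where "R = (\<Prod>j\<in>UNIV - {i}. cos (real (m j) * freq a b j * (x $ j - a $ j)))"
  have x: "mode a b m x = cos (c * (x $ i - a $ i)) * R"
    using mode_upd[of a b m x i "x $ i"] by (simp add: R_def c_def)
  show ?thesis
    unfolding shift_up_def shift_down_def mode_upd x
    unfolding c_def[symmetric] R_def[symmetric] U D cos_add cos_diff by (simp add: algebra_simps)
qed

lemma abs_mode_le: "\<bar>mode a b m x\<bar> \<le> 1"
  unfolding mode_def abs_prod by (rule prod_le_1) auto

lemma continuous_mode [continuous_intros]: "continuous_on S (mode a b m)"
  unfolding mode_def by (intro continuous_intros)

lemma bounded_borel_mode: "bounded_borel (mode a b m)"
  by (rule bounded_borelI[OF _ abs_mode_le]) (auto intro!: borel_measurable_continuous_onI continuous_mode)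

lemma freq_pos: "a $ i < b $ i \<Longrightarrow> freq a b i > 0"
  by (simp add: freq_def)

text \<open>Modes that differ in entry \<open>i\<close> are eigenvectors of the same symmetric
  operator, for a suitable \<open>h\<close> with different eigenvalues.\<close>

lemma mode_orthogonal:
  fixes a b :: "real^'n"
  assumes ab: "\<And>i. a $ i < b $ i" and "m \<noteq> k"
  shows "ip a b (mode a b m) (mode a b k) = 0"
proof -
  obtain i where i: "m i \<noteq> k i" using assms by auto
  \<comment> \<open>With this \<open>h\<close> both \<open>m i\<close> and \<open>k i\<close> times
    \<open>freq a b i * h\<close> lie between 0 and \<open>pi\<close>, where the cosine is
    injective; the added 1 keeps \<open>h\<close> below the edge length.\<close>
  define h where "h = (b $ i - a $ i) / (real (m i) + real (k i) + 1)"
  have h: "0 < h" "h < b $ i - a $ i"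
  proof -
    have "real (m i) + real (k i) > 0" using i by (cases "m i = 0") auto
    with ab[of i] show "0 < h" "h < b $ i - a $ i"
      by (auto simp: h_def divide_less_eq mult_less_cancel_left1)
  qed
  have wh: "freq a b i * h * (real (m i) + real (k i) + 1) = pi"
  proof -
    have "pi / L * (L / M) * M = pi" if "L > 0" "M > 0" for L M :: real
      using that by simp
    thus ?thesis using ab[of i] unfolding h_def freq_def by simp
  qed
  have wp: "freq a b i * h > 0" using freq_pos[OF ab] h by simp
  have "cos (real (m i) * freq a b i * h) \<noteq> cos (real (k i) * freq a b i * h)"
  proof
    assume eq: "cos (real (m i) * freq a b i * h) = cos (real (k i) * freq a b i * h)"
    have le: "0 \<le> real p * freq a b i * h \<and> real p * freq a b i * h \<le> pi" if "p \<le> m i + k i" for p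
    proof -
      have "real p * (freq a b i * h) \<le> (real (m i) + real (k i) + 1) * (freq a b i * h)"
        using that wp by (intro mult_right_mono) auto
      moreover have "0 \<le> real p * (freq a b i * h)" using wp by (rule_tac mult_nonneg_nonneg) auto
      ultimately show ?thesis using wh by (simp add: mult_ac)
    qed
    have "real (m i) * freq a b i * h = real (k i) * freq a b i * h"
      using cos_inj_pi[of "real (m i) * freq a b i * h" "real (k i) * freq a b i * h"] eq le[of "m i"] le[of "k i"] by auto
    thus False using wp i by auto
  qed
  moreover have "2 * cos (real (k i) * freq a b i * h) * ip a b (mode a b m) (mode a b k) =
     2 * cos (real (m i) * freq a b i * h) * ip a b (mode a b m) (mode a b k)"
    using ip_reflect_symmetric[OF h bounded_borel_mode bounded_borel_mode, of a b m a b k]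
    unfolding mode_shift[OF ab] ip_cmult_left ip_cmult_right .
  ultimately show ?thesis by auto
qed

lemma mode_at_corner: "mode a b m a = 1"
  by (simp add: mode_def)

text \<open>The mode equals 1 at the corner \<open>a\<close>, which is a limit of points of the
  box.\<close>

lemma mode_norm_pos:
  fixes a b :: "real^'n"
  assumes ab: "\<And>i. a $ i < b $ i"
  shows "ip a b (mode a b m) (mode a b m) > 0"
proof -
  have "continuous (at a) (mode a b m)"
    using continuous_mode[of UNIV a b m] by (simp add: continuous_on_eq_continuous_at)
  hence "\<exists>e>0. \<forall>y. dist a y < e \<longrightarrow> mode a b m y \<noteq> 0"
    using continuous_at_avoid[of a "mode a b m" 0] mode_at_corner[of a b m] by auto
  then obtain e where e: "e > 0" "\<And>y. dist a y < e \<Longrightarrow> mode a b m y \<noteq> 0" by auto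
  have "a \<in> closure (box a b)"
  proof -
    have "box a b \<noteq> {}" using ab by (auto simp: interval_ne_empty_cart)
    thus ?thesis using ab by (auto simp: mem_box_cart less_imp_le)
  qed
  then obtain y where "y \<in> box a b" "dist y a < e" using e(1) closure_approachable by blast
  thus ?thesis
    using e by (intro ip_pos_on_box[OF bounded_borel_mode continuous_mode, of y]) (auto simp: dist_commute)
qed

subsection \<open>The second difference operator\<close>

text \<open>The discrete counterpart of \<open>- h^2\<close> times the second derivative in
  direction \<open>i\<close>, with even reflection at both faces.\<close>

definition second_diff :: "real^'n \<Rightarrow> real^'n \<Rightarrow> 'n \<Rightarrow> real \<Rightarrow> (real^'n \<Rightarrow> real) \<Rightarrow> real^'n \<Rightarrow> real" where
  "second_diff a b i h f x = 2 * f x - (f (shift_up b i h x) + f (shift_down a i h x))"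

lemma bounded_borel_second_diff: "bounded_borel f \<Longrightarrow> bounded_borel (second_diff a b i h f)"
  unfolding second_diff_def
  by (intro bounded_borel_diff bounded_borel_add bounded_borel_shift bounded_borel_cmult)

lemma second_diff_symmetric:
  fixes a b :: "real^'n"
  assumes "0 < h" "h < b $ i - a $ i" "bounded_borel f" "bounded_borel g"
  shows "ip a b f (second_diff a b i h g) = ip a b (second_diff a b i h f) g"
proof -
  have "ip a b f (second_diff a b i h g) =
      2 * ip a b f g - ip a b f (\<lambda>x. g (shift_up b i h x) + g (shift_down a i h x))"
    unfolding second_diff_def
    by (subst ip_diff_right)
       (auto intro!: assms bounded_borel_cmult bounded_borel_add bounded_borel_shift simp: ip_cmult_right)
  moreover have "ip a b (second_diff a b i h f) g =
      2 * ip a b f g - ip a b (\<lambda>x. f (shift_up b i h x) + f (shift_down a i h x)) g"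
    unfolding second_diff_def
    by (subst ip_diff_left)
       (auto intro!: assms bounded_borel_cmult bounded_borel_add bounded_borel_shift simp: ip_cmult_left)
  ultimately show ?thesis using ip_reflect_symmetric[OF assms] by simp
qed

lemma second_diff_mode:
  assumes "a $ i < b $ i"
  shows "second_diff a b i h (mode a b m) x = (2 - 2 * cos (real (m i) * freq a b i * h)) * mode a b m x"
  unfolding second_diff_def mode_shift[OF assms] by (simp add: algebra_simps)

lemma second_diff_sum:
  "second_diff a b i h (\<lambda>x. \<Sum>m\<in>M. c m * f m x) x = (\<Sum>m\<in>M. c m * second_diff a b i h (f m) x)"
  unfolding second_diff_def by (simp add: sum_distrib_left sum_subtractf[symmetric] sum.distrib[symmetric] algebra_simps)

lemma second_diff_diff:
  "second_diff a b i h (\<lambda>x. f x - g x) x = second_diff a b i h f x - second_diff a b i h g x"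
  unfolding second_diff_def by (simp add: algebra_simps)

text \<open>The form is half the integral of the squared differences to both neighbours. The squares
  of the shifted functions integrate to twice the square of \<open>f\<close>, because the sum of the
  shifts is symmetric and maps the constant 1 to 2.\<close>

lemma second_diff_nonneg:
  fixes a b :: "real^'n"
  assumes h: "0 < h" "h < b $ i - a $ i" and f: "bounded_borel f"
  shows "ip a b f (second_diff a b i h f) \<ge> 0"
proof -
  let ?u = "\<lambda>x. f (shift_up b i h x)" and ?d = "\<lambda>x. f (shift_down a i h x)"
  have bb: "bounded_borel ?u" "bounded_borel ?d" using f by (auto intro: bounded_borel_shift)
  have f2: "bounded_borel (\<lambda>x. f x * f x)" using f by (intro bounded_borel_mult)
  have 1: "ip a b (\<lambda>x. 1) (\<lambda>x. ?u x * ?u x + ?d x * ?d x) = 2 * ip a b f f"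
    using ip_reflect_symmetric[OF h bounded_borel_const[of 1] f2]
    using ip_cmult_left[of a b 2 "\<lambda>x. 1" "\<lambda>x. f x * f x"] by (simp add: ip_def)
  have "0 \<le> ip a b (\<lambda>x. 1) (\<lambda>x. (?u x - f x)\<^sup>2 + (?d x - f x)\<^sup>2)"
    unfolding ip_def by (rule integral_nonneg_AE) auto
  also have "(\<lambda>x. (?u x - f x)\<^sup>2 + (?d x - f x)\<^sup>2) =
     (\<lambda>x. (?u x * ?u x + ?d x * ?d x) + ((2 * f x) * second_diff a b i h f x - 2 * (f x * f x)))"
    by (simp add: second_diff_def power2_eq_square algebra_simps)
  also have "ip a b (\<lambda>x. 1) \<dots> = 2 * ip a b f f + (ip a b (\<lambda>x. 1) (\<lambda>x. (2 * f x) * second_diff a b i h f x) - ip a b (\<lambda>x. 1) (\<lambda>x. 2 * (f x * f x)))"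
    unfolding 1[symmetric]
    by (subst ip_add_right ip_diff_right;
        (intro bounded_borel_const bounded_borel_add bounded_borel_mult bounded_borel_diff bb f bounded_borel_second_diff)?)+ simp
  also have "ip a b (\<lambda>x. 1) (\<lambda>x. (2 * f x) * second_diff a b i h f x) = 2 * ip a b f (second_diff a b i h f)"
    by (subst ip_cmult_left[symmetric]) (simp add: ip_def)
  also have "ip a b (\<lambda>x. 1) (\<lambda>x. 2 * (f x * f x)) = 2 * ip a b f f"
    by (subst ip_cmult_left[symmetric]) (simp add: ip_def mult_ac)
  finally show ?thesis by simp
qed

text \<open>The modes are orthogonal but not normalised, hence the division.\<close>

definition fcoeff :: "real^'n \<Rightarrow> real^'n \<Rightarrow> (real^'n \<Rightarrow> real) \<Rightarrow> ('n \<Rightarrow> nat) \<Rightarrow> real" where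
  "fcoeff a b f m = ip a b f (mode a b m) / ip a b (mode a b m) (mode a b m)"

abbreviation "mode_norm a b m \<equiv> ip a b (mode a b m) (mode a b m)"

lemma bounded_borel_mode_sum: "bounded_borel (\<lambda>x. \<Sum>m\<in>M. c m * mode a b m x)"
  by (intro bounded_borel_sum bounded_borel_cmult bounded_borel_mode)

lemma continuous_mode_sum [continuous_intros]: "continuous_on S (\<lambda>x. \<Sum>m\<in>M. c m * mode a b m x)"
  by (intro continuous_intros)

lemma ip_mode_sum_right:
  "bounded_borel f \<Longrightarrow> ip a b f (\<lambda>x. \<Sum>m\<in>M. c m * mode a b m x) = (\<Sum>m\<in>M. c m * ip a b f (mode a b m))"
  by (subst ip_sum_right) (auto intro: bounded_borel_cmult bounded_borel_mode simp: ip_cmult_right)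

lemma ip_mode_sum_mode:
  assumes ab: "\<And>i. a $ i < b $ i" and "finite M"
  shows "ip a b (\<lambda>x. \<Sum>m\<in>M. c m * mode a b m x) (mode a b k) = (if k \<in> M then c k * mode_norm a b k else 0)"
proof -
  have "ip a b (\<lambda>x. \<Sum>m\<in>M. c m * mode a b m x) (mode a b k) = (\<Sum>m\<in>M. c m * ip a b (mode a b k) (mode a b m))"
    unfolding ip_commute[of a b _ "mode a b k"] by (rule ip_mode_sum_right[OF bounded_borel_mode])
  also have "\<dots> = (\<Sum>m\<in>M. if k = m then c k * mode_norm a b k else 0)"
    by (rule sum.cong) (auto simp: mode_orthogonal[OF ab])
  finally show ?thesis using assms(2) by simp
qed

lemma ip_mode_sum_self:
  assumes ab: "\<And>i. a $ i < b $ i" and "finite M"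
  shows "ip a b (\<lambda>x. \<Sum>m\<in>M. c m * mode a b m x) (\<lambda>x. \<Sum>m\<in>M. d m * mode a b m x) = (\<Sum>m\<in>M. c m * d m * mode_norm a b m)"
  unfolding ip_mode_sum_right[OF bounded_borel_mode_sum] ip_mode_sum_mode[OF assms]
  by (rule sum.cong) auto

text \<open>Bessel's inequality for the difference form: its positivity is applied to
  \<open>f\<close> minus a partial Fourier sum, on which the operator is diagonal.\<close>

lemma second_diff_Bessel:
  fixes a b :: "real^'n"
  assumes ab: "\<And>i. a $ i < b $ i" and h: "0 < h" "h < b $ i - a $ i" and f: "bounded_borel f" and M: "finite M"
  shows "(\<Sum>m\<in>M. (2 - 2 * cos (real (m i) * freq a b i * h)) * (fcoeff a b f m)\<^sup>2 * mode_norm a b m)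
     \<le> ip a b f (second_diff a b i h f)"
proof -
  define w where "w m = 2 - 2 * cos (real (m i) * freq a b i * h)" for m :: "'n \<Rightarrow> nat"
  define F where "F = fcoeff a b f"
  define s where "s x = (\<Sum>m\<in>M. F m * mode a b m x)" for x
  have s: "bounded_borel s" unfolding s_def by (rule bounded_borel_mode_sum)
  have sd: "second_diff a b i h s = (\<lambda>x. \<Sum>m\<in>M. (F m * w m) * mode a b m x)"
    unfolding s_def[abs_def] by (rule ext) (simp add: second_diff_sum second_diff_mode[OF ab] w_def mult_ac)
  have sdb: "bounded_borel (second_diff a b i h g)" if "bounded_borel g" for g
    using that by (rule bounded_borel_second_diff)
  have FN: "ip a b f (mode a b m) = F m * mode_norm a b m" for m
    using mode_norm_pos[of a b m] ab by (simp add: F_def fcoeff_def less_imp_neq[THEN not_sym])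
  have fs: "ip a b f (second_diff a b i h s) = (\<Sum>m\<in>M. w m * (F m)\<^sup>2 * mode_norm a b m)"
    unfolding sd ip_mode_sum_right[OF f] FN by (rule sum.cong) (auto simp: power2_eq_square)
  have ss: "ip a b s (second_diff a b i h s) = (\<Sum>m\<in>M. w m * (F m)\<^sup>2 * mode_norm a b m)"
  proof -
    have "ip a b s (second_diff a b i h s) =
        ip a b (\<lambda>x. \<Sum>m\<in>M. F m * mode a b m x) (\<lambda>x. \<Sum>m\<in>M. (F m * w m) * mode a b m x)"
      unfolding sd by (simp add: s_def[abs_def])
    also have "\<dots> = (\<Sum>m\<in>M. w m * (F m)\<^sup>2 * mode_norm a b m)"
      unfolding ip_mode_sum_self[OF ab M] by (rule sum.cong) (auto simp: power2_eq_square)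
    finally show ?thesis .
  qed
  have sf: "ip a b s (second_diff a b i h f) = ip a b f (second_diff a b i h s)"
    using second_diff_symmetric[OF h s f] by (simp add: ip_commute)
  have "0 \<le> ip a b (\<lambda>x. f x - s x) (second_diff a b i h (\<lambda>x. f x - s x))"
    by (rule second_diff_nonneg[OF h]) (intro bounded_borel_diff f s)
  also have "second_diff a b i h (\<lambda>x. f x - s x) = (\<lambda>x. second_diff a b i h f x - second_diff a b i h s x)"
    by (rule ext) (rule second_diff_diff)
  also have "ip a b (\<lambda>x. f x - s x) \<dots> = ip a b f (second_diff a b i h f) - ip a b f (second_diff a b i h s)
      - (ip a b s (second_diff a b i h f) - ip a b s (second_diff a b i h s))"
    using f s by (simp add: ip_diff_left ip_diff_right sdb bounded_borel_diff)
  finally show ?thesis unfolding sf fs ss w_def F_def by simp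
qed

subsection \<open>Completeness of the modes\<close>

text \<open>The linear span of the modes, given inductively so that closure properties follow by
  rule induction.\<close>

inductive trig :: "real^'n \<Rightarrow> real^'n \<Rightarrow> (real^'n \<Rightarrow> real) \<Rightarrow> bool" for a b where
  zero: "trig a b (\<lambda>x. 0)"
| step: "trig a b f \<Longrightarrow> trig a b (\<lambda>x. c * mode a b m x + f x)"

lemma trig_mode: "trig a b (\<lambda>x. c * mode a b m x)"
  using trig.step[OF trig.zero, of a b c m] by simp

lemma trig_add: "trig a b f \<Longrightarrow> trig a b g \<Longrightarrow> trig a b (\<lambda>x. f x + g x)"
  by (induction rule: trig.induct) (auto simp: add.assoc intro: trig.step)

lemma trig_cmult: "trig a b f \<Longrightarrow> trig a b (\<lambda>x. c * f x)"
proof (induction rule: trig.induct)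
  case (step f d m)
  from trig.step[OF step.IH, of "c * d" m] show ?case by (simp add: algebra_simps)
qed (simp add: trig.zero)

lemma trig_continuous: "trig a b f \<Longrightarrow> continuous_on S f"
  by (induction rule: trig.induct) (auto intro!: continuous_intros)

lemma trig_representation:
  "trig a b f \<Longrightarrow> \<exists>M c. finite M \<and> f = (\<lambda>x. \<Sum>m\<in>M. c m * mode a b m x)"
proof (induction rule: trig.induct)
  case zero
  show ?case by (rule exI[of _ "{}"]) auto
next
  case (step f d m)
  then obtain M c where M: "finite M" "f = (\<lambda>x. \<Sum>m\<in>M. c m * mode a b m x)" by auto
  define e where "e k = (if k \<in> M then c k else 0) + (if k = m then d else 0)" for k
  have "(\<Sum>k\<in>insert m M. e k * mode a b k x) = d * mode a b m x + f x" for x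
  proof -
    have "(\<Sum>k\<in>insert m M. e k * mode a b k x) = (\<Sum>k\<in>insert m M. if k = m then d * mode a b k x else 0) +
        (\<Sum>k\<in>insert m M. if k \<in> M then c k * mode a b k x else 0)"
      unfolding sum.distrib[symmetric] by (rule sum.cong) (auto simp: e_def algebra_simps)
    also have "(\<Sum>k\<in>insert m M. if k \<in> M then c k * mode a b k x else 0) = f x"
      unfolding M(2) using M(1) by (intro sum.mono_neutral_cong_right) auto
    finally show ?thesis using M(1) by simp
  qed
  hence "finite (insert m M) \<and> (\<lambda>x. d * mode a b m x + f x) = (\<lambda>x. \<Sum>k\<in>insert m M. e k * mode a b k x)"
    using M(1) by auto
  thus ?case by blast
qed

lemma mode_factor:
  "mode a b m x = cos (real (m i) * freq a b i * (x $ i - a $ i)) *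
     (\<Prod>j\<in>UNIV - {i}. cos (real (m j) * freq a b j * (x $ j - a $ j)))"
  using mode_upd[of a b m x i "x $ i"] by simp

lemma trig_mult_coordinate:
  assumes "trig a b f"
  shows "trig a b (\<lambda>x. cos (freq a b i * (x $ i - a $ i)) * f x)"
  using assms
proof (induction rule: trig.induct)
  case zero
  show ?case by (simp add: trig.zero)
next
  case (step f d m)
  let ?y = "\<lambda>x::real^'a. freq a b i * (x $ i - a $ i)"
  have "trig a b (\<lambda>x. cos (?y x) * mode a b m x)"
  proof (cases "m i")
    case 0
    have "cos (?y x) * mode a b m x = 1 * mode a b (m(i := 1)) x" for x
      unfolding mode_factor[of a b _ x i] using 0 by simp
    thus ?thesis using trig_mode[of a b 1 "m(i := 1)"] by simp
  next
    case (Suc k)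
    \<comment> \<open>The product of two cosines splits into the two neighbouring frequencies.
      Frequency 0 was treated apart because it has no lower neighbour in \<open>nat\<close>.\<close>
    have "cos (?y x) * mode a b m x = 1/2 * mode a b (m(i := Suc (Suc k))) x + 1/2 * mode a b (m(i := k)) x" for x
    proof -
      define y where "y = ?y x"
      have "cos y * cos (real (Suc k) * y) = 1/2 * cos (real (Suc (Suc k)) * y) + 1/2 * cos (real k * y)"
        using cos_times_cos[of "real (Suc k) * y" y] by (simp add: algebra_simps add_divide_distrib)
      hence "cos y * (cos (real (Suc k) * y) * R) = 1/2 * (cos (real (Suc (Suc k)) * y) * R) + 1/2 * (cos (real k * y) * R)" for R
        by (metis (no_types, lifting) distrib_right mult.assoc)
      moreover have "real p * freq a b i * (x $ i - a $ i) = real p * y" for p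
        unfolding y_def by simp
      note e = this
      ultimately show ?thesis
        unfolding mode_factor[of a b _ x i] e using Suc by (simp del: of_nat_Suc add: y_def[symmetric])
    qed
    thus ?thesis using trig_add[OF trig_mode trig_mode, of a b "1/2" "m(i := Suc (Suc k))" "1/2" "m(i := k)"] by simp
  qed
  from trig_add[OF trig_cmult[OF this, of d] step.IH] show ?case by (simp add: algebra_simps)
qed

lemma trig_dense:
  assumes ab: "\<And>i. a $ i < b $ i" and f: "continuous_on (cbox a b) f" and e: "e > 0"
  shows "\<exists>g. trig a b g \<and> (\<forall>x\<in>cbox a b. \<bar>f x - g x\<bar> < e)"
proof -
  \<comment> \<open>\<open>P\<close> asks in addition that multiplication by \<open>g\<close>
    preserves the span. Closure under products is then immediate, and only constants and the cosine
    of a single coordinate have to be checked.\<close>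
  define P where "P g \<longleftrightarrow> trig a b g \<and> (\<forall>f. trig a b f \<longrightarrow> trig a b (\<lambda>x. g x * f x))" for g
  have const: "trig a b (\<lambda>x. c)" for c
    using trig_mode[of a b c "\<lambda>_. 0"] by (simp add: mode_def)
  have "\<exists>g. P g \<and> (\<forall>x\<in>cbox a b. \<bar>f x - g x\<bar> < e)"
  proof (rule Stone_Weierstrass_HOL[OF compact_cbox])
    show "P (\<lambda>x. c)" for c by (auto simp: P_def const trig_cmult)
    show "continuous_on (cbox a b) g" if "P g" for g using that trig_continuous by (auto simp: P_def)
    show "P (\<lambda>x. g x + h x)" if "P g \<and> P h" for g h
      using that by (auto simp: P_def trig_add distrib_right)
    show "P (\<lambda>x. g x * h x)" if "P g \<and> P h" for g h
      using that by (auto simp: P_def mult.assoc)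
    show "\<exists>g. P g \<and> g x \<noteq> g y" if xy: "x \<in> cbox a b \<and> y \<in> cbox a b \<and> x \<noteq> y" for x y
    proof -
      obtain i where i: "x $ i \<noteq> y $ i" using xy by (auto simp: vec_eq_iff)
      define g where "g z = cos (freq a b i * (z $ i - a $ i))" for z
      have "P g" unfolding P_def g_def using trig_mult_coordinate trig_mult_coordinate[OF const[of 1]] by auto
      moreover have "g x \<noteq> g y"
      proof
        have r: "0 \<le> freq a b i * (z $ i - a $ i) \<and> freq a b i * (z $ i - a $ i) \<le> pi" if "z \<in> cbox a b" for z
        proof -
          have z: "a $ i \<le> z $ i" "z $ i \<le> b $ i" using that by (auto simp: mem_box_cart)
          have "freq a b i * (z $ i - a $ i) \<le> freq a b i * (b $ i - a $ i)"
            using z freq_pos[OF ab, of i] by (intro mult_left_mono) auto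
          also have "\<dots> = pi" using ab[of i] by (simp add: freq_def)
          finally show ?thesis using z freq_pos[OF ab, of i] by auto
        qed
        assume "g x = g y"
        hence "freq a b i * (x $ i - a $ i) = freq a b i * (y $ i - a $ i)"
          unfolding g_def using r xy by (rule_tac cos_inj_pi) auto
        thus False using i freq_pos[OF ab, of i] by auto
      qed
      ultimately show ?thesis by blast
    qed
  qed (use f e in auto)
  thus ?thesis by (auto simp: P_def)
qed

text \<open>Completing the square: the error for arbitrary coefficients exceeds that of the Fourier
  coefficients by a weighted sum of squares.\<close>

lemma fcoeff_best_approx:
  assumes ab: "\<And>i. a $ i < b $ i" and f: "bounded_borel f" and M: "finite M"
  shows "ip a b f f - (\<Sum>m\<in>M. (fcoeff a b f m)\<^sup>2 * mode_norm a b m)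
    \<le> ip a b (\<lambda>x. f x - (\<Sum>m\<in>M. c m * mode a b m x)) (\<lambda>x. f x - (\<Sum>m\<in>M. c m * mode a b m x))"
proof -
  define s where "s x = (\<Sum>m\<in>M. c m * mode a b m x)" for x
  define F where "F = fcoeff a b f"
  have s: "bounded_borel s" unfolding s_def by (rule bounded_borel_mode_sum)
  have FN: "ip a b f (mode a b m) = F m * mode_norm a b m" for m
    using mode_norm_pos[of a b m] ab by (simp add: F_def fcoeff_def less_imp_neq[THEN not_sym])
  have fs: "ip a b f s = (\<Sum>m\<in>M. c m * F m * mode_norm a b m)"
    unfolding s_def[abs_def] ip_mode_sum_right[OF f] FN by (simp add: mult_ac)
  have ss: "ip a b s s = (\<Sum>m\<in>M. c m * c m * mode_norm a b m)"
    unfolding s_def[abs_def] by (rule ip_mode_sum_self[OF ab M])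
  have "ip a b (\<lambda>x. f x - s x) (\<lambda>x. f x - s x) = ip a b f f - 2 * ip a b f s + ip a b s s"
    using f s by (simp add: ip_diff_left ip_diff_right bounded_borel_diff ip_commute[of a b s f])
  also have "\<dots> = ip a b f f - (\<Sum>m\<in>M. (F m)\<^sup>2 * mode_norm a b m) + (\<Sum>m\<in>M. (c m - F m)\<^sup>2 * mode_norm a b m)"
    unfolding fs ss by (simp add: sum_distrib_left sum_subtractf[symmetric] sum.distrib[symmetric] power2_eq_square algebra_simps)
  also have "\<dots> \<ge> ip a b f f - (\<Sum>m\<in>M. (F m)\<^sup>2 * mode_norm a b m)"
    using mode_norm_pos[of a b] ab by (simp add: sum_nonneg less_imp_le)
  finally show ?thesis by (simp add: F_def s_def)
qed

lemma ip_self_le: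
  assumes f: "bounded_borel f" and d: "\<And>x. x \<in> box a b \<Longrightarrow> \<bar>f x\<bar> \<le> d"
  shows "ip a b f f \<le> d\<^sup>2 * measure lborel (box a b)"
proof -
  have "ip a b f f \<le> (LINT x|lborel. indicat_real (box a b) x * d\<^sup>2)"
    unfolding ip_def
  proof (rule integral_mono)
    show "indicat_real (box a b) x * (f x * f x) \<le> indicat_real (box a b) x * d\<^sup>2" for x
      using d[of x] power_mono[of "\<bar>f x\<bar>" d 2] by (auto simp: indicator_def power2_eq_square)
  qed (rule integrable_ip[OF f f] integrable_bounded_borel_box[OF bounded_borel_const])+
  also have "\<dots> = d\<^sup>2 * measure lborel (box a b)"
    by (subst integral_mult_left_zero) (simp add: mult.commute)
  finally show ?thesis .
qed

text \<open>Uniform approximation on the closed box controls the \<open>L^2\<close> error, and the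
  Fourier sum over the same modes is at least as good. The continuous \<open>g\<close> stands in for
  \<open>f\<close>, whose values off the open box are arbitrary.\<close>

lemma Parseval_le:
  assumes ab: "\<And>i. a $ i < b $ i" and f: "bounded_borel f"
    and g: "continuous_on (cbox a b) g" "\<And>x. x \<in> box a b \<Longrightarrow> f x = g x" and e: "e > 0"
  shows "\<exists>M. finite M \<and> ip a b f f \<le> (\<Sum>m\<in>M. (fcoeff a b f m)\<^sup>2 * mode_norm a b m) + e"
proof -
  define V where "V = measure lborel (box a b) + 1"
  have V: "V > 0" unfolding V_def by (smt (verit) measure_nonneg)
  define d where "d = sqrt (e / V)"
  have d: "d > 0" "d\<^sup>2 * V = e" using V e by (auto simp: d_def)
  obtain t where t: "trig a b t" "\<And>x. x \<in> cbox a b \<Longrightarrow> \<bar>g x - t x\<bar> < d"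
    using trig_dense[OF ab g(1) d(1)] by blast
  obtain M c where M: "finite M" "t = (\<lambda>x. \<Sum>m\<in>M. c m * mode a b m x)"
    using trig_representation[OF t(1)] by blast
  have bt: "bounded_borel t" unfolding M(2) by (rule bounded_borel_mode_sum)
  have "ip a b f f - (\<Sum>m\<in>M. (fcoeff a b f m)\<^sup>2 * mode_norm a b m) \<le> ip a b (\<lambda>x. f x - t x) (\<lambda>x. f x - t x)"
    unfolding M(2) by (rule fcoeff_best_approx[OF ab f M(1)])
  also have "\<dots> \<le> d\<^sup>2 * measure lborel (box a b)"
  proof (rule ip_self_le)
    show "\<bar>f x - t x\<bar> \<le> d" if "x \<in> box a b" for x
      using t(2)[of x] g(2)[of x] that box_subset_cbox[of a b] by fastforce
  qed (intro bounded_borel_diff f bt)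
  also have "\<dots> \<le> d\<^sup>2 * V" unfolding V_def by (intro mult_left_mono) auto
  finally show ?thesis using M(1) d(2) by (intro exI[of _ M]) auto
qed

lemma mode_completeness:
  assumes ab: "\<And>i. a $ i < b $ i" and f: "bounded_borel f"
    and g: "continuous_on (cbox a b) g" "\<And>x. x \<in> box a b \<Longrightarrow> f x = g x"
    and orth: "\<And>m. ip a b f (mode a b m) = 0" and x: "x \<in> box a b"
  shows "f x = 0"
proof (rule ccontr)
  assume "f x \<noteq> 0"
  have "continuous_on (box a b) g" using g(1) box_subset_cbox continuous_on_subset by blast
  hence "continuous_on (box a b) f" using g(2) by (simp cong: continuous_on_cong)
  hence pos: "ip a b f f > 0" using ip_pos_on_box[OF f _ x] \<open>f x \<noteq> 0\<close> by blast
  have "fcoeff a b f m = 0" for m by (simp add: fcoeff_def orth)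
  moreover obtain M where "ip a b f f \<le> (\<Sum>m\<in>M. (fcoeff a b f m)\<^sup>2 * mode_norm a b m) + ip a b f f / 2"
    using Parseval_le[OF ab f g, of "ip a b f f / 2"] pos by force
  ultimately have "ip a b f f \<le> ip a b f f / 2" by simp
  thus False using pos by linarith
qed

subsection \<open>Regularity and unique continuation of trigonometric sums\<close>

lemma finite_energy_le:
  fixes a b :: "real^'n"
  assumes ab: "\<And>i. a $ i < b $ i"
  shows "finite {m. energy a b m \<le> c}"
proof -
  obtain K :: nat where K: "\<And>i. sqrt \<bar>c\<bar> / freq a b i \<le> real K"
  proof -
    have "\<exists>K::nat. sqrt \<bar>c\<bar> / freq a b i \<le> real K" for i
      by (rule real_arch_simple)
    then obtain f :: "'n \<Rightarrow> nat" where f: "\<And>i. sqrt \<bar>c\<bar> / freq a b i \<le> real (f i)" by metis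
    have "f i \<le> Max (range f)" for i by (rule Max_ge) auto
    thus ?thesis using f that[of "Max (range f)"] by (meson of_nat_mono order_trans)
  qed
  have "{m. energy a b m \<le> c} \<subseteq> (UNIV :: 'n set) \<rightarrow>\<^sub>E {..K}"
  proof
    fix m assume "m \<in> {m. energy a b m \<le> c}"
    hence m: "energy a b m \<le> c" by simp
    have "m i \<le> K" for i
    proof -
      have "(real (m i) * freq a b i)\<^sup>2 \<le> energy a b m"
        unfolding energy_def by (rule member_le_sum) auto
      hence "(real (m i) * freq a b i)\<^sup>2 \<le> \<bar>c\<bar>" using m by linarith
      hence "real (m i) * freq a b i \<le> sqrt \<bar>c\<bar>"
        by (rule real_le_rsqrt)
      hence "real (m i) \<le> sqrt \<bar>c\<bar> / freq a b i" using freq_pos[OF ab, of i] by (simp add: field_simps)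
      thus ?thesis using K[of i] by linarith
    qed
    thus "m \<in> UNIV \<rightarrow>\<^sub>E {..K}" by auto
  qed
  moreover have "finite ((UNIV :: 'n set) \<rightarrow>\<^sub>E {..K})" by (rule finite_PiE) auto
  ultimately show ?thesis by (rule finite_subset)
qed

lemma finite_energy_eq:
  fixes a b :: "real^'n"
  assumes ab: "\<And>i. a $ i < b $ i"
  shows "finite {m. energy a b m = c}" "finite {m. energy a b m < c}"
  by (rule finite_subset[OF _ finite_energy_le[OF ab, of c]]; auto)+

lemma energy_nonneg: "energy a b m \<ge> 0"
  unfolding energy_def by (rule sum_nonneg) auto

lemma abs_cos_diff_le: "\<bar>cos x - cos y\<bar> \<le> \<bar>x - y\<bar>" for x y :: real
proof -
  have "cos x - cos y = 2 * sin ((x + y) / 2) * sin ((y - x) / 2)" by (rule cos_diff_cos)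
  hence "\<bar>cos x - cos y\<bar> = 2 * (\<bar>sin ((x + y) / 2)\<bar> * \<bar>sin ((y - x) / 2)\<bar>)"
    by (simp add: abs_mult)
  also have "\<dots> \<le> 2 * (1 * \<bar>(y - x) / 2\<bar>)"
    by (intro mult_left_mono mult_mono abs_sin_x_le_abs_x) auto
  finally show ?thesis by simp
qed

lemma mode_Lipschitz: "\<exists>L\<ge>0. \<forall>x y. \<bar>mode a b m x - mode a b m y\<bar> \<le> L * norm (x - y)"
proof (intro exI conjI allI)
  show "(\<Sum>i\<in>UNIV. \<bar>real (m i) * freq a b i\<bar>) \<ge> 0" by (rule sum_nonneg) auto
  fix x y
  have "\<bar>mode a b m x - mode a b m y\<bar> \<le> (\<Sum>i\<in>UNIV. norm (cos (real (m i) * freq a b i * (x $ i - a $ i)) - cos (real (m i) * freq a b i * (y $ i - a $ i))))"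
    unfolding mode_def real_norm_def[symmetric] by (rule norm_prod_diff) auto
  also have "\<dots> \<le> (\<Sum>i\<in>UNIV. \<bar>real (m i) * freq a b i\<bar> * norm (x - y))"
  proof (rule sum_mono)
    fix i
    have "norm (cos (real (m i) * freq a b i * (x $ i - a $ i)) - cos (real (m i) * freq a b i * (y $ i - a $ i)))
       \<le> \<bar>real (m i) * freq a b i * (x $ i - a $ i) - real (m i) * freq a b i * (y $ i - a $ i)\<bar>"
      unfolding real_norm_def by (rule abs_cos_diff_le)
    also have "\<dots> = \<bar>real (m i) * freq a b i\<bar> * \<bar>(x - y) $ i\<bar>"
      unfolding abs_mult[symmetric] by (simp add: algebra_simps)
    also have "\<dots> \<le> \<bar>real (m i) * freq a b i\<bar> * norm (x - y)"
      by (intro mult_left_mono component_le_norm_cart) auto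
    finally show "norm (cos (real (m i) * freq a b i * (x $ i - a $ i)) - cos (real (m i) * freq a b i * (y $ i - a $ i)))
       \<le> \<bar>real (m i) * freq a b i\<bar> * norm (x - y)" .
  qed
  finally show "\<bar>mode a b m x - mode a b m y\<bar> \<le> (\<Sum>i\<in>UNIV. \<bar>real (m i) * freq a b i\<bar>) * norm (x - y)"
    by (simp add: sum_distrib_right)
qed

lemma mode_sum_Lipschitz:
  "\<exists>L\<ge>0. \<forall>x y. \<bar>(\<Sum>m\<in>M. c m * mode a b m x) - (\<Sum>m\<in>M. c m * mode a b m y)\<bar> \<le> L * norm (x - y)"
proof -
  obtain L where L: "\<And>m. L m \<ge> 0" "\<And>m x y. \<bar>mode a b m x - mode a b m y\<bar> \<le> L m * norm (x - y)"
    using mode_Lipschitz[of a b] by metis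
  have "\<bar>(\<Sum>m\<in>M. c m * mode a b m x) - (\<Sum>m\<in>M. c m * mode a b m y)\<bar> \<le> (\<Sum>m\<in>M. \<bar>c m\<bar> * L m) * norm (x - y)" for x y
  proof -
    have "\<bar>(\<Sum>m\<in>M. c m * mode a b m x) - (\<Sum>m\<in>M. c m * mode a b m y)\<bar> = \<bar>\<Sum>m\<in>M. c m * (mode a b m x - mode a b m y)\<bar>"
      by (simp add: sum_subtractf right_diff_distrib)
    also have "\<dots> \<le> (\<Sum>m\<in>M. \<bar>c m * (mode a b m x - mode a b m y)\<bar>)" by (rule sum_abs)
    also have "\<dots> \<le> (\<Sum>m\<in>M. \<bar>c m\<bar> * (L m * norm (x - y)))"
      unfolding abs_mult by (intro sum_mono mult_left_mono L) auto
    finally show ?thesis by (simp add: sum_distrib_right mult.assoc)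
  qed
  moreover have "(\<Sum>m\<in>M. \<bar>c m\<bar> * L m) \<ge> 0" using L(1) by (intro sum_nonneg) auto
  ultimately show ?thesis by blast
qed

text \<open>Along the line from \<open>x0\<close> to \<open>y\<close> the sum extends to an entire
  function of one complex variable. It vanishes near 0 on the real axis, so by the identity theorem
  also at 1, the parameter of \<open>y\<close>.\<close>

lemma mode_sum_unique_continuation:
  fixes a b :: "real^'n"
  assumes U: "open U" "x0 \<in> U" and zero: "\<And>x. x \<in> U \<Longrightarrow> (\<Sum>m\<in>M. c m * mode a b m x) = 0"
  shows "(\<Sum>m\<in>M. c m * mode a b m y) = 0"
proof -
  define G :: "complex \<Rightarrow> complex" where
    "G z = (\<Sum>m\<in>M. of_real (c m) * (\<Prod>i\<in>UNIV. cos (of_real (real (m i) * freq a b i) * (of_real (x0 $ i - a $ i) + z * of_real (y $ i - x0 $ i)))))" for z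
  have hol: "G holomorphic_on UNIV" unfolding G_def by (intro holomorphic_intros)
  have G: "G (of_real s) = of_real (\<Sum>m\<in>M. c m * mode a b m (x0 + s *\<^sub>R (y - x0)))" for s :: real
  proof -
    have "cos (of_real (real (m i) * freq a b i) * (of_real (x0 $ i - a $ i) + of_real s * of_real (y $ i - x0 $ i)))
      = (of_real (cos (real (m i) * freq a b i * ((x0 + s *\<^sub>R (y - x0)) $ i - a $ i))) :: complex)" for m i
      unfolding of_real_mult[symmetric] of_real_add[symmetric] cos_of_real[symmetric]
      by (simp add: algebra_simps)
    thus ?thesis unfolding G_def mode_def by simp
  qed
  obtain e where e: "e > 0" "ball x0 e \<subseteq> U" using U open_contains_ball by blast
  \<comment> \<open>Parameters below \<open>r\<close> stay in the ball around \<open>x0\<close>; the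
    added 1 covers \<open>y = x0\<close>.\<close>
  define r where "r = e / (norm (y - x0) + 1)"
  have np: "norm (y - x0) + 1 > 0" by (smt (verit) norm_ge_zero)
  have r: "r > 0" using e np by (simp add: r_def)
  define S where "S = of_real ` {-r<..<r} - {0::complex}"
  have inS: "G z = 0" if "z \<in> S" for z
  proof -
    obtain s where s: "z = of_real s" "\<bar>s\<bar> < r" using \<open>z \<in> S\<close> by (auto simp: S_def)
    have "\<bar>s\<bar> * norm (y - x0) \<le> r * norm (y - x0)" using s by (intro mult_right_mono) auto
    also have "\<dots> < e" using np e unfolding r_def by (simp add: field_simps)
    finally have "x0 + s *\<^sub>R (y - x0) \<in> U" using e(2) by (auto simp: dist_norm subset_iff)
    from zero[OF this] show ?thesis unfolding s(1) G by simp
  qed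
  have lim: "0 islimpt S"
    unfolding islimpt_approachable
  proof (intro allI impI)
    fix d :: real assume "d > 0"
    define t where "t = min d r / 2"
    have t: "0 < t" "t < d" "t < r" using \<open>d > 0\<close> r by (auto simp: t_def)
    thus "\<exists>x'\<in>S. x' \<noteq> 0 \<and> dist x' 0 < d"
      by (intro bexI[of _ "of_real t"]) (auto simp: S_def)
  qed
  have "G 1 = 0"
    by (rule analytic_continuation[OF hol _ _ _ _ lim inS]) auto
  thus ?thesis using G[of 1] by (simp flip: of_real_mult of_real_sum)
qed

subsection \<open>Multiplying an eigenfunction by constants on its nodal domains\<close>

text \<open>The excluded hyperplane consists of the points sent onto the face, outside the open
  box.\<close>

lemma shift_up_near:
  assumes "0 < h" "h < b $ i - a $ i" "x \<in> box a b" "x $ i \<noteq> b $ i - h"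
  shows "shift_up b i h x \<in> box a b" "norm (shift_up b i h x - x) \<le> h"
proof -
  have x: "a $ j < x $ j" "x $ j < b $ j" for j using assms(3) by (auto simp: mem_box_cart)
  hence others: "\<forall>j. j \<noteq> i \<longrightarrow> a $ j < x $ j \<and> x $ j < b $ j" by blast
  show "shift_up b i h x \<in> box a b" "norm (shift_up b i h x - x) \<le> h"
    unfolding shift_up_def upd_in_box_iff norm_upd_diff
    using others assms(1,2,4) x(1)[of i] x(2)[of i] by (auto simp: abs_le_iff split: if_splits)
qed

lemma shift_down_near:
  assumes "0 < h" "h < b $ i - a $ i" "x \<in> box a b" "x $ i \<noteq> a $ i + h"
  shows "shift_down a i h x \<in> box a b" "norm (shift_down a i h x - x) \<le> h"
proof -
  have x: "a $ j < x $ j" "x $ j < b $ j" for j using assms(3) by (auto simp: mem_box_cart)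
  hence others: "\<forall>j. j \<noteq> i \<longrightarrow> a $ j < x $ j \<and> x $ j < b $ j" by blast
  show "shift_down a i h x \<in> box a b" "norm (shift_down a i h x - x) \<le> h"
    unfolding shift_down_def upd_in_box_iff norm_upd_diff
    using others assms(1,2,4) x(1)[of i] x(2)[of i] by (auto simp: abs_le_iff split: if_splits)
qed

text \<open>Multipliers that may jump only across zeros of the eigenfunction. Quantifying over
  connected subsets instead of components lets segments and balls be used directly.\<close>

definition constant_on_connected :: "('a::topological_space \<Rightarrow> real) \<Rightarrow> 'a set \<Rightarrow> bool" where
  "constant_on_connected k N \<longleftrightarrow> (\<forall>S x y. connected S \<and> S \<subseteq> N \<and> x \<in> S \<and> y \<in> S \<longrightarrow> k x = k y)"

lemma constant_on_connectedD:
  "constant_on_connected k N \<Longrightarrow> connected S \<Longrightarrow> S \<subseteq> N \<Longrightarrow> x \<in> S \<Longrightarrow> y \<in> S \<Longrightarrow> k x = k y"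
  unfolding constant_on_connected_def by blast

text \<open>If the multiplier differs, the segment from \<open>x\<close> to \<open>y\<close> cannot
  avoid the zeros of \<open>P\<close>; the Lipschitz bounds on the two sides of a zero add up along
  the segment.\<close>

lemma zero_between_nodal_domains:
  fixes P :: "real^'n \<Rightarrow> real"
  assumes k: "constant_on_connected k {x \<in> box a b. P x \<noteq> 0}"
    and L: "L \<ge> 0" "\<And>x y. \<bar>P x - P y\<bar> \<le> L * norm (x - y)"
    and xy: "x \<in> box a b" "y \<in> box a b" "k x \<noteq> k y"
  shows "\<bar>P x\<bar> + \<bar>P y\<bar> \<le> L * norm (x - y) \<or> P x = 0 \<or> P y = 0"
proof (cases "\<exists>z\<in>closed_segment x y. P z = 0")
  case True
  then obtain z where z: "z \<in> closed_segment x y" "P z = 0" by blast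
  have "\<bar>P x\<bar> + \<bar>P y\<bar> \<le> L * norm (x - z) + L * norm (z - y)"
    using L(2)[of x z] L(2)[of z y] z(2) by simp
  also have "\<dots> = L * (norm (x - z) + norm (z - y))" by (simp add: distrib_left)
  also have "norm (x - z) + norm (z - y) = norm (x - y)"
    using z(1) between[of x y z] by (simp add: between_mem_segment dist_norm)
  finally show ?thesis by simp
next
  case False
  hence "closed_segment x y \<subseteq> {x \<in> box a b. P x \<noteq> 0}"
    using closed_segment_subset[OF xy(1,2) convex_box(2)] by auto
  from constant_on_connectedD[OF k connected_segment(1) this, of x y] xy(3) show ?thesis by auto
qed

text \<open>Where \<open>k\<close> jumps, both values of \<open>P\<close> are bounded by the
  Lipschitz constant times the distance, so the product is Lipschitz although \<open>k\<close> is
  discontinuous.\<close>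

lemma nodal_multiple_Lipschitz:
  fixes P :: "real^'n \<Rightarrow> real"
  assumes k: "constant_on_connected k {x \<in> box a b. P x \<noteq> 0}" and K: "\<And>x. \<bar>k x\<bar> \<le> K"
    and L: "L \<ge> 0" "\<And>x y. \<bar>P x - P y\<bar> \<le> L * norm (x - y)"
    and xy: "x \<in> box a b" "y \<in> box a b"
  shows "\<bar>k x * P x - k y * P y\<bar> \<le> K * L * norm (x - y)"
proof -
  have K0: "K \<ge> 0" using K[of x] by linarith
  have le: "\<bar>P x\<bar> \<le> L * norm (x - y)" if "P y = 0" using L(2)[of x y] that by simp
  have le': "\<bar>P y\<bar> \<le> L * norm (x - y)" if "P x = 0" using L(2)[of x y] that by simp
  consider "k x = k y" | "\<bar>P x\<bar> + \<bar>P y\<bar> \<le> L * norm (x - y)"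
    using zero_between_nodal_domains[OF k L xy] le le' by fastforce
  thus ?thesis
  proof cases
    case 1
    have "\<bar>k x * P x - k y * P y\<bar> = \<bar>k x\<bar> * \<bar>P x - P y\<bar>" by (simp add: 1 right_diff_distrib abs_mult[symmetric])
    also have "\<dots> \<le> K * (L * norm (x - y))" using K K0 L by (intro mult_mono) auto
    finally show ?thesis by (simp add: mult.assoc)
  next
    case 2
    have "\<bar>k x * P x - k y * P y\<bar> \<le> \<bar>k x\<bar> * \<bar>P x\<bar> + \<bar>k y\<bar> * \<bar>P y\<bar>"
      unfolding abs_mult[symmetric] by (rule abs_triangle_ineq4)
    also have "\<dots> \<le> K * \<bar>P x\<bar> + K * \<bar>P y\<bar>" by (intro add_mono mult_right_mono K) auto
    also have "\<dots> = K * (\<bar>P x\<bar> + \<bar>P y\<bar>)" by (simp add: distrib_left)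
    also have "\<dots> \<le> K * (L * norm (x - y))" by (intro mult_left_mono 2 K0)
    finally show ?thesis by (simp add: mult.assoc)
  qed
qed

text \<open>
  Pointwise, \<open>\<psi>(2\<psi> - \<psi>\<^sub>+ - \<psi>\<^sub>-)\<close> with \<open>\<psi> = kP\<close> is \<open>k\<^sup>2P(2P - P\<^sub>+ - P\<^sub>-)\<close> plus half of the sum of
  \<open>(k - k\<^sub>\<plusminus>)\<^sup>2 P P\<^sub>\<plusminus>\<close>, plus a term that integrates to zero by the symmetry of the reflecting shifts.
\<close>
lemma second_diff_nodal_multiple:
  fixes a b :: "real^'n"
  assumes h: "0 < h" "h < b $ i - a $ i" and k: "bounded_borel k" and P: "bounded_borel P"
  shows "ip a b (\<lambda>x. k x * P x) (second_diff a b i h (\<lambda>x. k x * P x)) =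
    ip a b (\<lambda>x. (k x)\<^sup>2 * P x) (second_diff a b i h P) +
    ip a b P (\<lambda>x. ((k x - k (shift_up b i h x))\<^sup>2 * P (shift_up b i h x) +
                    (k x - k (shift_down a i h x))\<^sup>2 * P (shift_down a i h x))) / 2"
proof -
  let ?u = "shift_up b i h" and ?d = "shift_down a i h"
  let ?kP = "\<lambda>x. (k x)\<^sup>2 * P x"
  let ?R = "\<lambda>x. (k x - k (?u x))\<^sup>2 * P (?u x) + (k x - k (?d x))\<^sup>2 * P (?d x)"
  have bb: "bounded_borel ?kP" by (intro bounded_borel_mult bounded_borel_power k P)
  have bR: "bounded_borel ?R"
    by (intro bounded_borel_add bounded_borel_mult bounded_borel_power bounded_borel_diff bounded_borel_shift k P)
  have bs: "bounded_borel (\<lambda>x. P (?u x) + P (?d x))" "bounded_borel (\<lambda>x. ?kP (?u x) + ?kP (?d x))"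
    by (intro bounded_borel_add bounded_borel_shift[of ?kP] bounded_borel_shift bb P)+
  note int = integrable_ip
  have sym: "ip a b ?kP (\<lambda>x. P (?u x) + P (?d x)) = ip a b P (\<lambda>x. ?kP (?u x) + ?kP (?d x))"
    using ip_reflect_symmetric[OF h bb P] by (simp add: ip_commute)
  have "ip a b (\<lambda>x. k x * P x) (second_diff a b i h (\<lambda>x. k x * P x)) =
     (LINT x|lborel. (indicat_real (box a b) x * (?kP x * second_diff a b i h P x) +
        indicat_real (box a b) x * (P x * ?R x) / 2) +
        (indicat_real (box a b) x * (?kP x * (P (?u x) + P (?d x))) - indicat_real (box a b) x * (P x * (?kP (?u x) + ?kP (?d x)))) / 2)"
    unfolding ip_def
    by (rule Bochner_Integration.integral_cong[OF refl]) (simp add: second_diff_def indicator_def power2_eq_square field_simps)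
  also have "\<dots> = (ip a b ?kP (second_diff a b i h P) + ip a b P ?R / 2) +
      (ip a b ?kP (\<lambda>x. P (?u x) + P (?d x)) - ip a b P (\<lambda>x. ?kP (?u x) + ?kP (?d x))) / 2"
    unfolding ip_def
    by (simp only: Bochner_Integration.integral_add Bochner_Integration.integral_diff integral_divide_zero
        Bochner_Integration.integrable_add Bochner_Integration.integrable_diff integrable_divide_zero
        int[OF bb bounded_borel_second_diff[OF P]] int[OF P bR] int[OF bb bs(1)] int[OF P bs(2)] refl)
  finally show ?thesis unfolding sym by simp
qed

text \<open>Dominated convergence. A point of the box with \<open>P\<close> nonzero has a ball
  inside its nodal domain, so the defect there is 0 for small \<open>h\<close>; at zeros of
  \<open>P\<close> the factor in front is 0. A dominating constant exists because a change of
  \<open>k\<close> forces \<open>P\<close> to be of order \<open>h\<close> at both points.\<close>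

lemma nodal_defect_limit:
  fixes a b :: "real^'n" and P k :: "real^'n \<Rightarrow> real" and h :: "nat \<Rightarrow> real"
  assumes k: "constant_on_connected k {x \<in> box a b. P x \<noteq> 0}" "bounded_borel k"
    and P: "bounded_borel P" "continuous_on UNIV P"
    and L: "L \<ge> 0" "\<And>x y. \<bar>P x - P y\<bar> \<le> L * norm (x - y)"
    and h: "\<And>n. 0 < h n" "\<And>n. h n < b $ i - a $ i" "h \<longlonglongrightarrow> 0"
  shows "(\<lambda>n. ip a b P (\<lambda>x. ((k x - k (shift_up b i (h n) x))\<^sup>2 * P (shift_up b i (h n) x) +
                    (k x - k (shift_down a i (h n) x))\<^sup>2 * P (shift_down a i (h n) x))) / (h n)\<^sup>2) \<longlonglongrightarrow> 0"
proof -
  obtain K where K: "K \<ge> 0" "\<And>x. \<bar>k x\<bar> \<le> K" using bounded_borelE[OF k(2)] by blast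
  define N where "N = {x \<in> box a b. P x \<noteq> 0}"
  have N: "open N"
  proof -
    have "N = box a b \<inter> P -` (-{0})" by (auto simp: N_def)
    moreover have "open (P -` (-{0}))" using P(2) by (intro open_vimage) auto
    ultimately show ?thesis using open_box[of a b] by (metis open_Int)
  qed
  define R where "R n x = (k x - k (shift_up b i (h n) x))\<^sup>2 * P (shift_up b i (h n) x) +
                    (k x - k (shift_down a i (h n) x))\<^sup>2 * P (shift_down a i (h n) x)" for n x
  have R: "bounded_borel (R n)" for n
    unfolding R_def[abs_def]
    by (intro bounded_borel_add bounded_borel_mult bounded_borel_power bounded_borel_diff bounded_borel_shift k P)
  define s where "s n x = indicat_real (box a b) x * (P x * R n x) / (h n)\<^sup>2" for n x
  have [measurable]: "P \<in> borel_measurable borel" "R n \<in> borel_measurable borel" for n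
    using P R by (auto simp: bounded_borel_def)
  \<comment> \<open>One bound \<open>(2 * K)^2 * (L * h)^2 / h^2\<close> for each of the two
    shifts.\<close>
  define B where "B = 2 * (4 * K\<^sup>2 * L\<^sup>2)"
  have one: "\<bar>P x * ((k x - k y)\<^sup>2 * P y)\<bar> \<le> 4 * K\<^sup>2 * L\<^sup>2 * d\<^sup>2"
    if "x \<in> box a b" "y \<in> box a b" "norm (y - x) \<le> d" for x y d
  proof (cases "k x = k y \<or> P x = 0 \<or> P y = 0")
    case False
    hence le: "\<bar>P x\<bar> + \<bar>P y\<bar> \<le> L * norm (x - y)"
      using zero_between_nodal_domains[OF k(1) L that(1,2)] by auto
    also have "\<dots> \<le> L * d" using that(3) L by (intro mult_left_mono) (auto simp: norm_minus_commute)
    finally have "\<bar>P x\<bar> \<le> L * d" "\<bar>P y\<bar> \<le> L * d" by auto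
    moreover have "(k x - k y)\<^sup>2 \<le> (2 * K)\<^sup>2"
      by (rule power2_le_iff_abs_le[THEN iffD2]) (use K(1) K(2)[of x] K(2)[of y] in auto)
    moreover have "L * d \<ge> 0" using \<open>\<bar>P x\<bar> \<le> L * d\<close> by linarith
    ultimately have "\<bar>P x\<bar> * ((k x - k y)\<^sup>2 * \<bar>P y\<bar>) \<le> (L * d) * ((2 * K)\<^sup>2 * (L * d))"
      by (intro mult_mono) auto
    thus ?thesis by (simp add: abs_mult power2_eq_square mult_ac)
  qed auto
  have "(\<lambda>n. integral\<^sup>L lborel (s n)) \<longlonglongrightarrow> (LINT x|(lborel::(real^'n) measure). (0::real))"
  proof (rule integral_dominated_convergence)
    show "integrable lborel (\<lambda>x. indicat_real (box a b) x * B)"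
      by (rule integrable_bounded_borel_box[OF bounded_borel_const])
    show "s n \<in> borel_measurable lborel" for n unfolding s_def by measurable
    show "AE x in lborel. norm (s n x) \<le> indicat_real (box a b) x * B" for n
      using AE_vec_nth_neq[of i "b $ i - h n"] AE_vec_nth_neq[of i "a $ i + h n"]
    proof eventually_elim
      case (elim x)
      show ?case
      proof (cases "x \<in> box a b")
        case True
        note u = shift_up_near[OF h(1) h(2) True elim(1)] and d = shift_down_near[OF h(1) h(2) True elim(2)]
        have "\<bar>P x * R n x\<bar> \<le> \<bar>P x * ((k x - k (shift_up b i (h n) x))\<^sup>2 * P (shift_up b i (h n) x))\<bar> +
            \<bar>P x * ((k x - k (shift_down a i (h n) x))\<^sup>2 * P (shift_down a i (h n) x))\<bar>"
          unfolding R_def distrib_left by (rule abs_triangle_ineq)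
        also have "\<dots> \<le> B * (h n)\<^sup>2"
          using one[OF True u] one[OF True d] by (simp add: B_def)
        finally have "\<bar>P x * R n x\<bar> / (h n)\<^sup>2 \<le> B" using h(1)[of n] by (simp add: field_simps)
        thus ?thesis using True by (simp add: s_def)
      qed (simp add: s_def)
    qed
    show "AE x in lborel. (\<lambda>n. s n x) \<longlonglongrightarrow> 0"
    proof (rule AE_I2)
      fix x
      show "(\<lambda>n. s n x) \<longlonglongrightarrow> 0"
      proof (cases "x \<in> N")
        case True
        obtain e where e: "e > 0" "ball x e \<subseteq> N" using N True open_contains_ball by blast
        have "x \<in> box a b" using True by (simp add: N_def)
        hence xi: "a $ i < x $ i" "x $ i < b $ i" by (auto simp: mem_box_cart)
        define d where "d = min e (min (x $ i - a $ i) (b $ i - x $ i))"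
        have d: "d > 0" using e xi by (simp add: d_def)
        have "eventually (\<lambda>n. h n < d) sequentially" using order_tendstoD(2)[OF h(3) d] .
        hence "eventually (\<lambda>n. s n x = 0) sequentially"
        proof eventually_elim
          case (elim n)
          hence lt: "h n < e" "x $ i + h n < b $ i" "a $ i < x $ i - h n" by (auto simp: d_def)
          have "shift_up b i (h n) x \<in> ball x e" "shift_down a i (h n) x \<in> ball x e"
            using lt h(1)[of n] by (auto simp: shift_up_def shift_down_def dist_norm norm_minus_commute[of x] norm_upd_diff)
          hence "k x = k (shift_up b i (h n) x)" "k x = k (shift_down a i (h n) x)"
            using constant_on_connectedD[OF k(1)[folded N_def] connected_ball e(2)] e(1) by (metis centre_in_ball)+
          thus ?case by (simp add: s_def R_def)
        qed
        thus ?thesis by (rule tendsto_eventually)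
      next
        case False
        hence "s n x = 0" for n by (auto simp: s_def N_def indicator_def)
        thus ?thesis by simp
      qed
    qed
  qed auto
  moreover have "integral\<^sup>L lborel (s n) = ip a b P (R n) / (h n)\<^sup>2" for n
    unfolding s_def[abs_def] ip_def by (rule integral_divide_zero)
  ultimately show ?thesis unfolding R_def[abs_def] by simp
qed

text \<open>\<open>2 - 2 * cos y\<close> is four times the square of \<open>sin (y / 2)\<close>, and
  the remaining limit is a derivative at 0.\<close>

lemma second_diff_symbol_limit:
  fixes h :: "nat \<Rightarrow> real"
  assumes h: "\<And>n. 0 < h n" "h \<longlonglongrightarrow> 0"
  shows "(\<lambda>n. (2 - 2 * cos (c * h n)) / (h n)\<^sup>2) \<longlonglongrightarrow> c\<^sup>2"
proof -
  have "((\<lambda>t. sin (c * t / 2)) has_real_derivative c / 2) (at 0)"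
    by (auto intro!: derivative_eq_intros)
  hence "((\<lambda>t. sin (c * t / 2) / t) \<longlongrightarrow> c / 2) (at 0)"
    by (simp add: DERIV_def)
  moreover have "filterlim h (at 0) sequentially"
    using h by (auto intro!: filterlim_atI always_eventually less_imp_neq[THEN not_sym])
  ultimately have "(\<lambda>n. sin (c * h n / 2) / h n) \<longlonglongrightarrow> c / 2"
    by (rule filterlim_compose)
  hence "(\<lambda>n. 4 * (sin (c * h n / 2) / h n)\<^sup>2) \<longlonglongrightarrow> 4 * (c / 2)\<^sup>2"
    by (intro tendsto_mult tendsto_power tendsto_const)
  moreover have "4 * (sin (c * h n / 2) / h n)\<^sup>2 = (2 - 2 * cos (c * h n)) / (h n)\<^sup>2" for n
  proof -
    have "cos (c * h n) = 1 - 2 * (sin (c * h n / 2))\<^sup>2"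
      using cos_double_sin[of "c * h n / 2"] by simp
    thus ?thesis by (simp only: power_divide) simp
  qed
  hence "(\<lambda>n. 4 * (sin (c * h n / 2) / h n)\<^sup>2) = (\<lambda>n. (2 - 2 * cos (c * h n)) / (h n)\<^sup>2)" by (rule ext)
  ultimately have "(\<lambda>n. (2 - 2 * cos (c * h n)) / (h n)\<^sup>2) \<longlonglongrightarrow> 4 * (c / 2)\<^sup>2" by (simp only:)
  also have "4 * (c / 2)\<^sup>2 = c\<^sup>2" by (simp add: power2_eq_square)
  finally show ?thesis .
qed

lemma vanishing_steps:
  fixes a b :: "real^'n"
  assumes ab: "\<And>i. a $ i < b $ i"
  obtains h :: "nat \<Rightarrow> real" where "\<And>n. 0 < h n" "\<And>n i. h n < b $ i - a $ i" "h \<longlonglongrightarrow> 0"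
proof -
  define d where "d = Min (range (\<lambda>i. b $ i - a $ i))"
  have d: "d > 0" "\<And>i. d \<le> b $ i - a $ i" unfolding d_def using ab by auto
  define h where "h n = d / 2 * inverse (real (Suc n))" for n
  have "h n < b $ i - a $ i" for n i
  proof -
    have "inverse (real (Suc n)) \<le> 1" by (simp add: field_simps)
    hence "h n \<le> d / 2 * 1" unfolding h_def using d by (intro mult_left_mono) auto
    thus ?thesis using d(1) d(2)[of i] by linarith
  qed
  moreover have "h \<longlonglongrightarrow> 0"
    unfolding h_def using tendsto_mult_left[OF LIMSEQ_inverse_real_of_nat, of "d / 2"] by simp
  moreover have "0 < h n" for n using d(1) by (simp add: h_def)
  ultimately show ?thesis using that by blast
qed

lemma mode_sum_second_diff_limit:
  fixes a b :: "real^'n"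
  assumes ab: "\<And>i. a $ i < b $ i" and g: "bounded_borel g"
    and h: "\<And>n. 0 < h n" "h \<longlonglongrightarrow> 0"
    and M: "\<And>m. m \<in> M \<Longrightarrow> energy a b m = mu"
  shows "(\<lambda>n. \<Sum>i\<in>UNIV. ip a b g (second_diff a b i (h n) (\<lambda>x. \<Sum>m\<in>M. c m * mode a b m x)) / (h n)\<^sup>2)
    \<longlonglongrightarrow> mu * ip a b g (\<lambda>x. \<Sum>m\<in>M. c m * mode a b m x)"
proof -
  have "ip a b g (second_diff a b i t (\<lambda>x. \<Sum>m\<in>M. c m * mode a b m x)) =
     (\<Sum>m\<in>M. (c m * ip a b g (mode a b m)) * (2 - 2 * cos (real (m i) * freq a b i * t)))" for i t
  proof -
    have "second_diff a b i t (\<lambda>x. \<Sum>m\<in>M. c m * mode a b m x) =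
       (\<lambda>x. \<Sum>m\<in>M. (c m * (2 - 2 * cos (real (m i) * freq a b i * t))) * mode a b m x)"
      by (rule ext) (simp add: second_diff_sum second_diff_mode[OF ab] mult_ac)
    thus ?thesis by (simp only: ip_mode_sum_right[OF g]) (simp add: mult_ac)
  qed
  hence eq: "(\<Sum>i\<in>UNIV. ip a b g (second_diff a b i (h n) (\<lambda>x. \<Sum>m\<in>M. c m * mode a b m x)) / (h n)\<^sup>2) =
     (\<Sum>i\<in>UNIV. \<Sum>m\<in>M. (c m * ip a b g (mode a b m)) * ((2 - 2 * cos (real (m i) * freq a b i * h n)) / (h n)\<^sup>2))" for n
    by (simp add: sum_divide_distrib)
  have "(\<lambda>n. \<Sum>i\<in>UNIV. \<Sum>m\<in>M. (c m * ip a b g (mode a b m)) * ((2 - 2 * cos (real (m i) * freq a b i * h n)) / (h n)\<^sup>2))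
     \<longlonglongrightarrow> (\<Sum>i\<in>UNIV. \<Sum>m\<in>M. (c m * ip a b g (mode a b m)) * (real (m i) * freq a b i)\<^sup>2)"
    by (intro tendsto_sum tendsto_mult tendsto_const second_diff_symbol_limit h)
  also have "(\<Sum>i\<in>UNIV. \<Sum>m\<in>M. (c m * ip a b g (mode a b m)) * (real (m i) * freq a b i)\<^sup>2) =
     (\<Sum>m\<in>M. \<Sum>i\<in>UNIV. (c m * ip a b g (mode a b m)) * (real (m i) * freq a b i)\<^sup>2)"
    by (rule sum.swap)
  also have "\<dots> = (\<Sum>m\<in>M. (c m * ip a b g (mode a b m)) * mu)"
    by (rule sum.cong[OF refl]) (simp add: M[symmetric] energy_def sum_distrib_left)
  also have "\<dots> = mu * ip a b g (\<lambda>x. \<Sum>m\<in>M. c m * mode a b m x)"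
    unfolding ip_mode_sum_right[OF g] by (simp add: sum_distrib_left mult_ac)
  finally show ?thesis unfolding eq .
qed

text \<open>Bessel's inequality is summed over the axes, divided by \<open>h^2\<close>, and
  \<open>h\<close> tends to 0. The symbols on the left add up to \<open>energy\<close>; on the right
  the defect disappears and \<open>mu\<close> times the square of the norm is left.\<close>

lemma nodal_multiple_energy_le:
  fixes a b :: "real^'n" and c :: "('n \<Rightarrow> nat) \<Rightarrow> real"
  assumes ab: "\<And>i. a $ i < b $ i"
    and E: "\<And>m. m \<in> E \<Longrightarrow> energy a b m = mu"
    and P: "P = (\<lambda>x. \<Sum>m\<in>E. c m * mode a b m x)"
    and k: "constant_on_connected k {x \<in> box a b. P x \<noteq> 0}" "bounded_borel k" and M: "finite M"
  shows "(\<Sum>m\<in>M. energy a b m * (fcoeff a b (\<lambda>x. k x * P x) m)\<^sup>2 * mode_norm a b m)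
     \<le> mu * ip a b (\<lambda>x. k x * P x) (\<lambda>x. k x * P x)"
proof -
  have bP: "bounded_borel P" unfolding P by (rule bounded_borel_mode_sum)
  have cP: "continuous_on UNIV P" unfolding P by (rule continuous_mode_sum)
  obtain L where L: "L \<ge> 0" "\<And>x y. \<bar>P x - P y\<bar> \<le> L * norm (x - y)"
    unfolding P using mode_sum_Lipschitz[where M = E and c = c and a = a and b = b] by blast
  obtain h :: "nat \<Rightarrow> real" where h: "\<And>n. 0 < h n" "\<And>n i. h n < b $ i - a $ i" "h \<longlonglongrightarrow> 0"
    using vanishing_steps[OF ab] by blast
  let ?u = "\<lambda>x. k x * P x"
  define D where "D n = (\<Sum>i\<in>UNIV. ip a b ?u (second_diff a b i (h n) ?u) / (h n)\<^sup>2)" for n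
  define R where "R n i x = (k x - k (shift_up b i (h n) x))\<^sup>2 * P (shift_up b i (h n) x) +
                    (k x - k (shift_down a i (h n) x))\<^sup>2 * P (shift_down a i (h n) x)" for n i x
  have bu: "bounded_borel ?u" by (intro bounded_borel_mult k bP)
  have bk: "bounded_borel (\<lambda>x. (k x)\<^sup>2 * P x)" by (intro bounded_borel_mult bounded_borel_power k bP)
  have D_eq: "D n = (\<Sum>i\<in>UNIV. ip a b (\<lambda>x. (k x)\<^sup>2 * P x) (second_diff a b i (h n) P) / (h n)\<^sup>2) +
      (\<Sum>i\<in>UNIV. (ip a b P (R n i) / (h n)\<^sup>2) / 2)" for n
    unfolding D_def R_def second_diff_nodal_multiple[OF h(1) h(2) k(2) bP]
    by (simp add: sum.distrib add_divide_distrib mult.commute)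
  have "(\<lambda>n. (\<Sum>i\<in>UNIV. ip a b (\<lambda>x. (k x)\<^sup>2 * P x) (second_diff a b i (h n) P) / (h n)\<^sup>2) +
      (\<Sum>i\<in>UNIV. (ip a b P (R n i) / (h n)\<^sup>2) / 2)) \<longlonglongrightarrow> mu * ip a b (\<lambda>x. (k x)\<^sup>2 * P x) P + (\<Sum>i\<in>(UNIV::'n set). 0 / 2)"
  proof (intro tendsto_add tendsto_sum tendsto_divide tendsto_const)
    show "(\<lambda>n. \<Sum>i\<in>UNIV. ip a b (\<lambda>x. (k x)\<^sup>2 * P x) (second_diff a b i (h n) P) / (h n)\<^sup>2)
        \<longlonglongrightarrow> mu * ip a b (\<lambda>x. (k x)\<^sup>2 * P x) P"
      unfolding P by (rule mode_sum_second_diff_limit[OF ab _ h(1,3) E]) (use bk P in auto)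
    show "(\<lambda>n. ip a b P (R n i) / (h n)\<^sup>2) \<longlonglongrightarrow> 0" for i
      unfolding R_def by (rule nodal_defect_limit[OF k bP cP L h(1) h(2) h(3)])
  qed auto
  hence D1: "D \<longlonglongrightarrow> mu * ip a b (\<lambda>x. (k x)\<^sup>2 * P x) P"
    unfolding D_eq[symmetric] by simp
  have ipu: "ip a b (\<lambda>x. (k x)\<^sup>2 * P x) P = ip a b ?u ?u"
    unfolding ip_def by (rule Bochner_Integration.integral_cong) (auto simp: power2_eq_square)
  let ?F = "\<lambda>m. (fcoeff a b ?u m)\<^sup>2 * mode_norm a b m"
  have D2: "(\<lambda>n. \<Sum>i\<in>UNIV. \<Sum>m\<in>M. ((2 - 2 * cos (real (m i) * freq a b i * h n)) / (h n)\<^sup>2) * ?F m)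
     \<longlonglongrightarrow> (\<Sum>i\<in>UNIV. \<Sum>m\<in>M. (real (m i) * freq a b i)\<^sup>2 * ?F m)"
    by (intro tendsto_sum tendsto_mult tendsto_const second_diff_symbol_limit h)
  have "(\<Sum>i\<in>UNIV. \<Sum>m\<in>M. (real (m i) * freq a b i)\<^sup>2 * ?F m) = (\<Sum>m\<in>M. \<Sum>i\<in>UNIV. (real (m i) * freq a b i)\<^sup>2 * ?F m)"
    by (rule sum.swap)
  also have "\<dots> = (\<Sum>m\<in>M. energy a b m * (fcoeff a b ?u m)\<^sup>2 * mode_norm a b m)"
    by (rule sum.cong[OF refl]) (simp add: energy_def sum_distrib_right mult.assoc)
  finally have D2': "(\<lambda>n. \<Sum>i\<in>UNIV. \<Sum>m\<in>M. ((2 - 2 * cos (real (m i) * freq a b i * h n)) / (h n)\<^sup>2) * ?F m)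
     \<longlonglongrightarrow> (\<Sum>m\<in>M. energy a b m * (fcoeff a b ?u m)\<^sup>2 * mode_norm a b m)" using D2 by simp
  have "(\<Sum>i\<in>UNIV. \<Sum>m\<in>M. ((2 - 2 * cos (real (m i) * freq a b i * h n)) / (h n)\<^sup>2) * ?F m) \<le> D n" for n
    unfolding D_def
  proof (rule sum_mono)
    fix i
    have "(\<Sum>m\<in>M. ((2 - 2 * cos (real (m i) * freq a b i * h n)) / (h n)\<^sup>2) * ?F m) =
       (\<Sum>m\<in>M. (2 - 2 * cos (real (m i) * freq a b i * h n)) * (fcoeff a b ?u m)\<^sup>2 * mode_norm a b m) / (h n)\<^sup>2"
      by (simp add: sum_divide_distrib mult.assoc)
    also have "\<dots> \<le> ip a b ?u (second_diff a b i (h n) ?u) / (h n)\<^sup>2"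
      by (intro divide_right_mono second_diff_Bessel ab h bu M) auto
    finally show "(\<Sum>m\<in>M. ((2 - 2 * cos (real (m i) * freq a b i * h n)) / (h n)\<^sup>2) * ?F m)
      \<le> ip a b ?u (second_diff a b i (h n) ?u) / (h n)\<^sup>2" .
  qed
  from LIMSEQ_le[OF D2' D1] this show ?thesis unfolding ipu by blast
qed

text \<open>The mechanism behind Courant's theorem: such a multiple has Rayleigh quotient at most \<open>mu\<close>.\<close>
theorem nodal_multiple_eigenfunction:
  fixes a b :: "real^'n" and c :: "('n \<Rightarrow> nat) \<Rightarrow> real"
  assumes ab: "\<And>i. a $ i < b $ i" and mu: "mu \<ge> 0"
    and P: "P = (\<lambda>x. \<Sum>m\<in>{m. energy a b m = mu}. c m * mode a b m x)"
    and k: "constant_on_connected k {x \<in> box a b. P x \<noteq> 0}" "bounded_borel k"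
    and orth: "\<And>m. energy a b m < mu \<Longrightarrow> ip a b (\<lambda>x. k x * P x) (mode a b m) = 0"
  shows "\<exists>d. \<forall>x\<in>box a b. k x * P x = (\<Sum>m\<in>{m. energy a b m = mu}. d m * mode a b m x)"
proof -
  let ?E = "{m. energy a b m = mu}"
  let ?u = "\<lambda>x. k x * P x"
  have finE: "finite ?E" by (rule finite_energy_eq[OF ab])
  have bP: "bounded_borel P" unfolding P by (rule bounded_borel_mode_sum)
  have bu: "bounded_borel ?u" by (intro bounded_borel_mult k bP)
  obtain L where L: "L \<ge> 0" "\<And>x y. \<bar>P x - P y\<bar> \<le> L * norm (x - y)"
    unfolding P using mode_sum_Lipschitz[where M = ?E and c = c and a = a and b = b] by blast
  obtain K where K: "K \<ge> 0" "\<And>x. \<bar>k x\<bar> \<le> K" using bounded_borelE[OF k(2)] by blast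
  \<comment> \<open>The Lipschitz bound gives a continuous extension to the closed box, which
    Parseval and completeness ask for.\<close>
  have "(K * L)-lipschitz_on (box a b) ?u"
  proof (rule lipschitz_onI)
    show "dist (k x * P x) (k y * P y) \<le> K * L * dist x y" if "x \<in> box a b" "y \<in> box a b" for x y
      unfolding dist_norm real_norm_def by (rule nodal_multiple_Lipschitz[OF k(1) K(2) L that])
  qed (use K L in auto)
  hence "uniformly_continuous_on (box a b) ?u" by (rule lipschitz_on_uniformly_continuous)
  then obtain g where g: "uniformly_continuous_on (closure (box a b)) g" "\<And>x. x \<in> box a b \<Longrightarrow> ?u x = g x"
    by (rule uniformly_continuous_on_extension_on_closure) blast
  have "box a b \<noteq> {}" using ab by (auto simp: interval_ne_empty_cart)
  hence gc: "continuous_on (cbox a b) g"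
    using uniformly_continuous_imp_continuous[OF g(1)] by (simp add: closure_box)
  define F where "F = fcoeff a b ?u"
  have N: "mode_norm a b m > 0" for m by (rule mode_norm_pos[OF ab])
  have FN: "ip a b ?u (mode a b m) = F m * mode_norm a b m" for m
    using N[of m] by (simp add: F_def fcoeff_def)
  have low: "F m = 0" if "energy a b m < mu" for m
    using orth[OF that] by (simp add: F_def fcoeff_def)
  \<comment> \<open>Since no coefficient lies below \<open>mu\<close>, one above \<open>mu\<close>
    would lift the energy by at least \<open>gap\<close> over \<open>mu\<close> times the sum of the
    squared coefficients.\<close>
  have high: "F q = 0" if q: "energy a b q > mu" for q
  proof (rule ccontr)
    assume "F q \<noteq> 0"
    define G where "G m = (F m)\<^sup>2 * mode_norm a b m" for m
    have G0: "G m \<ge> 0" for m using N[of m] by (simp add: G_def)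
    have Gq: "G q > 0" using \<open>F q \<noteq> 0\<close> N[of q] by (simp add: G_def)
    define gap where "gap = (energy a b q - mu) * G q"
    have gap: "gap > 0" using q Gq by (simp add: gap_def)
    \<comment> \<open>So small that \<open>mu * e\<close> cannot absorb \<open>gap\<close>; the
      denominator has \<open>mu + 1\<close> because \<open>mu\<close> may be 0.\<close>
    define e where "e = gap / (2 * (mu + 1))"
    have e: "e > 0" "mu * e < gap"
    proof -
      show "e > 0" using gap mu by (simp add: e_def)
      have "mu * e \<le> (mu + 1) * e" using \<open>e > 0\<close> by (intro mult_right_mono) auto
      also have "\<dots> = gap / 2" using mu by (simp add: e_def field_simps)
      finally show "mu * e < gap" using gap by linarith
    qed
    obtain M where M: "finite M" "ip a b ?u ?u \<le> (\<Sum>m\<in>M. (fcoeff a b ?u m)\<^sup>2 * mode_norm a b m) + e"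
      using Parseval_le[OF ab bu gc g(2) e(1)] by blast
    define M' where "M' = insert q M"
    have M': "finite M'" using M by (simp add: M'_def)
    have "ip a b ?u ?u \<le> (\<Sum>m\<in>M'. G m) + e"
    proof -
      have "(\<Sum>m\<in>M. G m) \<le> (\<Sum>m\<in>M'. G m)"
        unfolding M'_def using M(1) G0 by (intro sum_mono2) auto
      thus ?thesis using M(2) by (simp add: G_def F_def)
    qed
    hence "mu * ip a b ?u ?u \<le> mu * ((\<Sum>m\<in>M'. G m) + e)" using mu by (rule mult_left_mono)
    moreover have "(\<Sum>m\<in>M'. energy a b m * G m) \<le> mu * ip a b ?u ?u"
      using nodal_multiple_energy_le[OF ab _ P k M', of mu] by (simp add: G_def F_def mult.assoc)
    moreover have "mu * (\<Sum>m\<in>M'. G m) + gap \<le> (\<Sum>m\<in>M'. energy a b m * G m)"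
    proof -
      have "gap = (\<Sum>m\<in>M'. if m = q then gap else 0)" using M' by (simp add: M'_def)
      hence "mu * (\<Sum>m\<in>M'. G m) + gap = (\<Sum>m\<in>M'. mu * G m + (if m = q then gap else 0))"
        by (simp add: sum.distrib sum_distrib_left)
      also have "\<dots> \<le> (\<Sum>m\<in>M'. energy a b m * G m)"
      proof (rule sum_mono)
        fix m
        show "mu * G m + (if m = q then gap else 0) \<le> energy a b m * G m"
        proof (cases "m = q")
          case True thus ?thesis by (simp add: gap_def algebra_simps)
        next
          case False
          show ?thesis
          proof (cases "energy a b m < mu")
            case True thus ?thesis using low[OF True] False by (simp add: G_def)
          next
            case False': False
            thus ?thesis using False G0[of m] by (simp add: mult_right_mono)
          qed
        qed
      qed
      finally show ?thesis .
    qed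
    ultimately show False using e(2) by (simp add: algebra_simps)
  qed
  let ?s = "\<lambda>x. \<Sum>m\<in>?E. F m * mode a b m x"
  have bs: "bounded_borel ?s" by (rule bounded_borel_mode_sum)
  have "?u x - ?s x = 0" if x: "x \<in> box a b" for x
  proof (rule mode_completeness[OF ab _ _ _ _ x, of "\<lambda>x. ?u x - ?s x" "\<lambda>x. g x - ?s x"])
    show "bounded_borel (\<lambda>x. ?u x - ?s x)" by (intro bounded_borel_diff bu bs)
    show "continuous_on (cbox a b) (\<lambda>x. g x - ?s x)" by (intro continuous_intros gc)
    show "ip a b (\<lambda>x. ?u x - ?s x) (mode a b m) = 0" for m
    proof -
      have "ip a b (\<lambda>x. ?u x - ?s x) (mode a b m) = F m * mode_norm a b m - (if m \<in> ?E then F m * mode_norm a b m else 0)"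
        unfolding ip_diff_left[OF bounded_borel_mode bu bs] FN ip_mode_sum_mode[OF ab finE] ..
      moreover have "F m = 0" if "m \<notin> ?E"
        using that low[of m] high[of m] by (cases "energy a b m < mu") auto
      ultimately show ?thesis by (cases "m \<in> ?E") simp_all
    qed
  qed (use g in auto)
  thus ?thesis by (intro exI[of _ F]) auto
qed

text \<open>Gaussian elimination, one equation at a time: \<open>M'\<close> eliminates the pivot
  unknown \<open>p\<close>, and \<open>d\<close> recovers its coefficient.\<close>

lemma linear_dependence:
  fixes A :: "'a set" and B :: "'b set" and M :: "'a \<Rightarrow> 'b \<Rightarrow> real"
  assumes "finite B" "finite A" "card B < card A"
  shows "\<exists>c. (\<exists>x\<in>A. c x \<noteq> 0) \<and> (\<forall>y\<in>B. (\<Sum>x\<in>A. c x * M x y) = 0)"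
  using assms
proof (induction B arbitrary: A M rule: finite_induct)
  case empty
  hence "A \<noteq> {}" by auto
  thus ?case by (intro exI[of _ "\<lambda>_. 1"]) auto
next
  case (insert y B)
  show ?case
  proof (cases "\<exists>p\<in>A. M p y \<noteq> 0")
    case False
    have "card B < card A" using insert.prems insert.hyps by simp
    from insert.IH[OF insert.prems(1) this, of M]
    obtain c where c: "\<exists>x\<in>A. c x \<noteq> 0" "\<forall>z\<in>B. (\<Sum>x\<in>A. c x * M x z) = 0" by blast
    have "(\<Sum>x\<in>A. c x * M x y) = 0" by (rule sum.neutral) (use False in simp)
    thus ?thesis using c by (intro exI[of _ c]) simp
  next
    case True
    then obtain p where p: "p \<in> A" "M p y \<noteq> 0" by blast
    define A' where "A' = A - {p}"
    have A': "finite A'" "card B < card A'" "p \<notin> A'" "A = insert p A'"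
      using insert.prems insert.hyps p by (auto simp: A'_def)
    define M' where "M' x z = M x z - M x y / M p y * M p z" for x z
    obtain c where c: "\<exists>x\<in>A'. c x \<noteq> 0" "\<forall>z\<in>B. (\<Sum>x\<in>A'. c x * M' x z) = 0"
      using insert.IH[OF A'(1,2), of M'] by blast
    define d where "d x = (if x = p then - (\<Sum>x\<in>A'. c x * M x y) / M p y else c x)" for x
    have sum: "(\<Sum>x\<in>A. d x * M x z) = (\<Sum>x\<in>A'. c x * M' x z)" for z
    proof -
      have "(\<Sum>x\<in>A. d x * M x z) = d p * M p z + (\<Sum>x\<in>A'. d x * M x z)"
        using A' by simp
      also have "(\<Sum>x\<in>A'. d x * M x z) = (\<Sum>x\<in>A'. c x * M x z)"
        using A'(3) by (intro sum.cong) (auto simp: d_def)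
      also have "d p * M p z = - (\<Sum>x\<in>A'. c x * (M x y / M p y * M p z))"
      proof -
        have "(\<Sum>x\<in>A'. c x * (M x y / M p y * M p z)) = (\<Sum>x\<in>A'. c x * M x y) * (M p z / M p y)"
          unfolding sum_distrib_right by (rule sum.cong) auto
        thus ?thesis by (simp add: d_def)
      qed
      finally show ?thesis by (simp add: M'_def right_diff_distrib sum_subtractf)
    qed
    have "(\<Sum>x\<in>A. d x * M x y) = 0" unfolding sum using p by (simp add: M'_def)
    moreover have "\<exists>x\<in>A. d x \<noteq> 0" using c(1) A' by (auto simp: d_def)
    ultimately show ?thesis using c(2) sum by (intro exI[of _ d]) auto
  qed
qed

subsection \<open>Nodal domains and reflections\<close>

definition eigsum :: "real^'n \<Rightarrow> real^'n \<Rightarrow> real \<Rightarrow> (('n \<Rightarrow> nat) \<Rightarrow> real) \<Rightarrow> real^'n \<Rightarrow> real" where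
  "eigsum a b mu c x = (\<Sum>m\<in>{m. energy a b m = mu}. c m * mode a b m x)"

lemma nodal_domains_alt: "nodal_domains S P = components {x \<in> S. P x \<noteq> 0}"
proof -
  have "S - P -` {0} = {x \<in> S. P x \<noteq> 0}" by auto
  thus ?thesis by (simp add: nodal_domains_def)
qed

lemma bounded_borel_eigsum: "bounded_borel (eigsum a b mu c)"
  unfolding eigsum_def[abs_def] by (rule bounded_borel_mode_sum)

lemma continuous_eigsum: "continuous_on S (eigsum a b mu c)"
  unfolding eigsum_def[abs_def] by (rule continuous_mode_sum)

lemma eigsum_unique_continuation:
  assumes "open U" "x0 \<in> U" "\<And>x. x \<in> U \<Longrightarrow> eigsum a b mu c x = 0"
  shows "eigsum a b mu c y = 0"
  using mode_sum_unique_continuation[OF assms(1,2)] assms(3) unfolding eigsum_def by blast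

lemma open_nonzero_set:
  fixes P :: "real^'n \<Rightarrow> real"
  assumes "continuous_on UNIV P"
  shows "open {x \<in> box a b. P x \<noteq> 0}"
proof -
  have "{x \<in> box a b. P x \<noteq> 0} = box a b \<inter> P -` (-{0})" by auto
  moreover have "open (P -` (-{0}))" using assms by (intro open_vimage) auto
  ultimately show ?thesis using open_box[of a b] by (metis open_Int)
qed

lemma open_nodal_domain:
  assumes "D \<in> nodal_domains (box a b) (eigsum a b mu c)"
  shows "open D"
  using assms open_components[OF open_nonzero_set[OF continuous_eigsum]] unfolding nodal_domains_alt by blast

lemma nodal_domainD:
  assumes "D \<in> nodal_domains S P"
  shows "connected D" "D \<noteq> {}" "\<And>x. x \<in> D \<Longrightarrow> x \<in> S" "\<And>x. x \<in> D \<Longrightarrow> P x \<noteq> 0"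
  using assms in_components_connected in_components_nonempty in_components_subset
  unfolding nodal_domains_alt by fast+

lemma nodal_domains_disjoint:
  assumes "D \<in> nodal_domains S P" "D' \<in> nodal_domains S P" "x \<in> D" "x \<in> D'"
  shows "D = D'"
  using assms components_nonoverlap[of D "{x \<in> S. P x \<noteq> 0}" D'] unfolding nodal_domains_alt by blast

lemma connected_subset_nodal_domain:
  assumes "D \<in> nodal_domains S P" "connected T" "T \<subseteq> {x \<in> S. P x \<noteq> 0}" "x \<in> T" "x \<in> D"
  shows "T \<subseteq> D"
  using components_maximal[of D "{x \<in> S. P x \<noteq> 0}" T] assms unfolding nodal_domains_alt by blast

lemma constant_on_connected_indicator:
  assumes "D \<in> nodal_domains S P"
  shows "constant_on_connected (indicat_real D) {x \<in> S. P x \<noteq> 0}"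
  unfolding constant_on_connected_def
proof (intro allI impI, elim conjE)
  fix T x y assume T: "connected T" "T \<subseteq> {x \<in> S. P x \<noteq> 0}" "x \<in> T" "y \<in> T"
  have "x \<in> D \<longleftrightarrow> y \<in> D"
    using connected_subset_nodal_domain[OF assms T(1,2)] T(3,4) by blast
  thus "indicat_real D x = indicat_real D y" by (simp add: indicator_def)
qed

lemma constant_on_connected_add:
  "constant_on_connected f N \<Longrightarrow> constant_on_connected g N \<Longrightarrow> constant_on_connected (\<lambda>x. f x + g x) N"
  unfolding constant_on_connected_def by (intro allI impI arg_cong2[where f = "(+)"]) blast+

lemma constant_on_connected_cmult:
  "constant_on_connected f N \<Longrightarrow> constant_on_connected (\<lambda>x. c * f x) N"
  unfolding constant_on_connected_def by (intro allI impI arg_cong2[where f = "(*)"] refl) blast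

lemma constant_on_connected_sum:
  assumes "\<And>i. i \<in> I \<Longrightarrow> constant_on_connected (f i) N"
  shows "constant_on_connected (\<lambda>x. \<Sum>i\<in>I. f i x) N"
  unfolding constant_on_connected_def
  by (intro allI impI sum.cong refl) (use assms constant_on_connectedD in blast)

text \<open>The dimension count behind Courant's bound. \<open>B\<close> collects the lower modes
  that impose a condition; every other lower mode is orthogonal to each piece from the start, in the
  later applications by parity.\<close>

lemma nodal_combination:
  fixes a b :: "real^'n"
  assumes ab: "\<And>i. a $ i < b $ i" and mu: "mu \<ge> 0"
    and A: "finite A" and B: "finite B" "card B < card A"
    and k: "\<And>j. j \<in> A \<Longrightarrow> constant_on_connected (k j) {x \<in> box a b. eigsum a b mu c x \<noteq> 0}"
      "\<And>j. j \<in> A \<Longrightarrow> bounded_borel (k j)"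
    and orth: "\<And>j m. j \<in> A \<Longrightarrow> energy a b m < mu \<Longrightarrow> m \<notin> B \<Longrightarrow> ip a b (\<lambda>x. k j x * eigsum a b mu c x) (mode a b m) = 0"
  obtains r d where "\<exists>j\<in>A. r j \<noteq> 0"
    "\<And>x. x \<in> box a b \<Longrightarrow> (\<Sum>j\<in>A. r j * k j x) * eigsum a b mu c x = eigsum a b mu d x"
proof -
  let ?P = "eigsum a b mu c"
  obtain r where r: "\<exists>j\<in>A. r j \<noteq> 0" "\<forall>m\<in>B. (\<Sum>j\<in>A. r j * ip a b (\<lambda>x. k j x * ?P x) (mode a b m)) = 0"
    using linear_dependence[OF B(1) A B(2), of "\<lambda>j m. ip a b (\<lambda>x. k j x * ?P x) (mode a b m)"] by blast
  let ?k = "\<lambda>x. \<Sum>j\<in>A. r j * k j x"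
  have "\<exists>d. \<forall>x\<in>box a b. ?k x * ?P x = (\<Sum>m\<in>{m. energy a b m = mu}. d m * mode a b m x)"
  proof (rule nodal_multiple_eigenfunction[OF ab mu])
    show "?P = (\<lambda>x. \<Sum>m\<in>{m. energy a b m = mu}. c m * mode a b m x)"
      by (rule ext) (simp add: eigsum_def)
    show "constant_on_connected ?k {x \<in> box a b. ?P x \<noteq> 0}"
      by (intro constant_on_connected_sum constant_on_connected_cmult k)
    show "bounded_borel ?k" by (intro bounded_borel_sum bounded_borel_cmult k)
    show "ip a b (\<lambda>x. ?k x * ?P x) (mode a b m) = 0" if m: "energy a b m < mu" for m
    proof -
      have "(\<lambda>x. ?k x * ?P x) = (\<lambda>x. \<Sum>j\<in>A. r j * (k j x * ?P x))"
        by (simp add: sum_distrib_right mult.assoc)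
      hence "ip a b (\<lambda>x. ?k x * ?P x) (mode a b m) = (\<Sum>j\<in>A. r j * ip a b (\<lambda>x. k j x * ?P x) (mode a b m))"
        by (simp only: ip_cmult_left[symmetric])
          (rule ip_sum_left, intro bounded_borel_mode, intro bounded_borel_cmult bounded_borel_mult k bounded_borel_eigsum)
      also have "\<dots> = 0"
      proof (cases "m \<in> B")
        case False
        thus ?thesis using orth[OF _ m False] by (intro sum.neutral) simp
      qed (use r(2) in blast)
      finally show ?thesis .
    qed
  qed
  thus ?thesis using r(1) that unfolding eigsum_def by blast
qed

text \<open>With one domain \<open>D0\<close> left out there are still more pieces than conditions.
  The resulting eigenfunction vanishes on the open set \<open>D0\<close>, hence everywhere, against
  a nonzero coefficient. Finite subsets are used because \<open>card\<close> of an infinite set of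
  domains would be 0.\<close>

lemma Courant_subset:
  fixes a b :: "real^'n"
  assumes ab: "\<And>i. a $ i < b $ i" and mu: "mu \<ge> 0"
    and A: "finite A" "A \<subseteq> nodal_domains (box a b) (eigsum a b mu c)"
  shows "card A \<le> card {m. energy a b m < mu} + 1"
proof (rule ccontr)
  assume "\<not> ?thesis"
  hence card: "card {m. energy a b m < mu} + 1 < card A" by simp
  hence "A \<noteq> {}" by auto
  then obtain D0 where D0: "D0 \<in> A" by blast
  define A' where "A' = A - {D0}"
  have card': "card {m. energy a b m < mu} < card A'"
    using card D0 A(1) by (simp add: A'_def)
  have fin: "finite A'" using A by (simp add: A'_def)
  have nd: "D \<in> nodal_domains (box a b) (eigsum a b mu c)" if "D \<in> A'" for D
    using that A(2) by (auto simp: A'_def)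
  have nd0: "D0 \<in> nodal_domains (box a b) (eigsum a b mu c)" using A(2) D0 by blast
  obtain r d where rd: "\<exists>j\<in>A'. r j \<noteq> 0"
    "\<And>x. x \<in> box a b \<Longrightarrow> (\<Sum>j\<in>A'. r j * indicat_real j x) * eigsum a b mu c x = eigsum a b mu d x"
  proof (rule nodal_combination[OF ab mu fin finite_energy_eq(2)[OF ab] card', where k = indicat_real and c = c])
    show "constant_on_connected (indicat_real j) {x \<in> box a b. eigsum a b mu c x \<noteq> 0}" if "j \<in> A'" for j
      by (rule constant_on_connected_indicator[OF nd[OF that]])
    show "bounded_borel (indicat_real j)" if "j \<in> A'" for j
      by (rule bounded_borel_indicator) (use open_nodal_domain[OF nd[OF that]] in auto)
  qed auto
  obtain x0 where x0: "x0 \<in> D0" using nodal_domainD(2)[OF nd0] by blast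
  have zero: "eigsum a b mu d y = 0" for y
  proof (rule eigsum_unique_continuation[OF open_nodal_domain[OF nd0] x0])
    fix x assume x: "x \<in> D0"
    have "indicat_real j x = 0" if "j \<in> A'" for j
      using nodal_domains_disjoint[OF nd[OF that] nd0 _ x] that by (auto simp: A'_def indicator_def)
    thus "eigsum a b mu d x = 0"
      using rd(2)[OF nodal_domainD(3)[OF nd0 x]] by simp
  qed
  obtain D where D: "D \<in> A'" "r D \<noteq> 0" using rd(1) by blast
  obtain x where x: "x \<in> D" using nodal_domainD(2)[OF nd[OF D(1)]] by blast
  have "(\<Sum>j\<in>A'. r j * indicat_real j x) = (\<Sum>j\<in>A'. if j = D then r D else 0)"
  proof (rule sum.cong[OF refl])
    fix j assume j: "j \<in> A'"
    have "j \<noteq> D \<Longrightarrow> x \<notin> j" using nodal_domains_disjoint[OF nd[OF j] nd[OF D(1)] _ x] by blast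
    thus "r j * indicat_real j x = (if j = D then r D else 0)" using x by (cases "j = D") simp_all
  qed
  also have "\<dots> = r D" using fin D(1) by simp
  finally show False
    using rd(2)[OF nodal_domainD(3)[OF nd[OF D(1)] x]] zero[of x] D(2) nodal_domainD(4)[OF nd[OF D(1)] x] by simp
qed

text \<open>A uniform bound on all finite subsets excludes infinitely many domains.\<close>

theorem Courant:
  fixes a b :: "real^'n"
  assumes "\<And>i. a $ i < b $ i" "mu \<ge> 0"
  shows "finite (nodal_domains (box a b) (eigsum a b mu c))"
    "card (nodal_domains (box a b) (eigsum a b mu c)) \<le> card {m. energy a b m < mu} + 1"
  using finite_if_finite_subsets_card_bdd[of "nodal_domains (box a b) (eigsum a b mu c)" "card {m. energy a b m < mu} + 1"]
    Courant_subset[OF assms] by blast+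

section \<open>Reflection in the midplane across an axis\<close>

definition mirror :: "real^'n \<Rightarrow> real^'n \<Rightarrow> 'n \<Rightarrow> real^'n \<Rightarrow> real^'n" where
  "mirror a b s x = upd x s (-1 * x $ s + (a $ s + b $ s))"

lemma mirror_nth: "mirror a b s x $ j = (if j = s then a $ s + b $ s - x $ s else x $ j)"
  by (simp add: mirror_def upd_nth)

lemma mirror_mirror [simp]: "mirror a b s (mirror a b s x) = x"
  by (simp add: vec_eq_iff mirror_nth)

lemma mirror_in_box [simp]: "mirror a b s x \<in> box a b \<longleftrightarrow> x \<in> box a b"
  unfolding mirror_def upd_in_box_iff by (auto simp: mem_box_cart)

lemma continuous_mirror: "continuous_on S (mirror a b s)"
proof -
  have "mirror a b s = (\<lambda>x. x + (a $ s + b $ s - 2 * x $ s) *\<^sub>R axis s 1)"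
    by (rule ext) (simp add: vec_eq_iff mirror_nth axis_def)
  thus ?thesis by (auto intro!: continuous_intros)
qed

lemma mirror_image_iff: "x \<in> mirror a b s ` D \<longleftrightarrow> mirror a b s x \<in> D"
proof
  assume "mirror a b s x \<in> D"
  hence "mirror a b s (mirror a b s x) \<in> mirror a b s ` D" by (rule imageI)
  thus "x \<in> mirror a b s ` D" by simp
qed auto

lemma mirror_image_image [simp]: "mirror a b s ` mirror a b s ` D = D"
  by (simp add: image_image)

lemma mode_mirror:
  assumes "a $ s < b $ s"
  shows "mode a b m (mirror a b s x) = (-1) ^ m s * mode a b m x"
proof -
  define w where "w = real (m s) * freq a b s"
  have w: "w * (b $ s - a $ s) = real (m s) * pi" using assms by (simp add: w_def freq_def)
  have "w * (-1 * x $ s + (a $ s + b $ s) - a $ s) = w * (b $ s - a $ s) - w * (x $ s - a $ s)"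
    by (simp add: algebra_simps)
  hence "cos (w * (-1 * x $ s + (a $ s + b $ s) - a $ s)) = (-1) ^ m s * cos (w * (x $ s - a $ s))"
    unfolding w by (simp add: cos_diff)
  thus ?thesis unfolding mirror_def mode_upd mode_factor[of a b m x s] w_def by simp
qed

lemma eigsum_mirror_odd:
  assumes "a $ s < b $ s" "\<And>m. energy a b m = mu \<Longrightarrow> odd (m s)"
  shows "eigsum a b mu c (mirror a b s x) = - eigsum a b mu c x"
  unfolding eigsum_def sum_negf[symmetric]
  by (rule sum.cong) (auto simp: mode_mirror[OF assms(1)] assms(2))

lemma eigsum_mirror_even:
  assumes "a $ s < b $ s" "\<And>m. energy a b m = mu \<Longrightarrow> even (m s)"
  shows "eigsum a b mu c (mirror a b s x) = eigsum a b mu c x"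
  unfolding eigsum_def by (rule sum.cong) (auto simp: mode_mirror[OF assms(1)] assms(2))

lemma ip_mirror:
  assumes "bounded_borel f" "bounded_borel g"
  shows "ip a b (\<lambda>x. f (mirror a b s x)) (\<lambda>x. g (mirror a b s x)) = ip a b f g"
proof -
  have [measurable]: "f \<in> borel_measurable borel" "g \<in> borel_measurable borel"
    using assms by (auto simp: bounded_borel_def)
  define F where "F x = indicat_real (box a b) x * (f x * g x)" for x
  have "integral\<^sup>L lborel F = (LINT x|lborel. F (upd x s (-1 * x $ s + (a $ s + b $ s))))"
    by (rule lborel_integral_upd[symmetric]) (auto simp: F_def[abs_def])
  also have "\<dots> = ip a b (\<lambda>x. f (mirror a b s x)) (\<lambda>x. g (mirror a b s x))"
    unfolding ip_def F_def mirror_def[symmetric] by (simp add: indicator_def)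
  finally show ?thesis by (simp add: ip_def F_def[abs_def])
qed

text \<open>The condition on \<open>e\<close> says that \<open>f\<close> and the mode have opposite
  parities, so the reflection turns the inner product into its negative.\<close>

lemma ip_mode_parity_zero:
  assumes ab: "a $ s < b $ s" and f: "bounded_borel f" and e: "\<And>x. f (mirror a b s x) = e * f x" "e * (-1) ^ m s = -1"
  shows "ip a b f (mode a b m) = 0"
proof -
  have "ip a b f (mode a b m) = ip a b (\<lambda>x. e * f x) (\<lambda>x. (-1) ^ m s * mode a b m x)"
    using ip_mirror[OF f bounded_borel_mode, of a b s a b m] by (simp add: e mode_mirror[OF ab])
  also have "\<dots> = (e * (-1) ^ m s) * ip a b f (mode a b m)"
    by (simp only: ip_cmult_left ip_cmult_right mult.assoc)
  finally show ?thesis using e(2) by simp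
qed

text \<open>\<open>P\<close> changes by a nonzero factor only, so the reflection is a homeomorphism
  of the nonzero set onto itself and permutes its components.\<close>

lemma nodal_domain_mirror:
  assumes D: "D \<in> nodal_domains (box a b) P" and P: "\<And>x. P (mirror a b s x) = e * P x" "e \<noteq> 0"
  shows "mirror a b s ` D \<in> nodal_domains (box a b) P"
proof -
  let ?N = "{x \<in> box a b. P x \<noteq> 0}" and ?f = "mirror a b s"
  have img: "?f ` T \<subseteq> ?N" if "T \<subseteq> ?N" for T using that P by auto
  have conn: "connected (?f ` T)" if "connected T" for T
    by (rule connected_continuous_image[OF continuous_mirror that])
  have D': "D \<noteq> {}" "D \<subseteq> ?N" "connected D" "\<And>E. E \<noteq> {} \<Longrightarrow> D \<subseteq> E \<Longrightarrow> E \<subseteq> ?N \<Longrightarrow> connected E \<Longrightarrow> E = D"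
    using in_components_maximal[THEN iffD1, OF D[unfolded nodal_domains_alt]] by simp_all
  show ?thesis unfolding nodal_domains_alt in_components_maximal
  proof (intro conjI allI impI)
    fix E assume E: "E \<noteq> {} \<and> ?f ` D \<subseteq> E \<and> E \<subseteq> ?N \<and> connected E"
    have "?f ` E = D"
    proof (rule D'(4))
      show "D \<subseteq> ?f ` E" using image_mono[of "?f ` D" E ?f] E by simp
    qed (use E img conn in auto)
    thus "E = ?f ` D" by (metis mirror_image_image)
  qed (use D' img conn in auto)
qed

lemma connected_avoids_hyperplane:
  fixes D :: "(real^'n) set"
  assumes "connected D" "\<And>x. x \<in> D \<Longrightarrow> x $ s \<noteq> t"
  shows "(\<forall>x\<in>D. x $ s < t) \<or> (\<forall>x\<in>D. x $ s > t)"
proof -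
  have "open {x::real^'n. x $ s < t}" "open {x::real^'n. x $ s > t}"
    by (rule open_halfspace_component_lt_cart open_halfspace_component_gt_cart)+
  moreover have "D \<subseteq> {x. x $ s < t} \<union> {x. x $ s > t}" using assms(2) by force
  moreover have "{x. x $ s < t} \<inter> {x. x $ s > t} \<inter> D = {}" by auto
  ultimately have "{x. x $ s < t} \<inter> D = {} \<or> {x. x $ s > t} \<inter> D = {}"
    using connectedD[OF assms(1)] by blast
  thus ?thesis
  proof
    assume "{x. x $ s < t} \<inter> D = {}"
    hence "x $ s > t" if "x \<in> D" for x using assms(2)[OF that] that by (auto simp: disjoint_iff not_less le_less)
    thus ?thesis by blast
  next
    assume "{x. x $ s > t} \<inter> D = {}"
    hence "x $ s < t" if "x \<in> D" for x using assms(2)[OF that] that by (auto simp: disjoint_iff not_less le_less)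
    thus ?thesis by blast
  qed
qed

definition left_domains :: "real^'n \<Rightarrow> real^'n \<Rightarrow> 'n \<Rightarrow> (real^'n \<Rightarrow> real) \<Rightarrow> (real^'n) set set" where
  "left_domains a b s P = {D \<in> nodal_domains (box a b) P. \<forall>x\<in>D. x $ s < (a $ s + b $ s) / 2}"

text \<open>
  A combination of the symmetrised (\<open>e = 1\<close>) or antisymmetrised (\<open>e = -1\<close>) pieces of the left nodal
  domains is orthogonal to all modes of the other parity, so only the modes in \<open>B\<close> are constraints.
\<close>
lemma left_domains_combination:
  fixes a b :: "real^'n"
  assumes ab: "\<And>i. a $ i < b $ i" and mu: "mu \<ge> 0"
    and A: "finite A" "A \<subseteq> left_domains a b s (eigsum a b mu c)"
    and B: "finite B" "card B < card A"
    and p: "\<And>x. eigsum a b mu c (mirror a b s x) = p * eigsum a b mu c x" "\<bar>p\<bar> = 1" and e: "\<bar>e\<bar> = 1"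
    and par: "\<And>m. energy a b m < mu \<Longrightarrow> m \<notin> B \<Longrightarrow> e * p * (-1) ^ m s = -1"
  obtains d D k where
    "\<And>x. x \<in> box a b \<Longrightarrow> k x * eigsum a b mu c x = eigsum a b mu d x"
    "\<And>x. k (mirror a b s x) = e * k x" "D \<in> A" "\<And>x. x \<in> D \<Longrightarrow> k x \<noteq> 0"
    "\<And>x D0. D0 \<in> left_domains a b s (eigsum a b mu c) - A \<Longrightarrow> x \<in> D0 \<Longrightarrow> k x = 0"
proof -
  let ?P = "eigsum a b mu c" and ?f = "mirror a b s"
  have ee: "e * e = 1" using e by (auto simp: abs_if split: if_splits)
  have pne: "p \<noteq> 0" using p(2) by auto
  define k where "k D x = indicat_real D x + e * indicat_real (?f ` D) x" for D x
  have nd: "D \<in> nodal_domains (box a b) ?P" "mirror a b s ` D \<in> nodal_domains (box a b) ?P"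
    "\<And>x. x \<in> D \<Longrightarrow> x $ s < (a $ s + b $ s) / 2" if "D \<in> left_domains a b s ?P" for D
    using that nodal_domain_mirror[where P = ?P and e = p, OF _ p(1) pne] by (auto simp: left_domains_def)
  have ndA: "D \<in> nodal_domains (box a b) ?P" "mirror a b s ` D \<in> nodal_domains (box a b) ?P" if "D \<in> A" for D
    using nd that A(2) by blast+
  have kf: "k D (?f x) = e * k D x" for D x
  proof -
    have "indicat_real (?f ` D) x = indicat_real D (?f x)" "indicat_real (?f ` D) (?f x) = indicat_real D x"
      by (simp_all add: indicator_def mirror_image_iff)
    thus ?thesis unfolding k_def using ee by (simp add: distrib_left mult.assoc[symmetric])
  qed
  have kb: "bounded_borel (k D)" if "D \<in> A" for D
    unfolding k_def[abs_def]
    by (intro bounded_borel_add bounded_borel_cmult bounded_borel_indicator borel_open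
        open_nodal_domain[OF ndA(1)[OF that]] open_nodal_domain[OF ndA(2)[OF that]])
  obtain r d where rd: "\<exists>j\<in>A. r j \<noteq> 0"
    "\<And>x. x \<in> box a b \<Longrightarrow> (\<Sum>j\<in>A. r j * k j x) * ?P x = eigsum a b mu d x"
  proof (rule nodal_combination[OF ab mu A(1) B, where k = k and c = c])
    show "constant_on_connected (k j) {x \<in> box a b. ?P x \<noteq> 0}" if "j \<in> A" for j
      unfolding k_def[abs_def]
      by (intro constant_on_connected_add constant_on_connected_cmult constant_on_connected_indicator ndA that)
    show "ip a b (\<lambda>x. k j x * ?P x) (mode a b m) = 0" if "j \<in> A" "energy a b m < mu" "m \<notin> B" for j m
    proof (rule ip_mode_parity_zero[OF ab])
      show "bounded_borel (\<lambda>x. k j x * ?P x)" by (intro bounded_borel_mult kb that bounded_borel_eigsum)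
      show "k j (?f x) * ?P (?f x) = e * p * (k j x * ?P x)" for x by (simp add: kf p)
      show "e * p * (-1) ^ m s = -1" by (rule par[OF that(2,3)])
    qed
  qed (use kb in auto)
  obtain D where D: "D \<in> A" "r D \<noteq> 0" using rd(1) by blast
  \<comment> \<open>Mirror images of left domains lie on the right, so on a left domain each
    multiplier reduces to an indicator and the coefficients can be read off.\<close>
  have mirror_out: "x \<notin> ?f ` D'" if x: "x \<in> D1" "D1 \<in> left_domains a b s ?P" "D' \<in> left_domains a b s ?P" for x D1 D'
  proof
    assume "x \<in> ?f ` D'"
    hence "?f x \<in> D'" by (simp add: mirror_image_iff)
    from nd(3)[OF x(3) this] nd(3)[OF x(2) x(1)] show False by (simp add: mirror_nth)
  qed
  have keq: "k D' x = (if D' = D1 then 1 else 0)"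
    if "x \<in> D1" "D1 \<in> left_domains a b s ?P" "D' \<in> left_domains a b s ?P" for x D1 D'
  proof -
    have "D' \<noteq> D1 \<Longrightarrow> x \<notin> D'"
      using nodal_domains_disjoint[OF nd(1)[OF that(3)] nd(1)[OF that(2)] _ that(1)] by blast
    thus ?thesis using mirror_out[OF that] that(1) by (cases "D' = D1") (simp_all add: k_def)
  qed
  show ?thesis
  proof (rule that[of "\<lambda>x. \<Sum>j\<in>A. r j * k j x" d D])
    show "(\<Sum>j\<in>A. r j * k j x) * ?P x = eigsum a b mu d x" if "x \<in> box a b" for x by (rule rd(2)[OF that])
    show "(\<Sum>j\<in>A. r j * k j (?f x)) = e * (\<Sum>j\<in>A. r j * k j x)" for x
      by (simp add: kf sum_distrib_left mult_ac)
    show "D \<in> A" by (rule D)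
    show "(\<Sum>j\<in>A. r j * k j x) \<noteq> 0" if x: "x \<in> D" for x
    proof -
      have "(\<Sum>j\<in>A. r j * k j x) = (\<Sum>j\<in>A. if j = D then r D else 0)"
      proof (rule sum.cong[OF refl])
        fix j assume j: "j \<in> A"
        have "k j x = (if j = D then 1 else 0)" by (rule keq[OF x]) (use j D(1) A(2) in blast)+
        thus "r j * k j x = (if j = D then r D else 0)" by simp
      qed
      thus ?thesis using D A(1) by simp
    qed
    show "(\<Sum>j\<in>A. r j * k j x) = 0" if D0: "D0 \<in> left_domains a b s ?P - A" "x \<in> D0" for x D0
    proof (rule sum.neutral, rule ballI)
      fix j assume "j \<in> A"
      have "k j x = (if j = D0 then 1 else 0)" by (rule keq[OF D0(2)]) (use \<open>j \<in> A\<close> D0(1) A(2) in blast)+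
      moreover have "j \<noteq> D0" using \<open>j \<in> A\<close> D0(1) by blast
      ultimately show "r j * k j x = 0" by simp
    qed
  qed
qed

subsection \<open>Courant-sharp eigenvalues and the longest edge\<close>

text \<open>Courant-sharpness in terms of modes alone: the list of eigenvalues is replaced by
  counting the modes below \<open>mu\<close>, and a nonzero eigenfunction by a nonzero coefficient
  in the eigenspace.\<close>

definition sharp :: "real^'n \<Rightarrow> real^'n \<Rightarrow> real \<Rightarrow> bool" where
  "sharp a b mu \<longleftrightarrow> (\<exists>c. (\<exists>m. energy a b m = mu \<and> c m \<noteq> 0) \<and>
     card (nodal_domains (box a b) (eigsum a b mu c)) = card {m. energy a b m < mu} + 1)"

lemma finite_energy_less_conj:
  fixes a b :: "real^'n"
  assumes ab: "\<And>i. a $ i < b $ i"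
  shows "finite {m. energy a b m < mu \<and> Q m}"
  by (rule finite_subset[OF _ finite_energy_eq(2)[OF ab, of mu]]) blast

lemma card_energy_parity:
  fixes a b :: "real^'n"
  assumes ab: "\<And>i. a $ i < b $ i"
  shows "card {m. energy a b m < mu} = card {m. energy a b m < mu \<and> even (m s)} + card {m. energy a b m < mu \<and> odd (m s)}"
proof -
  have "{m. energy a b m < mu} = {m. energy a b m < mu \<and> even (m s)} \<union> {m. energy a b m < mu \<and> odd (m s)}" by auto
  also have "card \<dots> = card {m. energy a b m < mu \<and> even (m s)} + card {m. energy a b m < mu \<and> odd (m s)}"
    by (rule card_Un_disjoint) (auto intro: finite_energy_less_conj[OF ab])
  finally show ?thesis .
qed

lemma left_domains_subset: "left_domains a b s P \<subseteq> nodal_domains (box a b) P"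
  by (auto simp: left_domains_def)

lemma nodal_domain_side:
  assumes D: "D \<in> nodal_domains (box a b) P" and P: "\<And>x. P (mirror a b s x) = e * P x" "e \<noteq> 0"
    and ne: "\<And>x. x \<in> D \<Longrightarrow> x $ s \<noteq> (a $ s + b $ s) / 2"
  shows "D \<in> left_domains a b s P \<union> image (mirror a b s) ` left_domains a b s P"
proof (cases "\<forall>x\<in>D. x $ s < (a $ s + b $ s) / 2")
  case True
  thus ?thesis using D by (simp add: left_domains_def)
next
  case False
  hence gt: "\<forall>x\<in>D. x $ s > (a $ s + b $ s) / 2"
    using connected_avoids_hyperplane[OF nodal_domainD(1)[OF D] ne] by blast
  have "mirror a b s ` D \<in> left_domains a b s P"
    unfolding left_domains_def using nodal_domain_mirror[where P = P and e = e, OF D P] gt by (force simp: mirror_nth)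
  hence "mirror a b s ` mirror a b s ` D \<in> image (mirror a b s) ` left_domains a b s P" by (rule imageI)
  thus ?thesis by simp
qed

text \<open>An odd eigenfunction vanishes on the midplane, so its domains are the left ones and
  their mirror images. Symmetrised pieces of it are odd, hence orthogonal to all even modes, and
  Courant's argument with one left domain spared allows at most one left domain more than there are
  odd modes below \<open>mu\<close>. Doubling this and comparing with even + odd + 1 gives the
  claim.\<close>

lemma sharp_odd:
  fixes a b :: "real^'n"
  assumes ab: "\<And>i. a $ i < b $ i" and sh: "sharp a b mu" and odd: "\<And>m. energy a b m = mu \<Longrightarrow> odd (m s)"
  shows "card {m. energy a b m < mu \<and> even (m s)} \<le> card {m. energy a b m < mu \<and> odd (m s)} + 1"
proof -
  obtain c m0 where c: "energy a b m0 = mu"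
    "card (nodal_domains (box a b) (eigsum a b mu c)) = card {m. energy a b m < mu} + 1"
    using sh unfolding sharp_def by blast
  have mu: "mu \<ge> 0" using c(1) energy_nonneg[of a b m0] by simp
  let ?P = "eigsum a b mu c" and ?O = "{m. energy a b m < mu \<and> odd (m s)}"
  let ?L = "left_domains a b s ?P"
  have P: "?P (mirror a b s x) = -1 * ?P x" for x
    using eigsum_mirror_odd[OF ab odd] by simp
  have finN: "finite (nodal_domains (box a b) ?P)" by (rule Courant(1)[OF ab mu])
  have finL: "finite ?L" by (rule finite_subset[OF left_domains_subset finN])
  have "nodal_domains (box a b) ?P \<subseteq> ?L \<union> image (mirror a b s) ` ?L"
  proof
    fix D assume D: "D \<in> nodal_domains (box a b) ?P"
    show "D \<in> ?L \<union> image (mirror a b s) ` ?L"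
    proof (rule nodal_domain_side[OF D P])
      fix x assume x: "x \<in> D"
      show "x $ s \<noteq> (a $ s + b $ s) / 2"
      proof
        assume "x $ s = (a $ s + b $ s) / 2"
        hence "mirror a b s x = x" by (simp add: vec_eq_iff mirror_nth)
        with P[of x] have "?P x = 0" by simp
        thus False using nodal_domainD(4)[OF D x] by simp
      qed
    qed simp
  qed
  hence "card (nodal_domains (box a b) ?P) \<le> card (?L \<union> image (mirror a b s) ` ?L)"
    using finL by (intro card_mono) auto
  also have "\<dots> \<le> card ?L + card ?L"
    using card_Un_le[of ?L "image (mirror a b s) ` ?L"] card_image_le[OF finL, of "image (mirror a b s)"] by linarith
  finally have nu: "card (nodal_domains (box a b) ?P) \<le> 2 * card ?L" by simp
  have "card ?L \<le> card ?O + 1"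
  proof (rule ccontr)
    assume "\<not> ?thesis"
    hence card: "card ?O + 1 < card ?L" by simp
    hence "?L \<noteq> {}" by auto
    then obtain D0 where D0: "D0 \<in> ?L" by blast
    have card': "card ?O < card (?L - {D0})" using card D0 finL by simp
    obtain d D k where k: "\<And>x. x \<in> box a b \<Longrightarrow> k x * ?P x = eigsum a b mu d x"
      "D \<in> ?L - {D0}" "\<And>x. x \<in> D \<Longrightarrow> k x \<noteq> 0"
      "\<And>x D0'. D0' \<in> ?L - (?L - {D0}) \<Longrightarrow> x \<in> D0' \<Longrightarrow> k x = 0"
    proof (rule left_domains_combination[OF ab mu _ _ finite_energy_less_conj[OF ab] card' P, where e = 1])
      show "1 * -1 * (-1) ^ m s = (-1::real)" if "energy a b m < mu" "m \<notin> ?O" for m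
        using that by auto
    qed (use finL in auto)
    have nd0: "D0 \<in> nodal_domains (box a b) ?P" using D0 left_domains_subset by blast
    have nd: "D \<in> nodal_domains (box a b) ?P" using k(2) left_domains_subset by blast
    obtain x0 where x0: "x0 \<in> D0" using nodal_domainD(2)[OF nd0] by blast
    have zero: "eigsum a b mu d y = 0" for y
    proof (rule eigsum_unique_continuation[OF open_nodal_domain[OF nd0] x0])
      fix x assume x: "x \<in> D0"
      have "k x = 0" by (rule k(4)[OF _ x]) (use D0 in auto)
      thus "eigsum a b mu d x = 0" using k(1)[OF nodal_domainD(3)[OF nd0 x]] by simp
    qed
    obtain x where x: "x \<in> D" using nodal_domainD(2)[OF nd] by blast
    show False
      using k(1)[OF nodal_domainD(3)[OF nd x]] zero[of x] k(3)[OF x] nodal_domainD(4)[OF nd x] by simp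
  qed
  thus ?thesis using nu c(2) card_energy_parity[OF ab, of mu s] by linarith
qed

section \<open>The half of a box\<close>

definition halve :: "real^'n \<Rightarrow> real^'n \<Rightarrow> 'n \<Rightarrow> real^'n" where
  "halve a b s = upd b s ((a $ s + b $ s) / 2)"

lemma halve_nth: "halve a b s $ j = (if j = s then (a $ s + b $ s) / 2 else b $ j)"
  by (simp add: halve_def upd_nth)

lemma halve_box:
  assumes "a $ s < b $ s"
  shows "x \<in> box a (halve a b s) \<longleftrightarrow> x \<in> box a b \<and> x $ s < (a $ s + b $ s) / 2"
proof -
  have m: "a $ s < (a $ s + b $ s) / 2" "(a $ s + b $ s) / 2 < b $ s" using assms by simp_all
  show ?thesis
  proof
    assume "x \<in> box a (halve a b s)"
    hence x: "a $ j < x $ j" "x $ j < (if j = s then (a $ s + b $ s) / 2 else b $ j)" for j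
      by (simp_all only: mem_box_cart halve_nth)
    have "x $ j < b $ j" for j using x(2)[of j] m(2) by (cases "j = s") simp_all
    thus "x \<in> box a b \<and> x $ s < (a $ s + b $ s) / 2" using x(1) x(2)[of s] by (simp add: mem_box_cart)
  qed (simp add: mem_box_cart halve_nth)
qed

lemma freq_halve: "freq a (halve a b s) j = (if j = s then 2 * freq a b s else freq a b j)"
proof -
  have "(a $ s + b $ s) / 2 - a $ s = (b $ s - a $ s) / 2" by (simp add: field_simps)
  thus ?thesis by (simp add: freq_def halve_nth)
qed

lemma wave_number_halve:
  "real (m j) * freq a (halve a b s) j = real ((m(s := 2 * m s)) j) * freq a b j"
  by (simp add: freq_halve)

lemma mode_halve: "mode a (halve a b s) m x = mode a b (m(s := 2 * m s)) x"
  unfolding mode_def wave_number_halve ..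

lemma energy_halve: "energy a (halve a b s) m = energy a b (m(s := 2 * m s))"
  unfolding energy_def wave_number_halve ..

lemma double_surj:
  assumes "even (m s)" shows "\<exists>k. m = k(s := 2 * k s)"
proof -
  obtain r where "m s = 2 * r" using assms by (rule evenE)
  hence "m = (m(s := r))(s := 2 * (m(s := r)) s)" by (auto simp: fun_eq_iff)
  thus ?thesis by blast
qed

lemma eigsum_halve:
  assumes even: "\<And>m. energy a b m = mu \<Longrightarrow> even (m s)"
  shows "eigsum a b mu c x = eigsum a (halve a b s) mu (\<lambda>m. c (m(s := 2 * m s))) x"
  unfolding eigsum_def
  by (rule sum.reindex_bij_witness[where i = "\<lambda>m. m(s := 2 * m s)" and j = "\<lambda>m. m(s := m s div 2)"])
     (auto simp: energy_halve mode_halve even dest!: even)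

text \<open>The even modes of the box, restricted to the half, are exactly the Neumann modes of the
  half, with the index along the cut divided by 2.\<close>

lemma card_energy_halve:
  "card {m. energy a (halve a b s) m < mu} = card {m. energy a b m < mu \<and> even (m s)}"
  by (rule bij_betw_same_card[of "\<lambda>m. m(s := 2 * m s)"], rule bij_betwI[where g = "\<lambda>m. m(s := m s div 2)"])
     (auto simp: energy_halve)

text \<open>Of the even + odd + 1 domains at most odd many lie strictly to the left, and equally
  many to the right. So at least even + 1 of them meet the left half. Each of these contains a nodal
  domain of the restriction, and Courant's theorem on the half allows no more than even + 1.\<close>

lemma sharp_even:
  fixes a b :: "real^'n"
  assumes ab: "\<And>i. a $ i < b $ i" and sh: "sharp a b mu" and even: "\<And>m. energy a b m = mu \<Longrightarrow> even (m s)"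
  shows "sharp a (halve a b s) mu"
proof -
  obtain c m0 where c: "energy a b m0 = mu" "c m0 \<noteq> 0"
    "card (nodal_domains (box a b) (eigsum a b mu c)) = card {m. energy a b m < mu} + 1"
    using sh unfolding sharp_def by blast
  have mu: "mu \<ge> 0" using c(1) energy_nonneg[of a b m0] by simp
  let ?t = "(a $ s + b $ s) / 2"
  let ?P = "eigsum a b mu c" and ?O = "{m. energy a b m < mu \<and> odd (m s)}" and ?E = "{m. energy a b m < mu \<and> even (m s)}"
  let ?L = "left_domains a b s ?P" and ?N = "nodal_domains (box a b) ?P"
  let ?h = "halve a b s" and ?c = "\<lambda>m. c (m(s := 2 * m s))"
  have P: "?P (mirror a b s x) = 1 * ?P x" for x
    using eigsum_mirror_even[OF ab even] by simp
  have finN: "finite ?N" by (rule Courant(1)[OF ab mu])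
  have finL: "finite ?L" by (rule finite_subset[OF left_domains_subset finN])
  \<comment> \<open>Antisymmetrised pieces yield an odd function in an eigenspace of even functions,
    that is 0. No domain has to be spared, and the bound is one better than in the odd case.\<close>
  have L: "card ?L \<le> card ?O"
  proof (rule ccontr)
    assume "\<not> ?thesis"
    hence card: "card ?O < card ?L" by simp
    obtain d D k where k: "\<And>x. x \<in> box a b \<Longrightarrow> k x * ?P x = eigsum a b mu d x"
      "\<And>x. k (mirror a b s x) = -1 * k x" "D \<in> ?L" "\<And>x. x \<in> D \<Longrightarrow> k x \<noteq> 0"
    proof (rule left_domains_combination[OF ab mu finL subset_refl finite_energy_less_conj[OF ab] card P, where e = "-1"])
      show "-1 * 1 * (-1) ^ m s = (-1::real)" if "energy a b m < mu" "m \<notin> ?O" for m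
        using that by auto
    qed auto
    have nd: "D \<in> ?N" using k(3) left_domains_subset by blast
    obtain x where x: "x \<in> D" using nodal_domainD(2)[OF nd] by blast
    have xb: "x \<in> box a b" by (rule nodal_domainD(3)[OF nd x])
    have "eigsum a b mu d (mirror a b s x) = eigsum a b mu d x" by (rule eigsum_mirror_even[OF ab even])
    moreover have "eigsum a b mu d x = k x * ?P x" by (rule k(1)[OF xb, symmetric])
    moreover have "eigsum a b mu d (mirror a b s x) = - (k x * ?P x)"
      using k(1)[of "mirror a b s x"] xb P[of x] k(2)[of x] by simp
    ultimately have "k x * ?P x = 0" by linarith
    thus False using k(4)[OF x] nodal_domainD(4)[OF nd x] by simp
  qed
  define M where "M = {D \<in> ?N. \<exists>x\<in>D. x $ s = ?t}"
  have M: "finite M" "M \<subseteq> ?N" unfolding M_def using finN by auto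
  have disj: "M \<inter> ?L = {}" by (auto simp: M_def left_domains_def)
  have "?N \<subseteq> M \<union> (?L \<union> image (mirror a b s) ` ?L)"
  proof
    fix D assume D: "D \<in> ?N"
    show "D \<in> M \<union> (?L \<union> image (mirror a b s) ` ?L)"
    proof (cases "\<exists>x\<in>D. x $ s = ?t")
      case False
      have "D \<in> ?L \<union> image (mirror a b s) ` ?L"
        by (rule nodal_domain_side[OF D P]) (use False in auto)
      thus ?thesis by blast
    qed (use D in \<open>auto simp: M_def\<close>)
  qed
  hence "card ?N \<le> card (M \<union> (?L \<union> image (mirror a b s) ` ?L))"
    using M finL by (intro card_mono) auto
  also have "\<dots> \<le> card M + (card ?L + card ?L)"
    using card_Un_le[of M "?L \<union> image (mirror a b s) ` ?L"] card_Un_le[of ?L "image (mirror a b s) ` ?L"]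
      card_image_le[OF finL, of "image (mirror a b s)"] by linarith
  finally have "card ?E + 1 \<le> card M + card ?L"
    using L c(3) card_energy_parity[OF ab, of mu s] by linarith
  also have "\<dots> = card (M \<union> ?L)" by (rule card_Un_disjoint[symmetric]) (use M finL disj in auto)
  finally have low: "card ?E + 1 \<le> card (M \<union> ?L)" .
  have half_ab: "a $ i < ?h $ i" for i using ab[of i] ab[of s] by (simp add: halve_nth)
  have heq: "eigsum a b mu c = eigsum a ?h mu ?c" by (rule ext) (rule eigsum_halve[OF even])
  let ?H = "nodal_domains (box a ?h) ?P"
  have finH: "finite ?H" and cardH: "card ?H \<le> card ?E + 1"
    unfolding heq using Courant[OF half_ab mu, of ?c] card_energy_halve[of a b s mu] by simp_all
  have "\<exists>C\<in>?H. C \<subseteq> D" if D: "D \<in> M \<union> ?L" for D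
  proof -
    have nd: "D \<in> ?N" using D M left_domains_subset by blast
    have "\<exists>x\<in>D. x $ s < ?t"
    proof (cases "D \<in> ?L")
      case True
      thus ?thesis using nodal_domainD(2)[OF nd] by (auto simp: left_domains_def)
    next
      case False
      then obtain x where x: "x \<in> D" "x $ s = ?t" using D by (auto simp: M_def)
      obtain e where e: "e > 0" "ball x e \<subseteq> D" using open_nodal_domain[OF nd] x(1) open_contains_ball by blast
      \<comment> \<open>An open domain that meets the midplane has points strictly to the left of
        it.\<close>
      define y where "y = upd x s (x $ s - e / 2)"
      have "y \<in> ball x e"
        using e(1) by (simp add: y_def dist_norm norm_minus_commute[of x] norm_upd_diff)
      moreover have "y $ s < ?t" using e(1) x(2) by (simp add: y_def)
      ultimately show ?thesis using e(2) by blast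
    qed
    then obtain x where x: "x \<in> D" "x $ s < ?t" by blast
    have "x \<in> {y \<in> box a ?h. ?P y \<noteq> 0}"
      using x nodal_domainD(3,4)[OF nd x(1)] by (simp add: halve_box[OF ab])
    then obtain C where C: "C \<in> ?H" "x \<in> C"
      unfolding nodal_domains_alt using Union_components[of "{y \<in> box a ?h. ?P y \<noteq> 0}"] by blast
    have "C \<subseteq> D"
    proof (rule connected_subset_nodal_domain[OF nd nodal_domainD(1)[OF C(1)] _ C(2) x(1)])
      show "C \<subseteq> {x \<in> box a b. ?P x \<noteq> 0}"
        using nodal_domainD(3,4)[OF C(1)] by (auto simp: halve_box[OF ab])
    qed
    thus ?thesis using C by blast
  qed
  then obtain f where f: "\<And>D. D \<in> M \<union> ?L \<Longrightarrow> f D \<in> ?H \<and> f D \<subseteq> D" by metis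
  have "inj_on f (M \<union> ?L)"
  proof (rule inj_onI)
    fix D D' assume D: "D \<in> M \<union> ?L" "D' \<in> M \<union> ?L" "f D = f D'"
    have "f D \<noteq> {}" using nodal_domainD(2)[OF conjunct1[OF f[OF D(1)]]] .
    then obtain x where x: "x \<in> f D" by blast
    have "x \<in> D" "x \<in> D'" using x conjunct2[OF f[OF D(1)]] conjunct2[OF f[OF D(2)]] D(3) by auto
    moreover have "D \<in> ?N" "D' \<in> ?N" using D(1,2) M(2) left_domains_subset[of a b s ?P] by auto
    ultimately show "D = D'" using nodal_domains_disjoint[of D "box a b" ?P D' x] by simp
  qed
  hence "card (M \<union> ?L) \<le> card ?H"
    by (rule card_inj_on_le) (use f finH in blast)+
  with low cardH have "card ?H = card {m. energy a ?h m < mu} + 1"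
    by (simp add: card_energy_halve)
  moreover obtain k where "m0 = k(s := 2 * k s)" using double_surj[of m0 s, OF even[OF c(1)]] by blast
  ultimately show ?thesis unfolding sharp_def heq using c(1,2) by (intro exI[of _ ?c]) (auto simp: energy_halve)
qed

subsection \<open>Nodal domains of a single mode\<close>

text \<open>A connected subset of \<open>N\<close> that contains one member meets no other, since
  that member and the union of the others are open and would separate it.\<close>

lemma components_eq_partition:
  fixes N :: "'a::topological_space set"
  assumes "\<Union>F = N" and F: "\<And>C. C \<in> F \<Longrightarrow> open C" "\<And>C. C \<in> F \<Longrightarrow> connected C" "\<And>C. C \<in> F \<Longrightarrow> C \<noteq> {}"
    and disj: "\<And>C D x. C \<in> F \<Longrightarrow> D \<in> F \<Longrightarrow> x \<in> C \<Longrightarrow> x \<in> D \<Longrightarrow> C = D"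
  shows "components N = F"
proof -
  have in_comp: "C \<in> components N" if C: "C \<in> F" for C
    unfolding in_components_maximal
  proof (intro conjI allI impI)
    fix D assume D: "D \<noteq> {} \<and> C \<subseteq> D \<and> D \<subseteq> N \<and> connected D"
    define R where "R = \<Union>(F - {C})"
    have "open R" unfolding R_def using F(1) by (intro open_Union) blast
    moreover have "C \<inter> R \<inter> D = {}" unfolding R_def using disj[OF C] by blast
    moreover have "D \<subseteq> C \<union> R" unfolding R_def using D assms(1) by blast
    ultimately have "C \<inter> D = {} \<or> R \<inter> D = {}"
      using connectedD[of D C R] D F(1)[OF C] by blast
    moreover have "C \<inter> D \<noteq> {}" using D F(3)[OF C] by blast
    ultimately show "D = C" using \<open>D \<subseteq> C \<union> R\<close> D by blast
  qed (use F(2,3)[OF C] C assms(1) in auto)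
  show ?thesis
  proof (rule antisym)
    show "components N \<subseteq> F"
    proof
      fix D assume D: "D \<in> components N"
      then obtain x where x: "x \<in> D" "x \<in> N" using in_components_nonempty in_components_subset by blast
      then obtain C where C: "C \<in> F" "x \<in> C" using assms(1) by blast
      have "D = C" using components_nonoverlap[OF D in_comp[OF C(1)]] x(1) C(2) by blast
      thus "D \<in> F" using C(1) by simp
    qed
  qed (use in_comp in blast)
qed

lemma cos_pi_nonzero_near:
  assumes "\<bar>y - real k\<bar> < 1 / 2" shows "cos (pi * y) \<noteq> 0"
proof -
  have "cos (pi * y) = cos (pi * (y - real k) + real k * pi)" by (simp add: algebra_simps)
  also have "\<dots> = (-1) ^ k * cos (pi * (y - real k))" by (simp add: cos_add)
  finally have eq: "cos (pi * y) = (-1) ^ k * cos (pi * (y - real k))" .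
  have "pi * \<bar>y - real k\<bar> < pi * (1 / 2)" using assms by (intro mult_strict_left_mono) auto
  hence "\<bar>pi * (y - real k)\<bar> < pi / 2" by (simp add: abs_mult)
  moreover have "0 < cos z" if "\<bar>z\<bar> < pi / 2" for z
    using that by (intro cos_gt_zero_pi) linarith+
  ultimately have "cos (pi * (y - real k)) > 0" by blast
  thus ?thesis unfolding eq by simp
qed

lemma near_integer_of_cos_pi_nonzero:
  assumes y: "0 \<le> y" "y \<le> real m" and ne: "cos (pi * y) \<noteq> 0"
  shows "\<exists>k\<le>m. \<bar>y - real k\<bar> < 1 / 2"
proof -
  define k where "k = nat \<lfloor>y + 1 / 2\<rfloor>"
  have k: "real k \<le> y + 1 / 2" "y + 1 / 2 < real k + 1"
    unfolding k_def using y(1) by linarith+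
  have "real k \<noteq> y + 1 / 2"
  proof
    assume "real k = y + 1 / 2"
    hence "pi * y = real k * pi - pi / 2" by (simp add: algebra_simps)
    hence "cos (pi * y) = 0" by (simp add: cos_diff)
    thus False using ne by simp
  qed
  hence "\<bar>y - real k\<bar> < 1 / 2" using k by linarith
  moreover have "k \<le> m" using k(1) y(2) \<open>real k \<noteq> y + 1 / 2\<close> by linarith
  ultimately show ?thesis by blast
qed

text \<open>The phase of the \<open>i\<close>-th cosine factor in units of \<open>pi\<close>. On the
  box it runs from 0 to \<open>m i\<close>, and the factor vanishes at the half-integers.\<close>

definition wave :: "real^'n \<Rightarrow> real^'n \<Rightarrow> ('n \<Rightarrow> nat) \<Rightarrow> 'n \<Rightarrow> real^'n \<Rightarrow> real" where
  "wave a b m i x = real (m i) * ((x $ i - a $ i) / (b $ i - a $ i))"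

text \<open>The points whose phases round to the integers \<open>k i\<close>; along axis
  \<open>i\<close> the indices from 0 to \<open>m i\<close> occur.\<close>

definition cell :: "real^'n \<Rightarrow> real^'n \<Rightarrow> ('n \<Rightarrow> nat) \<Rightarrow> ('n \<Rightarrow> nat) \<Rightarrow> (real^'n) set" where
  "cell a b m k = {x \<in> box a b. \<forall>i. \<bar>wave a b m i x - real (k i)\<bar> < 1 / 2}"

lemma mode_wave: "mode a b m x = (\<Prod>i\<in>UNIV. cos (pi * wave a b m i x))"
  unfolding mode_def by (rule prod.cong) (auto simp: freq_def wave_def mult_ac)

lemma mode_nonzero_iff:
  fixes a b :: "real^'n"
  assumes ab: "\<And>i. a $ i < b $ i" and x: "x \<in> box a b"
  shows "mode a b m x \<noteq> 0 \<longleftrightarrow> (\<exists>k\<in>{k. \<forall>i. k i \<le> m i}. x \<in> cell a b m k)"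
proof
  assume "mode a b m x \<noteq> 0"
  hence ne: "cos (pi * wave a b m i x) \<noteq> 0" for i
    unfolding mode_wave by simp
  have "\<exists>k\<le>m i. \<bar>wave a b m i x - real k\<bar> < 1 / 2" for i
  proof (rule near_integer_of_cos_pi_nonzero[OF _ _ ne])
    have xi: "a $ i < x $ i" "x $ i < b $ i" using x by (auto simp: mem_box_cart)
    thus "0 \<le> wave a b m i x" by (simp add: wave_def)
    have "(x $ i - a $ i) / (b $ i - a $ i) \<le> 1" using xi by simp
    thus "wave a b m i x \<le> real (m i)" unfolding wave_def using mult_left_mono by fastforce
  qed
  then obtain k where "\<And>i. k i \<le> m i \<and> \<bar>wave a b m i x - real (k i)\<bar> < 1 / 2" by metis
  thus "\<exists>k\<in>{k. \<forall>i. k i \<le> m i}. x \<in> cell a b m k" using x by (auto simp: cell_def)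
next
  assume "\<exists>k\<in>{k. \<forall>i. k i \<le> m i}. x \<in> cell a b m k"
  then obtain k where "\<And>i. \<bar>wave a b m i x - real (k i)\<bar> < 1 / 2" by (auto simp: cell_def)
  hence "cos (pi * wave a b m i x) \<noteq> 0" for i by (rule cos_pi_nonzero_near)
  thus "mode a b m x \<noteq> 0" unfolding mode_wave by simp
qed

lemma cell_alt:
  "cell a b m k = box a b \<inter> (\<Inter>i. {x. wave a b m i x < real (k i) + 1 / 2} \<inter> {x. wave a b m i x > real (k i) - 1 / 2})"
proof (rule set_eqI)
  fix x
  have "\<bar>wave a b m i x - real (k i)\<bar> < 1 / 2 \<longleftrightarrow> wave a b m i x < real (k i) + 1 / 2 \<and> wave a b m i x > real (k i) - 1 / 2" for i
    by (simp only: abs_less_iff) linarith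
  thus "x \<in> cell a b m k \<longleftrightarrow> x \<in> box a b \<inter> (\<Inter>i. {x. wave a b m i x < real (k i) + 1 / 2} \<inter> {x. wave a b m i x > real (k i) - 1 / 2})"
    unfolding cell_def by blast
qed

lemma continuous_wave: "continuous_on S (wave a b m i)"
  unfolding wave_def divide_inverse by (intro continuous_intros)

lemma open_cell: "open (cell a b m k)"
  unfolding cell_alt
  by (intro open_Int open_INT open_box ballI open_Collect_less continuous_wave continuous_on_const) auto

lemma convex_wave_halfspaces:
  "convex {x. wave a b m i x < t}" "convex {x. wave a b m i x > t}"
proof -
  have w: "wave a b m i x = (real (m i) / (b $ i - a $ i)) * x $ i - real (m i) * a $ i / (b $ i - a $ i)" for x
    by (simp add: wave_def right_diff_distrib diff_divide_distrib)
  have comb: "wave a b m i (u *\<^sub>R x + v *\<^sub>R y) = u * wave a b m i x + v * wave a b m i y" if "u + v = 1" for x y u v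
  proof -
    define A B where "A = real (m i) / (b $ i - a $ i)" and "B = real (m i) * a $ i / (b $ i - a $ i)"
    have "wave a b m i (u *\<^sub>R x + v *\<^sub>R y) = A * (u * x $ i + v * y $ i) - (u + v) * B"
      unfolding w using that by (simp add: A_def B_def)
    also have "\<dots> = u * wave a b m i x + v * wave a b m i y"
      unfolding w A_def[symmetric] B_def[symmetric] by (simp add: algebra_simps)
    finally show ?thesis .
  qed
  show "convex {x. wave a b m i x < t}"
  proof (rule convexI)
    fix x y u v assume *: "x \<in> {x. wave a b m i x < t}" "y \<in> {x. wave a b m i x < t}" "0 \<le> u" "0 \<le> v" "u + v = (1::real)"
    have "u * wave a b m i x + v * wave a b m i y < t" using * by (intro convex_bound_lt) auto
    thus "u *\<^sub>R x + v *\<^sub>R y \<in> {x. wave a b m i x < t}" using comb[OF *(5)] by simp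
  qed
  show "convex {x. wave a b m i x > t}"
  proof (rule convexI)
    fix x y u v assume *: "x \<in> {x. wave a b m i x > t}" "y \<in> {x. wave a b m i x > t}" "0 \<le> u" "0 \<le> v" "u + v = (1::real)"
    have "u * (- wave a b m i x) + v * (- wave a b m i y) < - t" using * by (intro convex_bound_lt) auto
    thus "u *\<^sub>R x + v *\<^sub>R y \<in> {x. wave a b m i x > t}" using comb[OF *(5)] by simp
  qed
qed

lemma connected_cell: "connected (cell a b m k)"
  unfolding cell_alt
  by (intro convex_connected convex_Int convex_INT convex_box convex_wave_halfspaces)

lemma abs_of_nat_plus_one: "\<bar>real k + 1\<bar> = real k + 1"
  by simp

lemma cell_nonempty:
  fixes a b :: "real^'n"
  assumes ab: "\<And>i. a $ i < b $ i" and k: "\<And>i. k i \<le> m i"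
  shows "cell a b m k \<noteq> {}"
proof -
  \<comment> \<open>The centre of part \<open>k i\<close> among \<open>m i + 1\<close> equal parts,
    counted from 0. Its phase differs from \<open>k i\<close> by at most
    \<open>m i / (2 * (m i + 1))\<close>, which treats inner and outer cells alike.\<close>
  define t where "t i = (real (k i) + 1 / 2) / (real (m i) + 1)" for i
  define x where "x = (\<chi> i. a $ i + t i * (b $ i - a $ i))"
  have t: "0 < t i" "t i < 1" for i using k[of i] by (simp_all add: t_def)
  have w: "wave a b m i x = real (m i) * t i" for i
    using ab[of i] by (simp add: wave_def x_def)
  have "\<bar>wave a b m i x - real (k i)\<bar> < 1 / 2" for i
  proof -
    have "real (m i) * t i - real (k i) = (real (m i) / 2 - real (k i)) / (real (m i) + 1)"
      by (simp add: t_def field_simps)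
    moreover have "\<bar>real (m i) / 2 - real (k i)\<bar> \<le> real (m i) / 2" using k[of i] by linarith
    hence "\<bar>(real (m i) / 2 - real (k i)) / (real (m i) + 1)\<bar> \<le> real (m i) / 2 / (real (m i) + 1)"
      unfolding abs_divide by (simp only: abs_of_nat_plus_one) (rule divide_right_mono, auto)
    ultimately have "\<bar>real (m i) * t i - real (k i)\<bar> \<le> real (m i) / 2 / (real (m i) + 1)" by (simp only:)
    also have "\<dots> < 1 / 2" by (simp add: field_simps)
    finally show ?thesis unfolding w .
  qed
  moreover have "x \<in> box a b"
    unfolding mem_box_cart
  proof
    fix i
    have "t i * (b $ i - a $ i) < 1 * (b $ i - a $ i)" using t[of i] ab[of i] by (intro mult_strict_right_mono) auto
    moreover have "0 < t i * (b $ i - a $ i)" using t[of i] ab[of i] by simp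
    ultimately show "a $ i < x $ i \<and> x $ i < b $ i" by (simp add: x_def)
  qed
  ultimately have "x \<in> cell a b m k" by (simp add: cell_def)
  thus ?thesis by blast
qed

lemma cell_index_unique:
  assumes "x \<in> cell a b m k" "x \<in> cell a b m l" shows "k = l"
proof
  fix i
  have "\<bar>wave a b m i x - real (k i)\<bar> < 1 / 2" "\<bar>wave a b m i x - real (l i)\<bar> < 1 / 2"
    using assms by (auto simp: cell_def)
  hence "\<bar>real (k i) - real (l i)\<bar> < 1" by linarith
  thus "k i = l i" by linarith
qed

lemma nodal_domains_mode:
  fixes a b :: "real^'n"
  assumes ab: "\<And>i. a $ i < b $ i"
  shows "nodal_domains (box a b) (mode a b m) = cell a b m ` {k. \<forall>i. k i \<le> m i}"
  unfolding nodal_domains_alt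
proof (rule components_eq_partition)
  show "\<Union>(cell a b m ` {k. \<forall>i. k i \<le> m i}) = {x \<in> box a b. mode a b m x \<noteq> 0}"
  proof (rule set_eqI)
    fix x
    have "x \<in> cell a b m k \<Longrightarrow> x \<in> box a b" for k by (simp add: cell_def)
    thus "x \<in> \<Union>(cell a b m ` {k. \<forall>i. k i \<le> m i}) \<longleftrightarrow> x \<in> {x \<in> box a b. mode a b m x \<noteq> 0}"
      using mode_nonzero_iff[OF ab, of x m] by blast
  qed
  show "C = D" if "C \<in> cell a b m ` {k. \<forall>i. k i \<le> m i}" "D \<in> cell a b m ` {k. \<forall>i. k i \<le> m i}" "x \<in> C" "x \<in> D" for C D x
    using that cell_index_unique[of x a b m] by blast
qed (use open_cell connected_cell cell_nonempty[OF ab] in auto)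

lemma card_le_functions: "card {k :: 'n::finite \<Rightarrow> nat. \<forall>i. k i \<le> m i} = (\<Prod>i\<in>UNIV. m i + 1)"
proof -
  have "{k :: 'n \<Rightarrow> nat. \<forall>i. k i \<le> m i} = (\<Pi>\<^sub>E i\<in>UNIV. {..m i})" by auto
  thus ?thesis by (simp add: card_PiE)
qed

lemma finite_le_functions: "finite {k :: 'n::finite \<Rightarrow> nat. \<forall>i. k i \<le> m i}"
proof -
  have "{k :: 'n \<Rightarrow> nat. \<forall>i. k i \<le> m i} = (\<Pi>\<^sub>E i\<in>UNIV. {..m i})" by auto
  thus ?thesis by (simp add: finite_PiE)
qed

lemma card_nodal_domains_mode:
  fixes a b :: "real^'n"
  assumes ab: "\<And>i. a $ i < b $ i"
  shows "card (nodal_domains (box a b) (mode a b m)) = (\<Prod>i\<in>UNIV. m i + 1)"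
proof -
  have "inj_on (cell a b m) {k. \<forall>i. k i \<le> m i}"
  proof (rule inj_onI)
    fix k l assume kl: "k \<in> {k. \<forall>i. k i \<le> m i}" "l \<in> {k. \<forall>i. k i \<le> m i}" "cell a b m k = cell a b m l"
    then obtain x where "x \<in> cell a b m k" using cell_nonempty[OF ab, of k m] by auto
    thus "k = l" using kl(3) cell_index_unique[of x a b m k l] by simp
  qed
  thus ?thesis unfolding nodal_domains_mode[OF ab] by (simp add: card_image card_le_functions)
qed

lemma energy_strict_mono:
  fixes a b :: "real^'n"
  assumes ab: "\<And>i. a $ i < b $ i" and k: "\<And>i. k i \<le> m i" "k \<noteq> m"
  shows "energy a b k < energy a b m"
proof -
  obtain j where j: "k j \<noteq> m j" using k(2) by auto
  hence "k j < m j" using k(1)[of j] by simp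
  show ?thesis unfolding energy_def
  proof (rule sum_strict_mono_ex1)
    show "\<forall>i\<in>UNIV. (real (k i) * freq a b i)\<^sup>2 \<le> (real (m i) * freq a b i)\<^sup>2"
    proof
      fix i
      show "(real (k i) * freq a b i)\<^sup>2 \<le> (real (m i) * freq a b i)\<^sup>2"
        using k(1)[of i] freq_pos[OF ab, of i] by (intro power_mono mult_right_mono) auto
    qed
    show "\<exists>i\<in>UNIV. (real (k i) * freq a b i)\<^sup>2 < (real (m i) * freq a b i)\<^sup>2"
    proof (rule bexI[of _ j])
      show "(real (k j) * freq a b j)\<^sup>2 < (real (m j) * freq a b j)\<^sup>2"
        using \<open>k j < m j\<close> freq_pos[OF ab, of j] by (intro power_strict_mono mult_strict_right_mono) auto
    qed simp
  qed simp
qed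

lemma sharp_simple_iff:
  fixes a b :: "real^'n"
  assumes ab: "\<And>i. a $ i < b $ i" and simple: "{k. energy a b k = mu} = {m}"
  shows "sharp a b mu \<longleftrightarrow> (\<Prod>i\<in>UNIV. m i + 1) = card {k. energy a b k < mu} + 1"
proof -
  have eig: "eigsum a b mu c x = c m * mode a b m x" for c x
    unfolding eigsum_def simple by simp
  have "nodal_domains (box a b) (eigsum a b mu c) = nodal_domains (box a b) (mode a b m)" if "c m \<noteq> 0" for c
    unfolding nodal_domains_alt eig using that by simp
  hence nu: "card (nodal_domains (box a b) (eigsum a b mu c)) = (\<Prod>i\<in>UNIV. m i + 1)" if "c m \<noteq> 0" for c
    using that card_nodal_domains_mode[OF ab, of m] by simp
  have "(\<exists>k. energy a b k = mu \<and> c k \<noteq> 0) \<longleftrightarrow> c m \<noteq> 0" for c :: "('n \<Rightarrow> nat) \<Rightarrow> real"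
  proof -
    have "energy a b k = mu \<longleftrightarrow> k = m" for k using simple by (simp add: set_eq_iff)
    thus ?thesis by simp
  qed
  hence "sharp a b mu \<longleftrightarrow> (\<exists>c::('n \<Rightarrow> nat) \<Rightarrow> real. c m \<noteq> 0 \<and> card (nodal_domains (box a b) (eigsum a b mu c)) = card {k. energy a b k < mu} + 1)"
    unfolding sharp_def by simp
  also have "\<dots> \<longleftrightarrow> (\<exists>c::('n \<Rightarrow> nat) \<Rightarrow> real. c m \<noteq> 0 \<and> (\<Prod>i\<in>UNIV. m i + 1) = card {k. energy a b k < mu} + 1)"
    by (intro ex_cong1 conj_cong refl) (subst nu, assumption, rule refl)
  also have "\<dots> \<longleftrightarrow> (\<Prod>i\<in>UNIV. m i + 1) = card {k. energy a b k < mu} + 1"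
    by (auto intro: exI[of _ "\<lambda>_. 1"])
  finally show ?thesis .
qed

text \<open>The vectors componentwise below \<open>m\<close>, other than \<open>m\<close>, have
  smaller energy and already account for the product minus one. A further mode below
  \<open>mu\<close> pushes the counting number past the number of nodal domains.\<close>

lemma not_sharp_simple:
  fixes a b :: "real^'n"
  assumes ab: "\<And>i. a $ i < b $ i" and simple: "{k. energy a b k = mu} = {m}"
    and z: "energy a b z < mu" "m i < z i"
  shows "\<not> sharp a b mu"
proof -
  have mu: "energy a b m = mu" using simple by blast
  have "insert z ({k. \<forall>i. k i \<le> m i} - {m}) \<subseteq> {k. energy a b k < mu}"
    using z(1) energy_strict_mono[OF ab, of _ m] mu by auto
  hence "card (insert z ({k. \<forall>i. k i \<le> m i} - {m})) \<le> card {k. energy a b k < mu}"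
    by (intro card_mono finite_energy_eq[OF ab])
  moreover have "card (insert z ({k. \<forall>i. k i \<le> m i} - {m})) = card {k. \<forall>i. k i \<le> m i}"
  proof -
    have "z \<notin> {k. \<forall>i. k i \<le> m i}" using z(2) not_less by blast
    moreover have "m \<in> {k. \<forall>i. k i \<le> m i}" by simp
    ultimately show ?thesis
      using finite_le_functions[of m] card.remove[OF finite_le_functions, of m m]
      by (subst card_insert_disjoint) simp_all
  qed
  ultimately show ?thesis unfolding sharp_simple_iff[OF ab simple] card_le_functions[symmetric] by simp
qed

text \<open>The opposite situation: the modes below \<open>mu\<close> are exactly the vectors
  componentwise below \<open>m\<close>, so the count is exact.\<close>

lemma sharp_simple:
  fixes a b :: "real^'n"
  assumes ab: "\<And>i. a $ i < b $ i" and simple: "{k. energy a b k = mu} = {m}"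
    and below: "\<And>k i. energy a b k < mu \<Longrightarrow> k i \<le> m i"
  shows "sharp a b mu" "card {k. energy a b k < mu} + 1 = (\<Prod>i\<in>UNIV. m i + 1)"
proof -
  have mu: "energy a b m = mu" using simple by blast
  have "{k. energy a b k < mu} = {k. \<forall>i. k i \<le> m i} - {m}"
    using below energy_strict_mono[OF ab, of _ m] mu by auto
  moreover have "m \<in> {k. \<forall>i. k i \<le> m i}" by simp
  ultimately show eq: "card {k. energy a b k < mu} + 1 = (\<Prod>i\<in>UNIV. m i + 1)"
    using card.remove[OF finite_le_functions, of m m] unfolding card_le_functions[symmetric] by simp
  show "sharp a b mu" unfolding sharp_simple_iff[OF ab simple] eq ..
qed

subsection \<open>Trigonometric sums solve the Neumann problem\<close>

text \<open>Products of functions of single coordinates. A partial derivative replaces one factor,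
  so the same rule yields gradients and Hessians of the modes.\<close>

definition pf :: "('n::finite \<Rightarrow> real \<Rightarrow> real) \<Rightarrow> real^'n \<Rightarrow> real" where
  "pf f x = (\<Prod>j\<in>UNIV. f j (x $ j))"

lemma pf_update: "pf (f(i := g)) x = g (x $ i) * (\<Prod>j\<in>UNIV - {i}. f j (x $ j))"
  unfolding pf_def by (subst prod.remove[of _ i]) (auto intro!: prod.cong)

lemma has_derivative_pf:
  assumes "\<And>j y. (f j has_real_derivative f' j y) (at y)"
  shows "(pf f has_derivative (\<lambda>v. \<Sum>j\<in>UNIV. v $ j * pf (f(j := f' j)) x)) (at x)"
proof -
  have "((\<lambda>x. \<Prod>j\<in>UNIV. f j (x $ j)) has_derivative
     (\<lambda>v. \<Sum>j\<in>UNIV. (f' j (x $ j) * v $ j) * (\<Prod>k\<in>UNIV - {j}. f k (x $ k)))) (at x)"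
  proof (rule has_derivative_prod)
    fix j
    have "((\<lambda>x. x $ j) has_derivative (\<lambda>v. v $ j)) (at x)"
      by (rule bounded_linear.has_derivative[OF bounded_linear_vec_nth]) (rule has_derivative_ident)
    from DERIV_compose_FDERIV[OF assms this]
    show "((\<lambda>x. f j (x $ j)) has_derivative (\<lambda>v. f' j (x $ j) * v $ j)) (at x)"
      by (simp add: mult.commute)
  qed
  moreover have "pf f = (\<lambda>x. \<Prod>j\<in>UNIV. f j (x $ j))" by (rule ext) (simp add: pf_def)
  ultimately show ?thesis unfolding pf_update by (simp add: mult_ac)
qed

lemma continuous_pf:
  assumes "\<And>j. continuous_on UNIV (f j)"
  shows "continuous_on S (pf f)"
  unfolding pf_def[abs_def]
  by (intro continuous_on_prod continuous_on_compose2[OF assms] continuous_intros) auto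

definition wcos :: "real^'n \<Rightarrow> real^'n \<Rightarrow> ('n \<Rightarrow> nat) \<Rightarrow> 'n \<Rightarrow> real \<Rightarrow> real" where
  "wcos a b m j y = cos (real (m j) * freq a b j * (y - a $ j))"

definition wsin :: "real^'n \<Rightarrow> real^'n \<Rightarrow> ('n \<Rightarrow> nat) \<Rightarrow> 'n \<Rightarrow> real \<Rightarrow> real" where
  "wsin a b m j y = - (real (m j) * freq a b j) * sin (real (m j) * freq a b j * (y - a $ j))"

lemma wcos_deriv: "(wcos a b m j has_real_derivative wsin a b m j y) (at y)"
  unfolding wcos_def[abs_def] wsin_def by (auto intro!: derivative_eq_intros)

lemma wsin_deriv: "(wsin a b m j has_real_derivative - (real (m j) * freq a b j)\<^sup>2 * wcos a b m j y) (at y)"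
  unfolding wcos_def wsin_def[abs_def] by (auto intro!: derivative_eq_intros simp: power2_eq_square)

lemma continuous_wcos: "continuous_on S (wcos a b m j)"
  unfolding wcos_def[abs_def] by (intro continuous_intros)

lemma continuous_wsin: "continuous_on S (wsin a b m j)"
  unfolding wsin_def[abs_def] by (intro continuous_intros)

lemma mode_pf: "mode a b m = pf (wcos a b m)"
  by (rule ext) (simp add: mode_def pf_def wcos_def)

definition dmode :: "real^'n \<Rightarrow> real^'n \<Rightarrow> ('n \<Rightarrow> nat) \<Rightarrow> 'n \<Rightarrow> real^'n \<Rightarrow> real" where
  "dmode a b m i = pf ((wcos a b m)(i := wsin a b m i))"

text \<open>For \<open>j = i\<close> the factor that was differentiated is differentiated once more,
  otherwise a second factor is.\<close>

definition d2mode :: "real^'n \<Rightarrow> real^'n \<Rightarrow> ('n \<Rightarrow> nat) \<Rightarrow> 'n \<Rightarrow> 'n \<Rightarrow> real^'n \<Rightarrow> real" where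
  "d2mode a b m i j = pf (((wcos a b m)(i := wsin a b m i))
     (j := (if j = i then (\<lambda>y. - (real (m i) * freq a b i)\<^sup>2 * wcos a b m i y) else wsin a b m j)))"

lemma d2mode_same: "d2mode a b m i i x = - (real (m i) * freq a b i)\<^sup>2 * mode a b m x"
proof -
  have "mode a b m x = wcos a b m i (x $ i) * (\<Prod>j\<in>UNIV - {i}. wcos a b m j (x $ j))"
    using pf_update[of "wcos a b m" i "wcos a b m i" x] by (simp add: mode_pf)
  thus ?thesis unfolding d2mode_def by (simp add: pf_update)
qed

lemma mode_has_derivative: "(mode a b m has_derivative (\<lambda>v. \<Sum>j\<in>UNIV. v $ j * dmode a b m j x)) (at x)"
  unfolding mode_pf dmode_def by (rule has_derivative_pf) (rule wcos_deriv)

lemma dmode_has_derivative: "(dmode a b m i has_derivative (\<lambda>v. \<Sum>j\<in>UNIV. v $ j * d2mode a b m i j x)) (at x)"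
proof -
  define f' where "f' j = (if j = i then (\<lambda>y. - (real (m i) * freq a b i)\<^sup>2 * wcos a b m i y) else wsin a b m j)" for j
  have "(((wcos a b m)(i := wsin a b m i)) j has_real_derivative f' j y) (at y)" for j y
    using wsin_deriv[of a b m i y] wcos_deriv[of a b m j y] by (simp add: f'_def)
  from has_derivative_pf[OF this] show ?thesis unfolding dmode_def d2mode_def f'_def .
qed

lemma continuous_dmode: "continuous_on S (dmode a b m i)"
  unfolding dmode_def by (rule continuous_pf) (simp add: continuous_wcos continuous_wsin)

lemma continuous_d2mode: "continuous_on S (d2mode a b m i j)"
  unfolding d2mode_def
  by (rule continuous_pf) (auto intro!: continuous_wcos continuous_wsin continuous_intros)

lemma dmode_face:
  assumes "a $ i < b $ i" "x $ i = a $ i \<or> x $ i = b $ i"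
  shows "dmode a b m i x = 0"
proof -
  have "real (m i) * freq a b i * (b $ i - a $ i) = real (m i) * pi" using assms(1) by (simp add: freq_def)
  hence "wsin a b m i (x $ i) = 0"
    using assms(2) unfolding wsin_def by (elim disjE) (simp_all only: sin_npi diff_self mult_zero_right sin_zero)
  thus ?thesis by (simp add: dmode_def pf_update)
qed

lemma sum_Basis_vec: "(\<Sum>u\<in>(Basis :: (real^'n) set). f u) = (\<Sum>i\<in>UNIV. f (axis i 1))"
proof -
  have B: "(Basis :: (real^'n) set) = range (\<lambda>i. axis i 1)" by (auto simp: Basis_vec_def)
  have "inj (\<lambda>i. axis i 1 :: real^'n)" by (rule injI) (simp add: axis_eq_axis)
  from sum.reindex[OF this, of f] show ?thesis unfolding B o_def .
qed

text \<open>Any defining function \<open>g\<close> vanishes on the boundary near \<open>p\<close>,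
  and the line through \<open>p\<close> in direction \<open>i\<close> runs inside the boundary
  there. So the \<open>i\<close>-th partial derivative of \<open>g\<close> is 0, whichever
  \<open>g\<close> is chosen.\<close>

lemma outward_unit_normal_box:
  fixes a b :: "real^'n"
  assumes ab: "\<And>i. a $ i < b $ i" and n: "outward_unit_normal (box a b) p nu" and i: "a $ i < p $ i" "p $ i < b $ i"
  shows "nu $ i = 0"
proof -
  obtain U g G where U: "p \<in> frontier (box a b)" "open U" "p \<in> U" "\<And>x. x \<in> U \<Longrightarrow> GDERIV g x :> G x"
    "box a b \<inter> U = {x \<in> U. g x < 0}" "nu = sgn (G p)"
    using n unfolding outward_unit_normal_def by blast
  have ne: "box a b \<noteq> {}" using ab by (auto simp: interval_ne_empty_cart)
  have p: "p \<in> cbox a b" "p \<notin> box a b" using U(1) ne by (auto simp: frontier_def interior_open[OF open_box])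
  have gd: "(g has_derivative (\<lambda>h. h \<bullet> G x)) (at x)" if "x \<in> U" for x
    using U(4)[OF that] by (simp add: gderiv_def)
  have gc: "isCont g x" if "x \<in> U" for x
    using has_derivative_continuous[OF gd[OF that]] .
  have out: "upd p i t \<notin> box a b" for t
  proof
    assume *: "upd p i t \<in> box a b"
    hence "p \<in> box a b" using i upd_in_box_iff[of p i t a b] upd_in_box_iff[of p i "p $ i" a b] by simp
    thus False using p by simp
  qed
  have "continuous (at (p $ i)) (\<lambda>t. upd p i t)"
  proof -
    have "(\<lambda>t. upd p i t) = (\<lambda>t. p + (t - p $ i) *\<^sub>R axis i 1)" by (auto simp: vec_eq_iff upd_nth axis_def)
    thus ?thesis by (simp add: continuous_intros)
  qed
  hence "((\<lambda>t. upd p i t) \<longlongrightarrow> p) (at (p $ i))" by (simp add: isCont_def)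
  hence ev: "eventually (\<lambda>t. upd p i t \<in> U) (at (p $ i))" using U(2,3) topological_tendstoD by blast
  have ev2: "eventually (\<lambda>t. t \<in> {a $ i<..<b $ i}) (at (p $ i))"
    using i by (intro eventually_at_in_open') auto
  \<comment> \<open>Outside the box \<open>g\<close> is nonnegative on \<open>U\<close>; as a limit
    of points of the box, where \<open>g\<close> is negative, a boundary point also has
    \<open>g\<close> at most 0.\<close>
  have zero: "g q = 0" if q: "q \<in> U" "q \<in> cbox a b" "q \<notin> box a b" for q
  proof (rule antisym)
    show "0 \<le> g q" using U(5) q by (auto simp: not_less[symmetric])
    show "g q \<le> 0"
    proof (rule ccontr)
      assume "\<not> g q \<le> 0"
      hence "g q > 0" by simp
      have "(g \<longlongrightarrow> g q) (nhds q)" using gc[OF q(1)] by (simp add: isCont_def tendsto_at_iff_tendsto_nhds)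
      hence "eventually (\<lambda>x. g x > 0) (nhds q)" using \<open>g q > 0\<close> order_tendstoD(1) by blast
      hence "eventually (\<lambda>x. g x > 0 \<and> x \<in> U) (nhds q)"
        using eventually_nhds_in_open[OF U(2) q(1)] by (rule eventually_conj)
      then obtain V where V: "open V" "q \<in> V" "\<And>x. x \<in> V \<Longrightarrow> g x > 0 \<and> x \<in> U"
        unfolding eventually_nhds by blast
      have "q \<in> closure (box a b)" using q(2) ne by simp
      then obtain x where "x \<in> box a b" "x \<in> V" using V(1,2) closure_iff_nhds_not_empty by blast
      thus False using V(3)[of x] U(5) by force
    qed
  qed
  have "eventually (\<lambda>t. g (upd p i t) = 0) (at (p $ i))"
    using ev ev2
  proof eventually_elim
    case (elim t)
    have "upd p i t \<in> cbox a b" using p(1) elim(2) by (auto simp: mem_box_cart upd_nth)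
    thus ?case using zero[OF elim(1)] out by blast
  qed
  moreover have "g p = 0" by (rule zero[OF U(3) p])
  moreover have "((\<lambda>t. g (upd p i t)) has_real_derivative G p $ i) (at (p $ i))"
  proof -
    have "((\<lambda>t. p + (t - p $ i) *\<^sub>R axis i 1) has_derivative (\<lambda>t. t *\<^sub>R axis i 1)) (at (p $ i))"
      by (auto intro!: derivative_eq_intros)
    moreover have "(\<lambda>t. p + (t - p $ i) *\<^sub>R axis i 1) = upd p i" by (auto simp: vec_eq_iff upd_nth axis_def)
    ultimately have "(upd p i has_derivative (\<lambda>t. t *\<^sub>R axis i 1)) (at (p $ i))" by simp
    moreover have "(g has_derivative (\<lambda>h. h \<bullet> G p)) (at (upd p i (p $ i)))" using gd[OF U(3)] by simp
    ultimately have "((\<lambda>t. g (upd p i t)) has_derivative (\<lambda>t. (t *\<^sub>R axis i 1) \<bullet> G p)) (at (p $ i))"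
      by (rule has_derivative_compose)
    thus ?thesis by (simp add: has_field_derivative_def inner_axis' mult_commute_abs)
  qed
  ultimately have "((\<lambda>t. 0) has_real_derivative G p $ i) (at (p $ i))"
    by (subst (asm) has_field_derivative_cong_eventually[where g = "\<lambda>t. 0"]) simp_all
  hence "G p $ i = 0" using DERIV_unique[OF _ DERIV_const] by blast
  thus ?thesis unfolding U(6) by (simp add: sgn_div_norm)
qed

definition zero_ext :: "'a set \<Rightarrow> ('a \<Rightarrow> real) \<Rightarrow> 'a \<Rightarrow> real" where
  "zero_ext S f x = (if x \<in> S then f x else 0)"

lemma has_derivative_zero_ext:
  assumes "(f has_derivative f') (at x)" "x \<in> box a b"
  shows "(zero_ext (cbox a b) f has_derivative f') (at x)"
proof (rule has_derivative_transform_within_open[OF assms(1) open_box assms(2)])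
  show "f y = zero_ext (cbox a b) f y" if "y \<in> box a b" for y
    using that box_subset_cbox[of a b] by (auto simp: zero_ext_def)
qed

text \<open>In \<open>G p \<bullet> nu\<close> each product of components vanishes separately: along
  an axis where \<open>p\<close> is interior the normal has no component, and at a face the sine
  factor of the derivative is 0. Edges and corners are thus covered as well.\<close>

lemma eigsum_neumann_solution:
  fixes a b :: "real^'n"
  assumes ab: "\<And>i. a $ i < b $ i"
  shows "neumann_solution (box a b) mu (zero_ext (cbox a b) (eigsum a b mu c))"
proof -
  let ?E = "{m. energy a b m = mu}"
  define g where "g i x = (\<Sum>m\<in>?E. c m * dmode a b m i x)" for i x
  define g2 where "g2 i j x = (\<Sum>m\<in>?E. c m * d2mode a b m i j x)" for i j x
  define G where "G x = (\<Sum>i\<in>UNIV. g i x *\<^sub>R (axis i 1 :: real^'n))" for x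
  define H where "H x v = (\<Sum>i\<in>UNIV. (\<Sum>j\<in>UNIV. v $ j * g2 i j x) *\<^sub>R (axis i 1 :: real^'n))" for x v
  have Gn: "G x $ k = g k x" for x k
    by (simp add: G_def axis_def sum.delta if_distrib cong: if_cong)
  have Hn: "H x v $ k = (\<Sum>j\<in>UNIV. v $ j * g2 k j x)" for x v k
    by (simp add: H_def axis_def sum.delta if_distrib cong: if_cong)
  have ne: "box a b \<noteq> {}" using ab by (auto simp: interval_ne_empty_cart)
  have cl: "closure (box a b) = cbox a b" using ne by simp
  have P': "(eigsum a b mu c has_derivative (\<lambda>v. \<Sum>m\<in>?E. c m * (\<Sum>j\<in>UNIV. v $ j * dmode a b m j x))) (at x)" for x
    unfolding eigsum_def[abs_def] by (intro has_derivative_sum has_derivative_mult_right mode_has_derivative)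
  have "(\<Sum>m\<in>?E. c m * (\<Sum>j\<in>UNIV. v $ j * dmode a b m j x)) = v \<bullet> G x" for v x
  proof -
    have "(\<Sum>m\<in>?E. c m * (\<Sum>j\<in>UNIV. v $ j * dmode a b m j x)) = (\<Sum>m\<in>?E. \<Sum>j\<in>UNIV. v $ j * (c m * dmode a b m j x))"
      by (simp add: sum_distrib_left mult_ac)
    also have "\<dots> = (\<Sum>j\<in>UNIV. v $ j * g j x)"
      unfolding g_def sum_distrib_left by (rule sum.swap)
    finally show ?thesis by (simp add: inner_vec_def Gn)
  qed
  with P' have P: "(eigsum a b mu c has_derivative (\<lambda>v. v \<bullet> G x)) (at x)" for x by simp
  have g': "(g i has_derivative (\<lambda>v. \<Sum>j\<in>UNIV. v $ j * g2 i j x)) (at x)" for i x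
  proof -
    have "(g i has_derivative (\<lambda>v. \<Sum>m\<in>?E. c m * (\<Sum>j\<in>UNIV. v $ j * d2mode a b m i j x))) (at x)"
      unfolding g_def[abs_def] by (intro has_derivative_sum has_derivative_mult_right dmode_has_derivative)
    moreover have "(\<Sum>m\<in>?E. c m * (\<Sum>j\<in>UNIV. v $ j * d2mode a b m i j x)) = (\<Sum>j\<in>UNIV. v $ j * g2 i j x)" for v
    proof -
      have "(\<Sum>m\<in>?E. c m * (\<Sum>j\<in>UNIV. v $ j * d2mode a b m i j x)) = (\<Sum>m\<in>?E. \<Sum>j\<in>UNIV. v $ j * (c m * d2mode a b m i j x))"
        by (simp add: sum_distrib_left mult_ac)
      also have "\<dots> = (\<Sum>j\<in>UNIV. v $ j * g2 i j x)"
        unfolding g2_def sum_distrib_left by (rule sum.swap)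
      finally show ?thesis .
    qed
    ultimately show ?thesis by simp
  qed
  have gc: "continuous_on S (g i)" "continuous_on S (g2 i j)" for S i j
    unfolding g_def[abs_def] g2_def[abs_def] by (intro continuous_intros continuous_dmode continuous_d2mode)+
  show ?thesis unfolding neumann_solution_def cl
  proof (intro exI[of _ G] exI[of _ H] conjI ballI allI impI)
    show "continuous_on (cbox a b) (zero_ext (cbox a b) (eigsum a b mu c))"
      using continuous_eigsum[of "cbox a b" a b mu c] by (rule continuous_on_eq) (simp add: zero_ext_def)
    show "continuous_on (cbox a b) G" unfolding G_def[abs_def] by (intro continuous_intros gc)
    show "GDERIV (zero_ext (cbox a b) (eigsum a b mu c)) x :> G x" if "x \<in> box a b" for x
      unfolding gderiv_def by (rule has_derivative_zero_ext[OF P that])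
    show "(G has_derivative H x) (at x)" for x
      unfolding G_def[abs_def] H_def[abs_def] by (intro has_derivative_sum has_derivative_scaleR_left g')
    show "continuous_on (box a b) (\<lambda>x. H x v)" for v
      unfolding H_def[abs_def] by (intro continuous_intros gc)
    show "- (\<Sum>u\<in>Basis. H x u \<bullet> u) = mu * zero_ext (cbox a b) (eigsum a b mu c) x" if "x \<in> box a b" for x
    proof -
      have "(\<Sum>u\<in>Basis. H x u \<bullet> u) = (\<Sum>i\<in>UNIV. g2 i i x)"
        unfolding sum_Basis_vec
      proof (rule sum.cong[OF refl])
        fix i
        have "H x (axis i 1) \<bullet> axis i 1 = H x (axis i 1) $ i" by (simp add: cart_eq_inner_axis)
        also have "\<dots> = (\<Sum>j\<in>UNIV. if j = i then g2 i j x else 0)"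
          unfolding Hn by (rule sum.cong) (auto simp: axis_def)
        finally show "H x (axis i 1) \<bullet> axis i 1 = g2 i i x" by simp
      qed
      also have "\<dots> = (\<Sum>m\<in>?E. \<Sum>i\<in>UNIV. c m * d2mode a b m i i x)"
        unfolding g2_def by (rule sum.swap)
      also have "\<dots> = (\<Sum>m\<in>?E. - mu * (c m * mode a b m x))"
      proof (rule sum.cong[OF refl])
        fix m assume m: "m \<in> ?E"
        have "(\<Sum>i\<in>UNIV. c m * d2mode a b m i i x) = - energy a b m * (c m * mode a b m x)"
          unfolding d2mode_same energy_def by (simp add: sum_distrib_left sum_distrib_right sum_negf mult_ac)
        thus "(\<Sum>i\<in>UNIV. c m * d2mode a b m i i x) = - mu * (c m * mode a b m x)" using m by simp
      qed
      also have "\<dots> = - mu * eigsum a b mu c x" by (simp add: eigsum_def sum_distrib_left)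
      finally show ?thesis using that box_subset_cbox[of a b] by (auto simp: zero_ext_def)
    qed
    show "G p \<bullet> nu = 0" if nu: "outward_unit_normal (box a b) p nu" for p nu
    proof -
      have "G p $ i * nu $ i = 0" for i
      proof (cases "a $ i < p $ i \<and> p $ i < b $ i")
        case True
        thus ?thesis using outward_unit_normal_box[OF ab nu, of i] by simp
      next
        case False
        have "p \<in> cbox a b" using nu ne by (auto simp: outward_unit_normal_def frontier_def)
        hence "a $ i \<le> p $ i" "p $ i \<le> b $ i" by (auto simp: mem_box_cart)
        hence "p $ i = a $ i \<or> p $ i = b $ i" using False by linarith
        thus ?thesis unfolding Gn g_def using dmode_face[OF ab] by simp
      qed
      hence "(\<Sum>i\<in>UNIV. G p $ i * nu $ i) = 0" by (intro sum.neutral ballI)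
      thus ?thesis by (simp add: inner_vec_def)
    qed
  qed
qed

subsection \<open>Every Neumann solution is a trigonometric sum\<close>

text \<open>The second derivatives of a solution are continuous in the open box only and may be
  unbounded near its boundary, so integration takes place over boxes with all faces moved inwards by
  \<open>e\<close>.\<close>

definition shrink_lo :: "real^'n \<Rightarrow> real \<Rightarrow> real^'n" where
  "shrink_lo a e = (\<chi> i. a $ i + e)"

definition shrink_hi :: "real^'n \<Rightarrow> real \<Rightarrow> real^'n" where
  "shrink_hi b e = (\<chi> i. b $ i - e)"

abbreviation "shrunk a b e \<equiv> box (shrink_lo a e) (shrink_hi b e)"

lemma mem_shrunk: "x \<in> shrunk a b e \<longleftrightarrow> (\<forall>i. a $ i + e < x $ i \<and> x $ i < b $ i - e)"
  by (simp add: mem_box_cart shrink_lo_def shrink_hi_def)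

lemma mem_cbox_shrink:
  "x \<in> cbox (shrink_lo a e) (shrink_hi b e) \<longleftrightarrow> (\<forall>i. a $ i + e \<le> x $ i \<and> x $ i \<le> b $ i - e)"
  by (simp add: mem_box_cart shrink_lo_def shrink_hi_def)

lemma cbox_shrink_subset: "e > 0 \<Longrightarrow> cbox (shrink_lo a e) (shrink_hi b e) \<subseteq> box a b"
proof
  fix x assume e: "e > 0" and "x \<in> cbox (shrink_lo a e) (shrink_hi b e)"
  hence x: "a $ i + e \<le> x $ i" "x $ i \<le> b $ i - e" for i by (simp_all add: mem_cbox_shrink)
  have "a $ i < x $ i \<and> x $ i < b $ i" for i using x(1)[of i] x(2)[of i] e by linarith
  thus "x \<in> box a b" by (simp add: mem_box_cart)
qed

lemma shrunk_subset: "e \<ge> 0 \<Longrightarrow> shrunk a b e \<subseteq> box a b"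
proof
  fix x assume e: "e \<ge> 0" and "x \<in> shrunk a b e"
  hence x: "a $ i + e < x $ i" "x $ i < b $ i - e" for i by (simp_all add: mem_shrunk)
  have "a $ i < x $ i \<and> x $ i < b $ i" for i using x(1)[of i] x(2)[of i] e by linarith
  thus "x \<in> box a b" by (simp add: mem_box_cart)
qed

lemma all_iff_at: "(\<And>j. j \<noteq> i \<Longrightarrow> Q j) \<Longrightarrow> (\<forall>j. Q j) \<longleftrightarrow> Q i"
proof
  assume others: "\<And>j. j \<noteq> i \<Longrightarrow> Q j" and "Q i"
  thus "\<forall>j. Q j" by (metis (full_types))
qed blast

lemma measure_slab_le:
  fixes a b :: "real^'n"
  assumes ab: "\<And>i. a $ i < b $ i" and h: "0 \<le> h"
  shows "measure lborel (cbox (upd a i t) (upd b i (t + h))) \<le> h * (\<Prod>j\<in>UNIV - {i}. b $ j - a $ j)"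
proof -
  have "cbox (upd a i t) (upd b i (t + h)) \<noteq> {}"
    using ab h by (auto simp: interval_ne_empty_cart upd_nth less_imp_le)
  hence "measure lborel (cbox (upd a i t) (upd b i (t + h))) = (\<Prod>j\<in>UNIV. upd b i (t + h) $ j - upd a i t $ j)"
    by (rule content_cbox_cart)
  also have "\<dots> = h * (\<Prod>j\<in>UNIV - {i}. b $ j - a $ j)"
    by (subst prod.remove[of _ i]) (auto intro!: prod.cong simp: upd_nth)
  finally show ?thesis by simp
qed

lemma bounded_borel_on_cbox:
  fixes f :: "real^'n \<Rightarrow> real"
  assumes "continuous_on (cbox a b) f"
  shows "bounded_borel (\<lambda>x. indicat_real (cbox a b) x * f x)"
proof -
  have "bounded (f ` cbox a b)" by (intro compact_imp_bounded compact_continuous_image assms compact_cbox)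
  then obtain K where K: "K > 0" "\<And>x. x \<in> cbox a b \<Longrightarrow> \<bar>f x\<bar> \<le> K" unfolding bounded_pos by auto
  show ?thesis
  proof (rule bounded_borelI[where K = K])
    have "(\<lambda>x. indicat_real (cbox a b) x *\<^sub>R f x) \<in> borel_measurable borel"
      by (rule borel_measurable_continuous_on_indicator[OF _ assms]) simp
    thus "(\<lambda>x. indicat_real (cbox a b) x * f x) \<in> borel_measurable borel" by simp
    show "\<bar>indicat_real (cbox a b) x * f x\<bar> \<le> K" for x using K by (cases "x \<in> cbox a b") auto
  qed
qed

lemma integrable_indicator_bounded_borel:
  assumes "bounded_borel f" "A \<in> sets borel" "A \<subseteq> box a b"
  shows "integrable lborel (\<lambda>x. indicat_real A x * f x)"
proof -
  have "bounded_borel (\<lambda>x. indicat_real A x * f x)" by (intro bounded_borel_mult bounded_borel_indicator assms)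
  from integrable_bounded_borel_box[OF this, of a b]
  have "integrable lborel (\<lambda>x. indicat_real (box a b) x * (indicat_real A x * f x))" .
  also have "(\<lambda>x. indicat_real (box a b) x * (indicat_real A x * f x)) = (\<lambda>x. indicat_real A x * f x)"
  proof (rule ext)
    fix x show "indicat_real (box a b) x * (indicat_real A x * f x) = indicat_real A x * f x"
      using assms(3) by (cases "x \<in> A") auto
  qed
  finally show ?thesis .
qed

lemma abs_integral_le_slabs:
  fixes f :: "real^'n \<Rightarrow> real"
  assumes ab: "\<And>i. a $ i < b $ i" and h: "0 \<le> h" and eta: "eta \<ge> 0" and int: "integrable lborel f"
    and f: "\<And>x. \<bar>f x\<bar> \<le> eta * (indicat_real (cbox (upd a i s) (upd b i (s + h))) x + indicat_real (cbox (upd a i t) (upd b i (t + h))) x)"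
  shows "\<bar>integral\<^sup>L lborel f\<bar> \<le> 2 * eta * h * (\<Prod>j\<in>UNIV - {i}. b $ j - a $ j)"
proof -
  let ?S = "cbox (upd a i s) (upd b i (s + h))" and ?T = "cbox (upd a i t) (upd b i (t + h))"
  let ?A = "\<Prod>j\<in>UNIV - {i}. b $ j - a $ j"
  have fin: "integrable lborel (indicat_real (cbox u v))" for u v :: "real^'n"
    by (intro integrable_real_indicator) (use emeasure_lborel_cbox_finite[of u v] in \<open>auto simp: top.not_eq_extremum\<close>)
  have "\<bar>integral\<^sup>L lborel f\<bar> \<le> (LINT x|lborel. \<bar>f x\<bar>)" by (rule integral_abs_bound)
  also have "\<dots> \<le> (LINT x|lborel. eta * (indicat_real ?S x + indicat_real ?T x))"
    by (rule integral_mono) (use int fin f in auto)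
  also have "\<dots> = eta * (measure lborel ?S + measure lborel ?T)"
    using fin by (subst integral_mult_right_zero, subst Bochner_Integration.integral_add) auto
  also have "\<dots> \<le> eta * (h * ?A + h * ?A)"
    by (intro mult_left_mono add_mono measure_slab_le ab h eta)
  finally show ?thesis by (simp add: algebra_simps)
qed

text \<open>
  The flux of \<open>F\<close> through the faces of the shrunken box is seen as the limit of integrals of \<open>F\<close> over
  thin slabs, since a difference quotient integrates to a difference of such integrals.
\<close>
lemma shrunk_flux_bound:
  fixes a b :: "real^'n" and F d :: "real^'n \<Rightarrow> real"
  assumes ab: "\<And>i. a $ i < b $ i" and e: "0 < e" "\<And>i. 2 * e < b $ i - a $ i"
    and F: "continuous_on (cbox a b) F" and eta: "eta \<ge> 0"
      "\<And>x. x \<in> cbox a b \<Longrightarrow> x $ i \<le> a $ i + 2 * e \<or> b $ i - 2 * e \<le> x $ i \<Longrightarrow> \<bar>F x\<bar> \<le> eta"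
    and d: "\<And>x. x \<in> box a b \<Longrightarrow> ((\<lambda>t. F (upd x i t)) has_real_derivative d x) (at (x $ i))"
      "continuous_on (box a b) d"
  shows "\<bar>LINT x|lborel. indicat_real (shrunk a b e) x * d x\<bar> \<le> 2 * eta * (\<Prod>j\<in>UNIV - {i}. b $ j - a $ j)"
proof -
  let ?C = "cbox (shrink_lo a (e / 2)) (shrink_hi b (e / 2))" and ?B = "shrunk a b e"
  let ?A = "\<Prod>j\<in>UNIV - {i}. b $ j - a $ j"
  \<comment> \<open>Steps of at most \<open>e / 2\<close> keep shifted points in the box shrunk by
    \<open>e / 2\<close>, a compact set on which \<open>d\<close> is bounded.\<close>
  define h where "h n = e / 2 * inverse (real (Suc n))" for n
  have h: "0 < h n" "h n \<le> e / 2" for n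
  proof -
    show "0 < h n" using e by (simp add: h_def)
    have "inverse (real (Suc n)) \<le> 1" by (simp add: field_simps)
    hence "h n \<le> e / 2 * 1" unfolding h_def using e by (intro mult_left_mono) auto
    thus "h n \<le> e / 2" by simp
  qed
  have hl: "h \<longlonglongrightarrow> 0"
    unfolding h_def using tendsto_mult_left[OF LIMSEQ_inverse_real_of_nat, of "e / 2"] by simp
  define f where "f x = indicat_real (cbox a b) x * F x" for x
  have bf: "bounded_borel f" unfolding f_def[abs_def] by (rule bounded_borel_on_cbox[OF F])
  hence [measurable]: "f \<in> borel_measurable borel" by (rule bounded_borel_measurable)
  have C: "?C \<subseteq> box a b" by (rule cbox_shrink_subset) (use e in simp)
  have BC: "?B \<subseteq> ?C"
  proof
    fix x assume x: "x \<in> ?B"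
    hence "a $ j + e < x $ j" "x $ j < b $ j - e" for j by (simp_all add: mem_shrunk)
    hence "a $ j + e / 2 \<le> x $ j \<and> x $ j \<le> b $ j - e / 2" for j using e(1) by (smt (verit) field_sum_of_halves)
    thus "x \<in> ?C" by (simp add: mem_cbox_shrink)
  qed
  have dC: "continuous_on ?C d" using d(2) C continuous_on_subset by blast
  have "bounded (d ` ?C)" by (intro compact_imp_bounded compact_continuous_image dC compact_cbox)
  then obtain K where K: "K > 0" "\<And>x. x \<in> ?C \<Longrightarrow> \<bar>d x\<bar> \<le> K" unfolding bounded_pos by auto
  define q where "q n x = indicat_real ?B x * ((f (upd x i (1 * x $ i + h n)) - f x) / h n)" for n x
  have near: "upd x i t \<in> ?C" if x: "x \<in> ?B" and t: "x $ i \<le> t" "t \<le> x $ i + e / 2" for x t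
  proof -
    have x: "a $ j + e < x $ j" "x $ j < b $ j - e" for j using x by (simp_all add: mem_shrunk)
    have "a $ j + e / 2 \<le> upd x i t $ j \<and> upd x i t $ j \<le> b $ j - e / 2" for j
      using x(1)[of j] x(2)[of j] t e(1) by (cases "j = i") (simp_all add: upd_nth)
    thus ?thesis by (simp add: mem_cbox_shrink)
  qed
  have fF: "f x = F x" if "x \<in> box a b" for x
    using that box_subset_cbox[of a b] by (auto simp: f_def)
  have dir: "((\<lambda>t. F (upd x i t)) has_real_derivative d (upd x i t)) (at t)" if "upd x i t \<in> box a b" for x t
    using d(1)[OF that] by simp
  have lim: "(\<lambda>n. integral\<^sup>L lborel (q n)) \<longlonglongrightarrow> (LINT x|lborel. indicat_real ?B x * d x)"
  proof (rule integral_dominated_convergence)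
    have "(\<lambda>x. indicat_real ?C x * d x) \<in> borel_measurable borel"
      using bounded_borel_on_cbox[OF dC] by (rule bounded_borel_measurable)
    hence "(\<lambda>x. indicat_real ?B x * (indicat_real ?C x * d x)) \<in> borel_measurable borel" by measurable
    also have "(\<lambda>x. indicat_real ?B x * (indicat_real ?C x * d x)) = (\<lambda>x. indicat_real ?B x * d x)"
    proof (rule ext)
      fix x show "indicat_real ?B x * (indicat_real ?C x * d x) = indicat_real ?B x * d x"
        using BC by (cases "x \<in> ?B") auto
    qed
    finally show "(\<lambda>x. indicat_real ?B x * d x) \<in> borel_measurable lborel" by simp
    show "q n \<in> borel_measurable lborel" for n unfolding q_def by measurable
    show "integrable lborel (\<lambda>x. indicat_real ?B x * K)"
      by (rule integrable_bounded_borel_box[OF bounded_borel_const])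
    show "AE x in lborel. (\<lambda>n. q n x) \<longlonglongrightarrow> indicat_real ?B x * d x"
    proof (rule AE_I2)
      fix x
      show "(\<lambda>n. q n x) \<longlonglongrightarrow> indicat_real ?B x * d x"
      proof (cases "x \<in> ?B")
        case True
        have xb: "x \<in> box a b" using True BC C by blast
        have "((\<lambda>t. (F (upd x i (x $ i + t)) - F (upd x i (x $ i))) / t) \<longlongrightarrow> d x) (at 0)"
          using d(1)[OF xb] unfolding DERIV_def .
        moreover have "filterlim h (at 0) sequentially"
          using hl h(1) by (auto intro!: filterlim_atI always_eventually less_imp_neq[THEN not_sym])
        ultimately have L: "(\<lambda>n. (F (upd x i (x $ i + h n)) - F (upd x i (x $ i))) / h n) \<longlonglongrightarrow> d x"
          by (rule filterlim_compose)
        have "q n x = (F (upd x i (x $ i + h n)) - F (upd x i (x $ i))) / h n" for n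
        proof -
          have "upd x i (x $ i + h n) \<in> box a b" using near[OF True, of "x $ i + h n"] h[of n] C by auto
          thus ?thesis unfolding q_def using True by (simp add: fF xb)
        qed
        thus ?thesis using L True by simp
      qed (simp add: q_def)
    qed
    show "AE x in lborel. norm (q n x) \<le> indicat_real ?B x * K" for n
    proof (rule AE_I2)
      fix x
      show "norm (q n x) \<le> indicat_real ?B x * K"
      proof (cases "x \<in> ?B")
        case True
        have xb: "x \<in> box a b" using True BC C by blast
        have lt: "x $ i < x $ i + h n" using h(1) by simp
        have inb: "upd x i t \<in> ?C" if "x $ i \<le> t" "t \<le> x $ i + h n" for t
          using near[OF True, of t] that h(2)[of n] by linarith
        \<comment> \<open>The mean value theorem bounds the difference quotient by a value of
          \<open>d\<close> on the compact box.\<close>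
        have "\<exists>z. x $ i < z \<and> z < x $ i + h n \<and>
           F (upd x i (x $ i + h n)) - F (upd x i (x $ i)) = (x $ i + h n - x $ i) * d (upd x i z)"
          by (rule MVT2[OF lt]) (use dir inb C in blast)
        then obtain z where z: "x $ i < z" "z < x $ i + h n"
          "F (upd x i (x $ i + h n)) - F x = h n * d (upd x i z)" by auto
        have "upd x i (x $ i + h n) \<in> box a b" using inb[of "x $ i + h n"] h(1)[of n] C by auto
        hence "q n x = d (upd x i z)"
          unfolding q_def using True h(1)[of n] z(3) by (simp add: fF xb)
        thus ?thesis using K(2)[OF inb[of z]] z True by simp
      qed (simp add: q_def)
    qed
  qed
  have bound: "\<bar>integral\<^sup>L lborel (q n)\<bar> \<le> 2 * eta * ?A" for n
  proof -
    let ?hn = "h n"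
    let ?g = "\<lambda>x. indicat_real ?B (upd x i (1 * x $ i + (- ?hn))) * f x"
    have hn: "0 < ?hn" "?hn \<le> e / 2" by (rule h)+
    have int1: "integrable lborel (\<lambda>x. indicat_real ?B x * f x)"
      by (rule integrable_bounded_borel_box[OF bf])
    have b1: "bounded_borel (\<lambda>x. f (upd x i (1 * x $ i + ?hn)))"
      by (rule bounded_borel_comp[OF bf]) measurable
    have int2: "integrable lborel (\<lambda>x. indicat_real ?B x * f (upd x i (1 * x $ i + ?hn)))"
      by (rule integrable_bounded_borel_box[OF b1])
    have sub: "{x. upd x i (1 * x $ i + (- ?hn)) \<in> ?B} \<subseteq> box a b"
    proof
      fix x assume "x \<in> {x. upd x i (1 * x $ i + (- ?hn)) \<in> ?B}"
      hence *: "a $ j + e < upd x i (1 * x $ i + (- ?hn)) $ j \<and> upd x i (1 * x $ i + (- ?hn)) $ j < b $ j - e" for j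
        by (simp add: mem_shrunk)
      have "a $ j < x $ j \<and> x $ j < b $ j" for j
        using *[of j] hn e(1) by (cases "j = i") (simp_all add: upd_nth)
      thus "x \<in> box a b" by (simp add: mem_box_cart)
    qed
    have meas: "{x. upd x i (1 * x $ i + (- ?hn)) \<in> ?B} \<in> sets borel" by measurable
    have gi: "?g = (\<lambda>x. indicat_real {x. upd x i (1 * x $ i + (- ?hn)) \<in> ?B} x * f x)"
      by (auto simp: indicator_def)
    have int3: "integrable lborel ?g"
      unfolding gi by (rule integrable_indicator_bounded_borel[OF bf meas sub])
    \<comment> \<open>Translation moves the shift from \<open>f\<close> to the indicator, and a box
      differs from its translate only inside two slabs of thickness \<open>h n\<close>.\<close>
    have "(LINT x|lborel. indicat_real ?B x * f (upd x i (1 * x $ i + ?hn))) = integral\<^sup>L lborel ?g"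
      using lborel_integral_upd[of 1 ?g i ?hn] by simp
    hence "integral\<^sup>L lborel (q n) = (LINT x|lborel. ?g x - indicat_real ?B x * f x) / ?hn"
      unfolding q_def using int1 int2 int3
      by (simp add: right_diff_distrib Bochner_Integration.integral_diff diff_divide_distrib)
    moreover have "\<bar>LINT x|lborel. ?g x - indicat_real ?B x * f x\<bar> \<le> 2 * eta * ?hn * ?A"
    proof (rule abs_integral_le_slabs[OF ab _ eta(1), where s = "a $ i + e" and t = "b $ i - e"])
      show "integrable lborel (\<lambda>x. ?g x - indicat_real ?B x * f x)" using int1 int3 by auto
      fix x
      let ?S = "cbox (upd a i (a $ i + e)) (upd b i (a $ i + e + ?hn))"
      let ?T = "cbox (upd a i (b $ i - e)) (upd b i (b $ i - e + ?hn))"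
      let ?y = "upd x i (1 * x $ i + (- ?hn))"
      show "\<bar>?g x - indicat_real ?B x * f x\<bar> \<le> eta * (indicat_real ?S x + indicat_real ?T x)"
      proof (cases "(?y \<in> ?B) = (x \<in> ?B)")
        case True
        thus ?thesis using eta(1) by (auto simp: indicator_def)
      next
        case False
        have or: "x \<in> ?B \<or> ?y \<in> ?B" using False by blast
        have others: "a $ j + e < x $ j \<and> x $ j < b $ j - e" if "j \<noteq> i" for j
          using or
        proof
          assume "?y \<in> ?B"
          hence "\<forall>j. a $ j + e < ?y $ j \<and> ?y $ j < b $ j - e" by (rule mem_shrunk[THEN iffD1])
          from spec[OF this, of j] show ?thesis using that by (simp add: upd_nth)
        qed (simp add: mem_shrunk)
        have iB: "x \<in> ?B \<longleftrightarrow> a $ i + e < x $ i \<and> x $ i < b $ i - e"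
          unfolding mem_shrunk by (rule all_iff_at) (rule others)
        have iY: "?y \<in> ?B \<longleftrightarrow> a $ i + e < x $ i - ?hn \<and> x $ i - ?hn < b $ i - e"
        proof -
          have "?y \<in> ?B \<longleftrightarrow> a $ i + e < ?y $ i \<and> ?y $ i < b $ i - e"
            unfolding mem_shrunk by (rule all_iff_at) (use others in \<open>simp add: upd_nth\<close>)
          thus ?thesis by simp
        qed
        have cases: "(a $ i + e \<le> x $ i \<and> x $ i \<le> a $ i + e + ?hn) \<or> (b $ i - e \<le> x $ i \<and> x $ i \<le> b $ i - e + ?hn)"
          using False iB iY hn e(2)[of i] by linarith
        have o2: "a $ j \<le> x $ j \<and> x $ j \<le> b $ j" if "j \<noteq> i" for j using others[OF that] e(1) by linarith
        have i2: "a $ i \<le> x $ i \<and> x $ i \<le> b $ i" using cases hn e(1) e(2)[of i] by linarith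
        have xc: "x \<in> cbox a b" unfolding mem_box_cart by (subst all_iff_at[of i, OF o2]) (use i2 in auto)
        have "\<bar>f x\<bar> \<le> eta" unfolding f_def using eta(2)[OF xc] xc cases hn e(1) by auto
        moreover have "x \<in> ?S \<or> x \<in> ?T"
        proof -
          have "x \<in> cbox (upd a i u) (upd b i v) \<longleftrightarrow> u \<le> x $ i \<and> x $ i \<le> v" for u v
          proof -
            have "x \<in> cbox (upd a i u) (upd b i v) \<longleftrightarrow> upd a i u $ i \<le> x $ i \<and> x $ i \<le> upd b i v $ i"
              unfolding mem_box_cart by (rule all_iff_at) (use o2 in \<open>simp add: upd_nth\<close>)
            thus ?thesis by simp
          qed
          thus ?thesis using cases by simp
        qed
        moreover have "\<bar>?g x - indicat_real ?B x * f x\<bar> = \<bar>f x\<bar>" using False by (auto simp: indicator_def)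
        ultimately show ?thesis using eta(1) by (auto simp: indicator_def)
      qed
    qed (use hn in simp)
    hence "\<bar>LINT x|lborel. ?g x - indicat_real ?B x * f x\<bar> / ?hn \<le> 2 * eta * ?hn * ?A / ?hn"
      using hn by (intro divide_right_mono) auto
    ultimately have "\<bar>integral\<^sup>L lborel (q n)\<bar> \<le> 2 * eta * ?hn * ?A / ?hn"
      using hn(1) by (simp only: abs_divide abs_of_pos)
    thus ?thesis using hn by simp
  qed
  have "(\<lambda>n. \<bar>integral\<^sup>L lborel (q n)\<bar>) \<longlonglongrightarrow> \<bar>LINT x|lborel. indicat_real ?B x * d x\<bar>"
    by (rule tendsto_rabs[OF lim])
  thus ?thesis by (rule LIMSEQ_le_const2) (use bound in blast)
qed

text \<open>\<open>F\<close> is uniformly continuous and 0 on the two faces, so it is below any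
  given \<open>eta\<close> in a thin layer along them; the choice of \<open>eta\<close> compensates
  the area of the face.\<close>

lemma shrunk_flux_vanishes:
  fixes a b :: "real^'n" and F d :: "real^'n \<Rightarrow> real" and e :: "nat \<Rightarrow> real"
  assumes ab: "\<And>i. a $ i < b $ i" and e: "\<And>n. 0 < e n" "\<And>n i. 2 * e n < b $ i - a $ i" "e \<longlonglongrightarrow> 0"
    and F: "continuous_on (cbox a b) F"
      "\<And>x. x \<in> cbox a b \<Longrightarrow> x $ i = a $ i \<or> x $ i = b $ i \<Longrightarrow> F x = 0"
    and d: "\<And>x. x \<in> box a b \<Longrightarrow> ((\<lambda>t. F (upd x i t)) has_real_derivative d x) (at (x $ i))"
      "continuous_on (box a b) d"
  shows "(\<lambda>n. LINT x|lborel. indicat_real (shrunk a b (e n)) x * d x) \<longlonglongrightarrow> 0"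
proof (rule LIMSEQ_I)
  fix r :: real assume r: "r > 0"
  let ?A = "\<Prod>j\<in>UNIV - {i}. b $ j - a $ j"
  have A: "?A \<ge> 0" by (rule prod_nonneg) (use ab in \<open>simp add: less_imp_le\<close>)
  define eta where "eta = r / (2 * ?A + 1)"
  have eta: "eta > 0" using r A by (simp add: eta_def)
  have etaA: "2 * eta * ?A < r"
  proof -
    have "2 * eta * ?A < eta * (2 * ?A + 1)" using eta by (simp add: algebra_simps)
    also have "\<dots> = r" using A by (simp add: eta_def)
    finally show ?thesis .
  qed
  have "uniformly_continuous_on (cbox a b) F"
    by (rule compact_uniformly_continuous[OF F(1) compact_cbox])
  then obtain dl where dl: "dl > 0" "\<And>x y. x \<in> cbox a b \<Longrightarrow> y \<in> cbox a b \<Longrightarrow> dist y x < dl \<Longrightarrow> dist (F y) (F x) < eta"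
    unfolding uniformly_continuous_on_def using eta by blast
  have "eventually (\<lambda>n. e n < dl / 2) sequentially" by (rule order_tendstoD(2)[OF e(3)]) (use dl in simp)
  then obtain N where N: "\<And>n. n \<ge> N \<Longrightarrow> e n < dl / 2" unfolding eventually_sequentially by blast
  have "norm ((LINT x|lborel. indicat_real (shrunk a b (e n)) x * d x) - 0) < r" if n: "n \<ge> N" for n
  proof -
    have "\<bar>LINT x|lborel. indicat_real (shrunk a b (e n)) x * d x\<bar> \<le> 2 * eta * ?A"
    proof (rule shrunk_flux_bound[OF ab e(1) e(2) F(1) _ _ d])
      fix x assume x: "x \<in> cbox a b" "x $ i \<le> a $ i + 2 * e n \<or> b $ i - 2 * e n \<le> x $ i"
      have xb: "a $ j \<le> x $ j" "x $ j \<le> b $ j" for j using x(1) by (auto simp: mem_box_cart)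
      obtain t where t: "t = a $ i \<or> t = b $ i" "\<bar>t - x $ i\<bar> < dl"
        using x(2)
      proof
        assume "x $ i \<le> a $ i + 2 * e n"
        hence "\<bar>a $ i - x $ i\<bar> < dl" using N[OF n] xb(1)[of i] by linarith
        thus thesis by (intro that[of "a $ i"]) auto
      next
        assume "b $ i - 2 * e n \<le> x $ i"
        hence "\<bar>b $ i - x $ i\<bar> < dl" using N[OF n] xb(2)[of i] by linarith
        thus thesis by (intro that[of "b $ i"]) auto
      qed
      have y: "upd x i t \<in> cbox a b"
        unfolding mem_box_cart upd_nth using xb t(1) ab[of i] by (auto simp: less_imp_le)
      have "dist (upd x i t) x < dl" using t(2) by (simp add: dist_norm norm_upd_diff)
      from dl(2)[OF x(1) y this] have "dist (F (upd x i t)) (F x) < eta" .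
      moreover have "F (upd x i t) = 0" by (rule F(2)[OF y]) (use t(1) in simp)
      ultimately show "\<bar>F x\<bar> \<le> eta" by (simp add: dist_norm)
    qed (use eta in auto)
    thus ?thesis using etaA by simp
  qed
  thus "\<exists>N. \<forall>n\<ge>N. norm ((LINT x|lborel. indicat_real (shrunk a b (e n)) x * d x) - 0) < r" by blast
qed

lemma has_derivative_upd:
  fixes f :: "real^'n \<Rightarrow> real"
  assumes "(f has_derivative f') (at x)"
  shows "((\<lambda>t. f (upd x i t)) has_real_derivative f' (axis i 1)) (at (x $ i))"
proof -
  have "((\<lambda>t. x + (t - x $ i) *\<^sub>R axis i 1) has_derivative (\<lambda>t. t *\<^sub>R axis i 1)) (at (x $ i))"
    by (auto intro!: derivative_eq_intros)
  moreover have "(\<lambda>t. x + (t - x $ i) *\<^sub>R axis i 1) = upd x i" by (auto simp: vec_eq_iff upd_nth axis_def)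
  ultimately have "(upd x i has_derivative (\<lambda>t. t *\<^sub>R axis i 1)) (at (x $ i))" by simp
  moreover have "(f has_derivative f') (at (upd x i (x $ i)))" using assms by simp
  ultimately have "((\<lambda>t. f (upd x i t)) has_derivative (\<lambda>t. f' (t *\<^sub>R axis i 1))) (at (x $ i))"
    by (rule has_derivative_compose)
  moreover have "f' (t *\<^sub>R axis i 1) = t * f' (axis i 1)" for t
    using linear_scale[OF has_derivative_linear[OF assms], of t "axis i 1"] by simp
  ultimately show ?thesis by (simp add: has_field_derivative_def mult_commute_abs)
qed

text \<open>The witnesses are \<open>x $ i - b $ i\<close> and its counterpart at \<open>a\<close>,
  on a neighbourhood that stays away from all other faces.\<close>

lemma outward_unit_normal_faces:
  fixes a b :: "real^'n"
  assumes ab: "\<And>i. a $ i < b $ i" and p: "\<And>j. j \<noteq> i \<Longrightarrow> a $ j < p $ j \<and> p $ j < b $ j"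
  shows "p $ i = b $ i \<Longrightarrow> outward_unit_normal (box a b) p (axis i 1)"
    "p $ i = a $ i \<Longrightarrow> outward_unit_normal (box a b) p (- axis i 1)"
proof -
  have ne: "box a b \<noteq> {}" using ab by (auto simp: interval_ne_empty_cart)
  have fr: "p \<in> frontier (box a b)" if "p $ i = a $ i \<or> p $ i = b $ i"
  proof -
    have "p \<in> cbox a b"
      unfolding mem_box_cart by (subst all_iff_at[where i = i]) (use that p ab[of i] in \<open>auto simp: less_imp_le\<close>)
    moreover have "p \<notin> box a b"
    proof
      assume "p \<in> box a b"
      hence "a $ i < p $ i \<and> p $ i < b $ i" by (simp only: mem_box_cart)
      thus False using that by auto
    qed
    ultimately show ?thesis using ne by (simp add: frontier_def interior_open[OF open_box])
  qed
  have op: "open (\<Inter>j\<in>UNIV - {i}. {x::real^'n. a $ j < x $ j} \<inter> {x. x $ j < b $ j})"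
    by (intro open_INT open_Int ballI open_halfspace_component_lt_cart open_halfspace_component_gt_cart finite_Diff) auto
  have sg: "sgn (axis i 1 :: real^'n) = axis i 1" "sgn (- axis i 1 :: real^'n) = - axis i 1"
    by (simp_all add: sgn_div_norm norm_axis_1)
  have nz: "(axis i 1 :: real^'n) \<noteq> 0" by (simp add: axis_eq_0_iff)
  have der: "((\<lambda>x::real^'n. x $ i - t) has_derivative (\<lambda>h. h \<bullet> axis i 1)) (at x)" for t x
    by (auto intro!: derivative_eq_intros simp: cart_eq_inner_axis)
  show "outward_unit_normal (box a b) p (axis i 1)" if pi: "p $ i = b $ i"
    unfolding outward_unit_normal_def
  proof (intro conjI exI)
    let ?U = "(\<Inter>j\<in>UNIV - {i}. {x::real^'n. a $ j < x $ j} \<inter> {x. x $ j < b $ j}) \<inter> {x. a $ i < x $ i}"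
    show "open ?U" by (intro open_Int op open_halfspace_component_gt_cart)
    show "p \<in> ?U" using p pi ab[of i] by auto
    show "\<forall>x\<in>?U. GDERIV (\<lambda>x. x $ i - b $ i) x :> axis i 1"
      unfolding gderiv_def using der by blast
    show "box a b \<inter> ?U = {x \<in> ?U. x $ i - b $ i < 0}"
    proof (rule set_eqI)
      fix x
      show "x \<in> box a b \<inter> ?U \<longleftrightarrow> x \<in> {x \<in> ?U. x $ i - b $ i < 0}"
      proof
        assume x: "x \<in> {x \<in> ?U. x $ i - b $ i < 0}"
        hence "x \<in> box a b" unfolding mem_box_cart by (subst all_iff_at[where i = i]) auto
        thus "x \<in> box a b \<inter> ?U" using x by blast
      qed (auto simp: mem_box_cart)
    qed
  qed (use fr pi nz sg in auto)
  show "outward_unit_normal (box a b) p (- axis i 1)" if pi: "p $ i = a $ i"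
    unfolding outward_unit_normal_def
  proof (intro conjI exI)
    let ?U = "(\<Inter>j\<in>UNIV - {i}. {x::real^'n. a $ j < x $ j} \<inter> {x. x $ j < b $ j}) \<inter> {x. x $ i < b $ i}"
    show "open ?U" by (intro open_Int op open_halfspace_component_lt_cart)
    show "p \<in> ?U" using p pi ab[of i] by auto
    show "\<forall>x\<in>?U. GDERIV (\<lambda>x. - (x $ i - a $ i)) x :> - axis i 1"
      unfolding gderiv_def using has_derivative_minus[OF der] by simp
    show "box a b \<inter> ?U = {x \<in> ?U. - (x $ i - a $ i) < 0}"
    proof (rule set_eqI)
      fix x
      show "x \<in> box a b \<inter> ?U \<longleftrightarrow> x \<in> {x \<in> ?U. - (x $ i - a $ i) < 0}"
      proof
        assume x: "x \<in> {x \<in> ?U. - (x $ i - a $ i) < 0}"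
        hence "x \<in> box a b" unfolding mem_box_cart by (subst all_iff_at[where i = i]) auto
        thus "x \<in> box a b \<inter> ?U" using x by blast
      qed (auto simp: mem_box_cart)
    qed
  qed (use fr pi nz sg in auto)
qed

text \<open>The Neumann condition holds on the relative interior of a facet; continuity extends it to the whole facet.\<close>
lemma normal_derivative_zero_on_face:
  fixes a b :: "real^'n" and G :: "real^'n \<Rightarrow> real^'n"
  assumes ab: "\<And>i. a $ i < b $ i" and G: "continuous_on (cbox a b) G"
    and N: "\<And>p nu. outward_unit_normal (box a b) p nu \<Longrightarrow> G p \<bullet> nu = 0"
    and p: "p \<in> cbox a b" "p $ i = a $ i \<or> p $ i = b $ i"
  shows "G p $ i = 0"
proof -
  have pb: "a $ j \<le> p $ j" "p $ j \<le> b $ j" for j using p(1) by (auto simp: mem_box_cart)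
  \<comment> \<open>The centre of the facet: points on the segment from \<open>p\<close> to it,
    other than \<open>p\<close>, lie in the relative interior.\<close>
  define c where "c = (\<chi> j. if j = i then p $ i else (a $ j + b $ j) / 2)"
  define q where "q n = p + inverse (real (Suc n)) *\<^sub>R (c - p)" for n
  have qi: "q n $ i = p $ i" for n by (simp add: q_def c_def)
  have qj: "a $ j < q n $ j \<and> q n $ j < b $ j" if "j \<noteq> i" for n j
  proof -
    define t where "t = inverse (real (Suc n))"
    have t: "0 < t" "t \<le> 1" by (simp_all add: t_def field_simps)
    define m where "m = (a $ j + b $ j) / 2"
    have m: "a $ j < m" "m < b $ j" using ab[of j] by (simp_all add: m_def)
    have "q n $ j = (p + t *\<^sub>R (c - p)) $ j" by (simp only: q_def t_def)
    hence "q n $ j = p $ j + t * (c $ j - p $ j)" by simp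
    moreover have "c $ j = m" using that by (simp add: c_def m_def)
    ultimately have eq: "q n $ j = (1 - t) * p $ j + t * m"
      by (simp add: algebra_simps)
    have "(1 - t) * a $ j + t * a $ j < (1 - t) * p $ j + t * m"
      using t pb[of j] m by (intro add_le_less_mono mult_left_mono mult_strict_left_mono) auto
    moreover have "(1 - t) * p $ j + t * m < (1 - t) * b $ j + t * b $ j"
      using t pb[of j] m by (intro add_le_less_mono mult_left_mono mult_strict_left_mono) auto
    ultimately show ?thesis unfolding eq by (simp add: algebra_simps)
  qed
  have qc: "q n \<in> cbox a b" for n
    unfolding mem_box_cart by (subst all_iff_at[where i = i]) (use qj pb qi in \<open>auto simp: less_imp_le\<close>)
  have "G (q n) $ i = 0" for n
    using p(2)
  proof
    assume "p $ i = b $ i"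
    hence "G (q n) \<bullet> axis i 1 = 0" by (intro N outward_unit_normal_faces(1)[OF ab qj]) (simp_all add: qi)
    thus ?thesis by (simp add: cart_eq_inner_axis)
  next
    assume "p $ i = a $ i"
    hence "G (q n) \<bullet> (- axis i 1) = 0" by (intro N outward_unit_normal_faces(2)[OF ab qj]) (simp_all add: qi)
    thus ?thesis by (simp add: cart_eq_inner_axis)
  qed
  moreover have "(\<lambda>n. G (q n) $ i) \<longlonglongrightarrow> G p $ i"
  proof -
    have "(\<lambda>n. p + inverse (real (Suc n)) *\<^sub>R (c - p)) \<longlonglongrightarrow> p + 0 *\<^sub>R (c - p)"
      by (intro tendsto_intros LIMSEQ_inverse_real_of_nat)
    hence "q \<longlonglongrightarrow> p" by (simp add: q_def[abs_def])
    hence "(\<lambda>n. G (q n)) \<longlonglongrightarrow> G p"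
      by (rule continuous_on_tendsto_compose[OF G _ p(1)]) (use qc in simp)
    thus ?thesis by (rule tendsto_vec_nth)
  qed
  ultimately have "(\<lambda>n::nat. 0::real) \<longlonglongrightarrow> G p $ i" by simp
  from LIMSEQ_unique[OF this tendsto_const] show ?thesis .
qed

text \<open>Green's formula for \<open>u\<close> and the mode: the \<open>F i\<close> are the
  components of a field whose divergence is \<open>energy a b m - mu\<close> times the product of
  both. Its normal component is 0 on every face, so the integral of the divergence over shrunken
  boxes tends to 0.\<close>

lemma neumann_solution_orthogonal:
  fixes a b :: "real^'n"
  assumes ab: "\<And>i. a $ i < b $ i" and sol: "neumann_solution (box a b) mu u"
    and m: "energy a b m \<noteq> mu"
  shows "ip a b u (mode a b m) = 0"
proof -
  have ne: "box a b \<noteq> {}" using ab by (auto simp: interval_ne_empty_cart)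
  have cl: "closure (box a b) = cbox a b" using ne by simp
  obtain G H where GH: "continuous_on (cbox a b) u" "continuous_on (cbox a b) G"
    "\<And>x. x \<in> box a b \<Longrightarrow> GDERIV u x :> G x" "\<And>x. x \<in> box a b \<Longrightarrow> (G has_derivative H x) (at x)"
    "\<And>v. continuous_on (box a b) (\<lambda>x. H x v)"
    "\<And>x. x \<in> box a b \<Longrightarrow> - (\<Sum>i\<in>Basis. H x i \<bullet> i) = mu * u x"
    "\<And>p nu. outward_unit_normal (box a b) p nu \<Longrightarrow> G p \<bullet> nu = 0"
    using sol unfolding neumann_solution_def cl by blast
  let ?w = "\<lambda>i. real (m i) * freq a b i"
  let ?e = "mode a b m"
  define F where "F i x = G x $ i * ?e x - u x * dmode a b m i x" for i x
  define d where "d i x = H x (axis i 1) $ i * ?e x + (?w i)\<^sup>2 * (u x * ?e x)" for i x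
  have sub: "box a b \<subseteq> cbox a b" by (rule box_subset_cbox)
  have uc: "continuous_on (box a b) u" using GH(1) sub continuous_on_subset by blast
  obtain h :: "nat \<Rightarrow> real" where h: "\<And>n. 0 < h n" "\<And>n i. h n < b $ i - a $ i" "h \<longlonglongrightarrow> 0"
    using vanishing_steps[OF ab] by blast
  define e where "e n = h n / 2" for n
  have e: "\<And>n. 0 < e n" "\<And>n i. 2 * e n < b $ i - a $ i" using h by (auto simp: e_def)
  have e0: "e \<longlonglongrightarrow> 0" unfolding e_def using tendsto_divide[OF h(3) tendsto_const, of 2] by simp
  have dc: "continuous_on (box a b) (d i)" for i
    unfolding d_def[abs_def]
    by (intro continuous_intros continuous_on_component GH(5) uc continuous_mode)
  have flux: "(\<lambda>n. LINT x|lborel. indicat_real (shrunk a b (e n)) x * d i x) \<longlonglongrightarrow> 0" for i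
  proof (rule shrunk_flux_vanishes[OF ab e e0, where F = "F i" and i = i])
    show "continuous_on (cbox a b) (F i)"
      unfolding F_def[abs_def] by (intro continuous_intros continuous_on_component GH(1,2) continuous_mode continuous_dmode)
    show "F i x = 0" if "x \<in> cbox a b" "x $ i = a $ i \<or> x $ i = b $ i" for x
      unfolding F_def using normal_derivative_zero_on_face[OF ab GH(2,7) that] dmode_face[OF ab that(2)] by simp
    show "((\<lambda>t. F i (upd x i t)) has_real_derivative d i x) (at (x $ i))" if x: "x \<in> box a b" for x
    proof -
      have 1: "((\<lambda>t. u (upd x i t)) has_real_derivative G x $ i) (at (x $ i))"
        using has_derivative_upd[OF GH(3)[OF x, unfolded gderiv_def], of i] by (simp add: inner_axis')
      have 2: "((\<lambda>t. G (upd x i t) $ i) has_real_derivative H x (axis i 1) $ i) (at (x $ i))"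
        by (rule has_derivative_upd[where f = "\<lambda>y. G y $ i" and f' = "\<lambda>v. H x v $ i"])
           (rule bounded_linear.has_derivative[OF bounded_linear_vec_nth GH(4)[OF x]])
      have ax: "(\<Sum>j\<in>UNIV. axis i 1 $ j * f j) = f i" for f :: "'n \<Rightarrow> real"
      proof -
        have "(\<Sum>j\<in>UNIV. axis i 1 $ j * f j) = (\<Sum>j\<in>UNIV. if j = i then f j else 0)"
          by (rule sum.cong) (auto simp: axis_def)
        thus ?thesis by simp
      qed
      have 3: "((\<lambda>t. ?e (upd x i t)) has_real_derivative dmode a b m i x) (at (x $ i))"
        using has_derivative_upd[OF mode_has_derivative[of a b m x], of i] unfolding ax .
      have 4: "((\<lambda>t. dmode a b m i (upd x i t)) has_real_derivative - (?w i)\<^sup>2 * ?e x) (at (x $ i))"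
        using has_derivative_upd[OF dmode_has_derivative[of a b m i x], of i] unfolding ax d2mode_same .
      have "((\<lambda>t. F i (upd x i t)) has_real_derivative
        (H x (axis i 1) $ i * ?e (upd x i (x $ i)) + dmode a b m i x * G (upd x i (x $ i)) $ i) -
        (G x $ i * dmode a b m i (upd x i (x $ i)) + (- (?w i)\<^sup>2 * ?e x) * u (upd x i (x $ i)))) (at (x $ i))"
        unfolding F_def by (intro DERIV_diff DERIV_mult 1 2 3 4)
      thus ?thesis unfolding d_def by (simp add: algebra_simps)
    qed
  qed (rule dc)
  have total: "(\<Sum>i\<in>UNIV. d i x) = (energy a b m - mu) * (u x * ?e x)" if x: "x \<in> box a b" for x
  proof -
    have "(\<Sum>i\<in>Basis. H x i \<bullet> i) = (\<Sum>i\<in>UNIV. H x (axis i 1) $ i)"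
      unfolding sum_Basis_vec by (simp add: cart_eq_inner_axis)
    hence "(\<Sum>i\<in>UNIV. H x (axis i 1) $ i) = - (mu * u x)" using GH(6)[OF x] by simp
    thus ?thesis
      unfolding d_def sum.distrib sum_distrib_right[symmetric] energy_def by (simp add: algebra_simps)
  qed
  have int: "integrable lborel (\<lambda>x. indicat_real (shrunk a b (e n)) x * d i x)" for i n
  proof -
    let ?C = "cbox (shrink_lo a (e n)) (shrink_hi b (e n))"
    have "?C \<subseteq> box a b" by (rule cbox_shrink_subset[OF e(1)])
    hence "continuous_on ?C (d i)" using dc continuous_on_subset by blast
    hence "bounded_borel (\<lambda>x. indicat_real ?C x * d i x)" by (rule bounded_borel_on_cbox)
    hence "integrable lborel (\<lambda>x. indicat_real (shrunk a b (e n)) x * (indicat_real ?C x * d i x))"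
      by (rule integrable_bounded_borel_box)
    also have "(\<lambda>x. indicat_real (shrunk a b (e n)) x * (indicat_real ?C x * d i x)) = (\<lambda>x. indicat_real (shrunk a b (e n)) x * d i x)"
    proof (rule ext)
      fix x show "indicat_real (shrunk a b (e n)) x * (indicat_real ?C x * d i x) = indicat_real (shrunk a b (e n)) x * d i x"
        using box_subset_cbox[of "shrink_lo a (e n)" "shrink_hi b (e n)"] by (cases "x \<in> shrunk a b (e n)") auto
    qed
    finally show ?thesis .
  qed
  define v where "v x = indicat_real (cbox a b) x * (u x * ?e x)" for x
  have bv: "bounded_borel v" unfolding v_def[abs_def]
    by (rule bounded_borel_on_cbox) (intro continuous_intros GH(1) continuous_mode)
  hence [measurable]: "v \<in> borel_measurable borel" by (rule bounded_borel_measurable)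
  obtain K where K: "K \<ge> 0" "\<And>x. \<bar>v x\<bar> \<le> K" using bounded_borelE[OF bv] by blast
  have "(\<Sum>i\<in>UNIV. LINT x|lborel. indicat_real (shrunk a b (e n)) x * d i x) =
     (energy a b m - mu) * (LINT x|lborel. indicat_real (shrunk a b (e n)) x * v x)" for n
  proof -
    have "(\<Sum>i\<in>UNIV. LINT x|lborel. indicat_real (shrunk a b (e n)) x * d i x) =
       (LINT x|lborel. (\<Sum>i\<in>UNIV. indicat_real (shrunk a b (e n)) x * d i x))"
      by (rule Bochner_Integration.integral_sum[symmetric]) (rule int)
    also have "\<dots> = (LINT x|lborel. (energy a b m - mu) * (indicat_real (shrunk a b (e n)) x * v x))"
    proof (rule Bochner_Integration.integral_cong[OF refl])
      fix x
      show "(\<Sum>i\<in>UNIV. indicat_real (shrunk a b (e n)) x * d i x) = (energy a b m - mu) * (indicat_real (shrunk a b (e n)) x * v x)"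
      proof (cases "x \<in> shrunk a b (e n)")
        case True
        hence "x \<in> box a b" using shrunk_subset[of "e n" a b] e(1)[of n] by auto
        thus ?thesis using True total[of x] sub by (auto simp: v_def)
      qed simp
    qed
    finally show ?thesis by simp
  qed
  moreover have "(\<lambda>n. \<Sum>i\<in>UNIV. LINT x|lborel. indicat_real (shrunk a b (e n)) x * d i x) \<longlonglongrightarrow> (\<Sum>i\<in>(UNIV::'n set). 0)"
    by (intro tendsto_sum flux)
  ultimately have lim0: "(\<lambda>n. (energy a b m - mu) * (LINT x|lborel. indicat_real (shrunk a b (e n)) x * v x)) \<longlonglongrightarrow> 0"
    by simp
  have "(\<lambda>n. LINT x|lborel. indicat_real (shrunk a b (e n)) x * v x) \<longlonglongrightarrow> (LINT x|lborel. indicat_real (box a b) x * v x)"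
  proof (rule integral_dominated_convergence)
    show "integrable lborel (\<lambda>x. indicat_real (box a b) x * K)"
      by (rule integrable_bounded_borel_box[OF bounded_borel_const])
    show "AE x in lborel. norm (indicat_real (shrunk a b (e n)) x * v x) \<le> indicat_real (box a b) x * K" for n
    proof (rule AE_I2)
      fix x show "norm (indicat_real (shrunk a b (e n)) x * v x) \<le> indicat_real (box a b) x * K"
        using K(2)[of x] K(1) shrunk_subset[of "e n" a b] e(1)[of n] by (cases "x \<in> shrunk a b (e n)") auto
    qed
    show "AE x in lborel. (\<lambda>n. indicat_real (shrunk a b (e n)) x * v x) \<longlonglongrightarrow> indicat_real (box a b) x * v x"
    proof (rule AE_I2)
      fix x
      show "(\<lambda>n. indicat_real (shrunk a b (e n)) x * v x) \<longlonglongrightarrow> indicat_real (box a b) x * v x"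
      proof (cases "x \<in> box a b")
        case True
        hence xi: "a $ j < x $ j" "x $ j < b $ j" for j by (auto simp: mem_box_cart)
        define r where "r = Min (range (\<lambda>j. min (x $ j - a $ j) (b $ j - x $ j)))"
        have r: "r > 0" unfolding r_def using xi by (subst Min_gr_iff) auto
        have r2: "r \<le> min (x $ j - a $ j) (b $ j - x $ j)" for j
          unfolding r_def by (rule Min_le) auto
        have "eventually (\<lambda>n. e n < r) sequentially" by (rule order_tendstoD(2)[OF e0 r])
        hence "eventually (\<lambda>n. indicat_real (shrunk a b (e n)) x * v x = indicat_real (box a b) x * v x) sequentially"
        proof eventually_elim
          case (elim n)
          have "a $ j + e n < x $ j \<and> x $ j < b $ j - e n" for j using elim r2[of j] by auto
          hence "x \<in> shrunk a b (e n)" by (simp add: mem_shrunk)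
          thus ?case using True by simp
        qed
        thus ?thesis by (rule tendsto_eventually)
      next
        case False
        hence "x \<notin> shrunk a b (e n)" for n using shrunk_subset[of "e n" a b] e(1)[of n] by auto
        thus ?thesis using False by simp
      qed
    qed
  qed measurable
  hence "(\<lambda>n. (energy a b m - mu) * (LINT x|lborel. indicat_real (shrunk a b (e n)) x * v x)) \<longlonglongrightarrow>
     (energy a b m - mu) * (LINT x|lborel. indicat_real (box a b) x * v x)"
    by (rule tendsto_mult_left)
  from LIMSEQ_unique[OF this lim0] have "(LINT x|lborel. indicat_real (box a b) x * v x) = 0"
    using m by simp
  moreover have "(LINT x|lborel. indicat_real (box a b) x * v x) = ip a b u ?e"
    unfolding ip_def
  proof (rule Bochner_Integration.integral_cong[OF refl])
    fix x show "indicat_real (box a b) x * v x = indicat_real (box a b) x * (u x * ?e x)"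
      using sub by (cases "x \<in> box a b") (auto simp: v_def)
  qed
  ultimately show ?thesis by simp
qed

text \<open>A solution is orthogonal to the modes of other energies. After its projection to the
  modes of energy \<open>mu\<close> is subtracted, completeness leaves nothing in the open box, and
  continuity reaches the closed one.\<close>

lemma neumann_eigenspace_box:
  fixes a b :: "real^'n"
  assumes ab: "\<And>i. a $ i < b $ i"
  shows "neumann_eigenspace (box a b) mu = range (\<lambda>c. zero_ext (cbox a b) (eigsum a b mu c))"
proof -
  have ne: "box a b \<noteq> {}" using ab by (auto simp: interval_ne_empty_cart)
  have cl: "closure (box a b) = cbox a b" using ne by simp
  show ?thesis
  proof (rule set_eqI, rule iffI)
    fix u assume "u \<in> range (\<lambda>c. zero_ext (cbox a b) (eigsum a b mu c))"
    then obtain c where "u = zero_ext (cbox a b) (eigsum a b mu c)" by blast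
    thus "u \<in> neumann_eigenspace (box a b) mu"
      unfolding neumann_eigenspace_def cl using eigsum_neumann_solution[OF ab, of mu c] by (simp add: zero_ext_def)
  next
    fix u assume "u \<in> neumann_eigenspace (box a b) mu"
    hence u: "neumann_solution (box a b) mu u" "\<And>x. x \<notin> cbox a b \<Longrightarrow> u x = 0"
      unfolding neumann_eigenspace_def cl by auto
    have uc: "continuous_on (cbox a b) u" using u(1) unfolding neumann_solution_def cl by blast
    have "u = (\<lambda>x. indicat_real (cbox a b) x * u x)"
    proof (rule ext)
      fix x show "u x = indicat_real (cbox a b) x * u x" using u(2)[of x] by (cases "x \<in> cbox a b") auto
    qed
    hence bu: "bounded_borel u" using bounded_borel_on_cbox[OF uc] by simp
    define F where "F = fcoeff a b u"
    have FN: "ip a b u (mode a b m) = F m * mode_norm a b m" for m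
      using mode_norm_pos[OF ab, of m] by (simp add: F_def fcoeff_def)
    have bs: "bounded_borel (eigsum a b mu F)" by (rule bounded_borel_eigsum)
    have zero: "u x - eigsum a b mu F x = 0" if x: "x \<in> box a b" for x
    proof (rule mode_completeness[OF ab _ _ _ _ x, of "\<lambda>x. u x - eigsum a b mu F x" "\<lambda>x. u x - eigsum a b mu F x"])
      show "bounded_borel (\<lambda>x. u x - eigsum a b mu F x)" by (intro bounded_borel_diff bu bs)
      show "continuous_on (cbox a b) (\<lambda>x. u x - eigsum a b mu F x)"
        by (intro continuous_intros uc continuous_eigsum)
      show "ip a b (\<lambda>x. u x - eigsum a b mu F x) (mode a b m) = 0" for m
      proof -
        have "ip a b (eigsum a b mu F) (mode a b m) = (if energy a b m = mu then F m * mode_norm a b m else 0)"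
          unfolding eigsum_def[abs_def] by (subst ip_mode_sum_mode[OF ab finite_energy_eq(1)[OF ab]]) simp
        thus ?thesis
          unfolding ip_diff_left[OF bounded_borel_mode bu bs]
          using neumann_solution_orthogonal[OF ab u(1), of m] FN[of m] by (cases "energy a b m = mu") simp_all
      qed
    qed simp
    have "u x = eigsum a b mu F x" if x: "x \<in> cbox a b" for x
    proof -
      have "x \<in> closure (box a b)" using x cl by simp
      then obtain s where s: "\<And>n. s n \<in> box a b" "s \<longlonglongrightarrow> x" unfolding closure_sequential by blast
      have "continuous_on (cbox a b) (\<lambda>x. u x - eigsum a b mu F x)"
        by (intro continuous_intros uc continuous_eigsum)
      hence "(\<lambda>n. u (s n) - eigsum a b mu F (s n)) \<longlonglongrightarrow> u x - eigsum a b mu F x"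
        using s box_subset_cbox[of a b] by (intro continuous_on_tendsto_compose[OF _ s(2) x]) (auto intro!: always_eventually)
      hence "(\<lambda>n::nat. 0::real) \<longlonglongrightarrow> u x - eigsum a b mu F x" using zero[OF s(1)] by simp
      from LIMSEQ_unique[OF tendsto_const this] show ?thesis by simp
    qed
    hence "u = zero_ext (cbox a b) (eigsum a b mu F)" using u(2) by (auto simp: zero_ext_def)
    thus "u \<in> range (\<lambda>c. zero_ext (cbox a b) (eigsum a b mu c))" by blast
  qed
qed

subsection \<open>Multiplicities and the counting number\<close>

lemma sum_fun_apply: "(\<Sum>i\<in>I. f i) x = (\<Sum>i\<in>I. f i x)" for f :: "'i \<Rightarrow> 'a \<Rightarrow> real"
  by (induction I rule: infinite_finite_induct) auto

lemma zero_ext_eigsum_sum: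
  "zero_ext S (eigsum a b mu c) = (\<Sum>m\<in>{m. energy a b m = mu}. (\<lambda>x. c m * zero_ext S (mode a b m) x))"
  by (rule ext) (simp add: sum_fun_apply zero_ext_def eigsum_def)

lemma eigsum_zero_imp:
  fixes a b :: "real^'n"
  assumes ab: "\<And>i. a $ i < b $ i" and z: "\<And>x. x \<in> box a b \<Longrightarrow> eigsum a b mu c x = 0" and m: "energy a b m = mu"
  shows "c m = 0"
proof -
  have "ip a b (eigsum a b mu c) (mode a b m) = c m * mode_norm a b m"
    unfolding eigsum_def[abs_def] using m by (subst ip_mode_sum_mode[OF ab finite_energy_eq(1)[OF ab]]) simp
  moreover have "ip a b (eigsum a b mu c) (mode a b m) = ip a b (\<lambda>x. 0) (mode a b m)"
    by (rule ip_cong) (simp_all add: z)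
  ultimately show ?thesis using mode_norm_pos[OF ab, of m] by simp
qed

lemma zero_ext_eigsum_eq_0_iff:
  fixes a b :: "real^'n"
  assumes ab: "\<And>i. a $ i < b $ i"
  shows "zero_ext (cbox a b) (eigsum a b mu c) = 0 \<longleftrightarrow> (\<forall>m. energy a b m = mu \<longrightarrow> c m = 0)"
proof
  assume z: "zero_ext (cbox a b) (eigsum a b mu c) = 0"
  have "eigsum a b mu c x = 0" if "x \<in> box a b" for x
    using fun_cong[OF z, of x] that box_subset_cbox[of a b] by (auto simp: zero_ext_def)
  thus "\<forall>m. energy a b m = mu \<longrightarrow> c m = 0" using eigsum_zero_imp[OF ab] by blast
next
  assume "\<forall>m. energy a b m = mu \<longrightarrow> c m = 0"
  hence "eigsum a b mu c x = 0" for x unfolding eigsum_def by (intro sum.neutral) simp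
  thus "zero_ext (cbox a b) (eigsum a b mu c) = 0" by (auto simp: zero_ext_def)
qed

lemma neumann_multiplicity_box:
  fixes a b :: "real^'n"
  assumes ab: "\<And>i. a $ i < b $ i"
  shows "neumann_multiplicity (box a b) mu = card {m. energy a b m = mu}"
proof -
  interpret vs: vector_space "\<lambda>(c::real) (f::real^'n \<Rightarrow> real) x. c * f x"
    by (rule vector_space_real_fun)
  let ?E = "{m. energy a b m = mu}"
  let ?e = "\<lambda>m. zero_ext (cbox a b) (mode a b m)"
  have fin: "finite ?E" by (rule finite_energy_eq[OF ab])
  have indep: "c k = 0" if "(\<Sum>m\<in>?E. (\<lambda>x. c m * ?e m x)) = 0" "k \<in> ?E" for c k
    using that zero_ext_eigsum_eq_0_iff[OF ab, of mu c] unfolding zero_ext_eigsum_sum by blast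
  have inj: "inj_on ?e ?E"
  proof (rule inj_onI, rule ccontr)
    fix k l assume kl: "k \<in> ?E" "l \<in> ?E" "?e k = ?e l" "k \<noteq> l"
    define c where "c m = (if m = k then 1 else if m = l then -1 else 0 :: real)" for m
    have "(\<Sum>m\<in>?E. (\<lambda>x. c m * ?e m x)) = 0"
    proof (rule ext)
      fix x
      have "(\<Sum>m\<in>?E. c m * ?e m x) = (\<Sum>m\<in>{k, l}. c m * ?e m x)"
        by (rule sum.mono_neutral_right) (use fin kl in \<open>auto simp: c_def\<close>)
      also have "\<dots> = 0" using kl(3,4) by (simp add: c_def)
      finally show "(\<Sum>m\<in>?E. (\<lambda>x. c m * ?e m x)) x = 0 x" by (simp add: sum_fun_apply)
    qed
    from indep[OF this kl(1)] show False by (simp add: c_def)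
  qed
  show ?thesis unfolding neumann_multiplicity_def
  proof (rule vs.dim_unique)
    show "?e ` ?E \<subseteq> neumann_eigenspace (box a b) mu"
    proof
      fix u assume "u \<in> ?e ` ?E"
      then obtain k where k: "k \<in> ?E" "u = ?e k" by blast
      have "eigsum a b mu (\<lambda>m. if m = k then 1 else 0) = mode a b k"
        unfolding eigsum_def using fin k(1) by (auto simp: if_distrib[of "\<lambda>t. t * _"] cong: if_cong)
      thus "u \<in> neumann_eigenspace (box a b) mu" unfolding neumann_eigenspace_box[OF ab] k(2) by (metis rangeI)
    qed
    show "neumann_eigenspace (box a b) mu \<subseteq> vs.span (?e ` ?E)"
    proof
      fix u assume "u \<in> neumann_eigenspace (box a b) mu"
      then obtain c where "u = zero_ext (cbox a b) (eigsum a b mu c)" unfolding neumann_eigenspace_box[OF ab] by blast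
      hence u: "u = (\<Sum>m\<in>?E. (\<lambda>x. c m * ?e m x))" by (simp only: zero_ext_eigsum_sum)
      show "u \<in> vs.span (?e ` ?E)" unfolding u
        by (intro vs.span_sum vs.span_scale vs.span_base imageI)
    qed
    show "vs.independent (?e ` ?E)"
    proof (rule vs.independent_if_scalars_zero)
      show "finite (?e ` ?E)" using fin by simp
      fix f v assume f: "(\<Sum>w\<in>?e ` ?E. (\<lambda>x. f w * w x)) = 0" and v: "v \<in> ?e ` ?E"
      obtain k where k: "k \<in> ?E" "v = ?e k" using v by blast
      have "(\<Sum>m\<in>?E. (\<lambda>x. f (?e m) * ?e m x)) = 0"
        using f unfolding sum.reindex[OF inj] o_def .
      from indep[OF this k(1)] show "f v = 0" unfolding k(2) .
    qed
    show "card (?e ` ?E) = card ?E" by (rule card_image[OF inj])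
  qed
qed

text \<open>Both sets are split by value. A listed number has positive multiplicity, so it is the
  energy of a mode, and the finite set \<open>V\<close> of energies below \<open>mu\<close> serves
  both.\<close>

lemma card_listed_below:
  fixes a b :: "real^'n"
  assumes ab: "\<And>i. a $ i < b $ i" and L: "lists_neumann_eigenvalues (box a b) lam"
  shows "finite {j. 1 \<le> j \<and> lam j < mu}" "card {j. 1 \<le> j \<and> lam j < mu} = card {m. energy a b m < mu}"
proof -
  have l: "finite {j. 1 \<le> j \<and> lam j = t}" "card {j. 1 \<le> j \<and> lam j = t} = card {m. energy a b m = t}" for t
    using L neumann_multiplicity_box[OF ab, of t] unfolding lists_neumann_eigenvalues_def by auto
  define V where "V = energy a b ` {m. energy a b m < mu}"
  have V: "finite V" unfolding V_def using finite_energy_eq(2)[OF ab] by blast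
  have occ: "lam j \<in> V" if "1 \<le> j" "lam j < mu" for j
  proof -
    have "{i. 1 \<le> i \<and> lam i = lam j} \<noteq> {}" using that(1) by blast
    hence "card {m. energy a b m = lam j} > 0" using l[of "lam j"] by (metis card_gt_0_iff)
    then obtain m where "energy a b m = lam j" by (metis (mono_tags, lifting) Collect_empty_eq card.empty less_irrefl)
    thus ?thesis using that(2) unfolding V_def by (intro image_eqI[of _ _ m]) simp_all
  qed
  have U1: "{j. 1 \<le> j \<and> lam j < mu} = (\<Union>t\<in>V. {j. 1 \<le> j \<and> lam j = t})"
  proof (rule set_eqI, rule iffI)
    fix j assume "j \<in> (\<Union>t\<in>V. {j. 1 \<le> j \<and> lam j = t})"
    thus "j \<in> {j. 1 \<le> j \<and> lam j < mu}" unfolding V_def by auto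
  qed (use occ in auto)
  have U2: "{m. energy a b m < mu} = (\<Union>t\<in>V. {m. energy a b m = t})"
    unfolding V_def by auto
  show "finite {j. 1 \<le> j \<and> lam j < mu}" unfolding U1 using V l(1) by (intro finite_UN_I)
  have "card {j. 1 \<le> j \<and> lam j < mu} = (\<Sum>t\<in>V. card {j. 1 \<le> j \<and> lam j = t})"
    unfolding U1 by (rule card_UN_disjoint) (use V l(1) in auto)
  also have "\<dots> = (\<Sum>t\<in>V. card {m. energy a b m = t})" by (simp only: l(2))
  also have "\<dots> = card {m. energy a b m < mu}"
    unfolding U2 by (rule card_UN_disjoint[symmetric]) (use V finite_energy_eq(1)[OF ab] in auto)
  finally show "card {j. 1 \<le> j \<and> lam j < mu} = card {m. energy a b m < mu}" .
qed

lemma courant_sharp_eigenvalue_iff: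
  fixes a b :: "real^'n"
  assumes ab: "\<And>i. a $ i < b $ i" and L: "lists_neumann_eigenvalues (box a b) lam"
  shows "courant_sharp_eigenvalue (box a b) lam mu \<longleftrightarrow> sharp a b mu"
proof -
  have nd: "nodal_domains (box a b) (zero_ext (cbox a b) u) = nodal_domains (box a b) u" for u
  proof -
    have "{x \<in> box a b. zero_ext (cbox a b) u x \<noteq> 0} = {x \<in> box a b. u x \<noteq> 0}"
      using box_subset_cbox[of a b] by (auto simp: zero_ext_def)
    thus ?thesis by (simp add: nodal_domains_alt)
  qed
  have "courant_sharp_eigenvalue (box a b) lam mu \<longleftrightarrow>
     (\<exists>c. courant_sharp_eigenfunction (box a b) lam mu (zero_ext (cbox a b) (eigsum a b mu c)))"
    unfolding courant_sharp_eigenvalue_def courant_sharp_eigenfunction_def neumann_eigenfunction_def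
      neumann_eigenspace_box[OF ab] by blast
  also have "\<dots> \<longleftrightarrow> sharp a b mu"
    unfolding sharp_def courant_sharp_eigenfunction_def neumann_eigenfunction_def neumann_eigenspace_box[OF ab]
      nd zero_ext_eigsum_eq_0_iff[OF ab] counting_number_def card_listed_below(2)[OF ab L] by blast
  finally show ?thesis .
qed

text \<open>In a monotone list the indices with value below \<open>mu\<close> form an initial
  segment, and the index after it is the first with value \<open>mu\<close>.\<close>

lemma listed_eigenvalue:
  fixes a b :: "real^'n"
  assumes ab: "\<And>i. a $ i < b $ i" and L: "lists_neumann_eigenvalues (box a b) lam"
    and m: "energy a b m = mu" and k: "card {k. energy a b k < mu} + 1 = k"
  shows "lam k = mu"
proof -
  let ?S = "{j. 1 \<le> j \<and> lam j < mu}"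
  have mono: "lam i \<le> lam j" if "1 \<le> i" "i \<le> j" for i j
    using L that unfolding lists_neumann_eigenvalues_def by (auto intro: mono_onD)
  have S: "finite ?S" "card ?S + 1 = k" using card_listed_below[OF ab L, of mu] k by auto
  have "k \<notin> ?S"
  proof
    assume kS: "k \<in> ?S"
    have "{1..k} \<subseteq> ?S"
    proof
      fix i assume i: "i \<in> {1..k}"
      hence "lam i \<le> lam k" by (intro mono) auto
      thus "i \<in> ?S" using i kS by auto
    qed
    hence "card {1..k} \<le> card ?S" using S(1) by (rule card_mono[rotated])
    thus False using S(2) by simp
  qed
  hence ge: "lam k \<ge> mu" using S(2) by auto
  have "card {j. 1 \<le> j \<and> lam j = mu} = card {m. energy a b m = mu}"
    using L neumann_multiplicity_box[OF ab, of mu] unfolding lists_neumann_eigenvalues_def by auto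
  moreover have "card {m. energy a b m = mu} > 0"
    using finite_energy_eq(1)[OF ab, of mu] m by (subst card_gt_0_iff) blast
  ultimately have "{j. 1 \<le> j \<and> lam j = mu} \<noteq> {}" by (metis card.empty less_irrefl)
  then obtain j where j: "1 \<le> j" "lam j = mu" by blast
  have "k \<le> j"
  proof (rule ccontr)
    assume "\<not> k \<le> j"
    have "?S \<subseteq> {1..<j}"
    proof
      fix i assume i: "i \<in> ?S"
      have "i < j"
      proof (rule ccontr)
        assume "\<not> i < j"
        hence "lam j \<le> lam i" by (intro mono j) simp
        thus False using i j by auto
      qed
      thus "i \<in> {1..<j}" using i by auto
    qed
    hence "card ?S \<le> card {1..<j}" by (intro card_mono) auto
    thus False using S(2) \<open>\<not> k \<le> j\<close> j(1) by simp
  qed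
  hence "lam k \<le> lam j" using S(2) by (intro mono) auto
  thus ?thesis using ge j by simp
qed

subsection \<open>Arithmetic of the spectrum\<close>

text \<open>The diagonal matrix of the odd numbers \<open>u\<close> minus \<open>2 * A\<close> is
  the identity modulo 2, so it has odd determinant. The proof replaces determinants by eliminating
  one variable at a time while the diagonal stays odd.\<close>

lemma odd_system_trivial:
  fixes v :: "'i \<Rightarrow> real" and u :: "'i \<Rightarrow> int" and A :: "'i \<Rightarrow> 'i \<Rightarrow> int"
  assumes "finite I" "\<And>i. i \<in> I \<Longrightarrow> odd (u i)"
    "\<And>i. i \<in> I \<Longrightarrow> of_int (u i) * v i = 2 * (\<Sum>j\<in>I. of_int (A i j) * v j)"
  shows "\<forall>i\<in>I. v i = 0"
  using assms
proof (induction I arbitrary: u A rule: finite_induct)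
  case (insert k I)
  define w where "w = u k - 2 * A k k"
  have w: "odd w" using insert.prems(1)[of k] by (simp add: w_def)
  have ek: "of_int w * v k = 2 * (\<Sum>j\<in>I. of_int (A k j) * v j)"
    using insert.prems(2)[of k] insert.hyps by (simp add: w_def algebra_simps)
  \<comment> \<open>Row \<open>i\<close> is multiplied by the odd number \<open>w\<close> and row
    \<open>k\<close> is inserted: the right-hand side keeps its factor 2.\<close>
  have IH: "\<forall>i\<in>I. v i = 0"
  proof (rule insert.IH[where u = "\<lambda>i. w * u i" and A = "\<lambda>i j. w * A i j + 2 * A i k * A k j"])
    show "odd (w * u i)" if "i \<in> I" for i using w insert.prems(1)[of i] that by simp
    fix i assume i: "i \<in> I"
    have "of_int (u i) * v i = 2 * (of_int (A i k) * v k + (\<Sum>j\<in>I. of_int (A i j) * v j))"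
      using insert.prems(2)[of i] insert.hyps i by simp
    hence "of_int (w * u i) * v i = of_int w * (2 * (of_int (A i k) * v k + (\<Sum>j\<in>I. of_int (A i j) * v j)))"
      by simp
    also have "\<dots> = 2 * (of_int (A i k) * (of_int w * v k) + of_int w * (\<Sum>j\<in>I. of_int (A i j) * v j))"
      by (simp add: algebra_simps)
    also have "\<dots> = 2 * (\<Sum>j\<in>I. of_int (w * A i j + 2 * A i k * A k j) * v j)"
      unfolding ek by (simp add: sum_distrib_left sum.distrib algebra_simps)
    finally show "of_int (w * u i) * v i = 2 * (\<Sum>j\<in>I. of_int (w * A i j + 2 * A i k * A k j) * v j)" .
  qed
  hence "of_int w * v k = 0" using ek by simp
  moreover have "w \<noteq> 0" using w by auto
  ultimately show ?case using IH by simp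
qed simp

text \<open>For \<open>r ^ n = 2\<close> this is the ring \<open>Z[r]\<close>; only the powers below
  \<open>n\<close> occur.\<close>

definition int_span :: "nat \<Rightarrow> real \<Rightarrow> real set" where
  "int_span n r = {x. \<exists>c :: nat \<Rightarrow> int. x = (\<Sum>i<n. of_int (c i) * r ^ i)}"

lemma int_span_add: "x \<in> int_span n r \<Longrightarrow> y \<in> int_span n r \<Longrightarrow> x + y \<in> int_span n r"
proof -
  assume "x \<in> int_span n r" "y \<in> int_span n r"
  then obtain c d :: "nat \<Rightarrow> int" where "x = (\<Sum>i<n. of_int (c i) * r ^ i)" "y = (\<Sum>i<n. of_int (d i) * r ^ i)"
    unfolding int_span_def by blast
  hence "x + y = (\<Sum>i<n. of_int (c i + d i) * r ^ i)" by (simp add: sum.distrib distrib_right)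
  thus ?thesis unfolding int_span_def by (intro CollectI exI[of _ "\<lambda>i. c i + d i"])
qed

lemma int_span_int_mult: "x \<in> int_span n r \<Longrightarrow> of_int k * x \<in> int_span n r"
proof -
  assume "x \<in> int_span n r"
  then obtain c :: "nat \<Rightarrow> int" where "x = (\<Sum>i<n. of_int (c i) * r ^ i)" unfolding int_span_def by blast
  hence "of_int k * x = (\<Sum>i<n. of_int (k * c i) * r ^ i)" by (simp add: sum_distrib_left mult.assoc)
  thus ?thesis unfolding int_span_def by (intro CollectI exI[of _ "\<lambda>i. k * c i"])
qed

lemma int_span_sum: "(\<And>i. i \<in> I \<Longrightarrow> f i \<in> int_span n r) \<Longrightarrow> (\<Sum>i\<in>I. f i) \<in> int_span n r"
proof (induction I rule: infinite_finite_induct)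
  case (insert i I) thus ?case by (auto intro: int_span_add)
qed (auto simp: int_span_def intro!: exI[of _ "\<lambda>_. 0"])

lemma int_span_basis: "i < n \<Longrightarrow> r ^ i \<in> int_span n r"
proof -
  assume i: "i < n"
  have "(\<Sum>j<n. of_int (if j = i then 1 else 0) * r ^ j) = (\<Sum>j<n. if j = i then r ^ j else 0)"
    by (rule sum.cong) auto
  also have "\<dots> = r ^ i" using i by simp
  finally show ?thesis unfolding int_span_def by (intro CollectI exI[of _ "\<lambda>j. if j = i then 1 else 0"]) simp
qed

lemma int_span_mult_root:
  assumes r: "r ^ n = 2" and n: "n \<ge> 1" and x: "x \<in> int_span n r"
  shows "r * x \<in> int_span n r"
proof -
  obtain c :: "nat \<Rightarrow> int" where "x = (\<Sum>i<n. of_int (c i) * r ^ i)" using x unfolding int_span_def by blast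
  hence "r * x = (\<Sum>i<n. of_int (c i) * r ^ Suc i)" by (simp add: sum_distrib_left mult_ac)
  also have "\<dots> \<in> int_span n r"
  proof (rule int_span_sum, rule int_span_int_mult)
    fix i assume "i \<in> {..<n}"
    show "r ^ Suc i \<in> int_span n r"
    proof (cases "Suc i < n")
      case False
      hence "Suc i = n" using \<open>i \<in> {..<n}\<close> by auto
      hence "r ^ Suc i = of_int 2 * r ^ 0" using r by simp
      moreover have "of_int 2 * r ^ 0 \<in> int_span n r" by (rule int_span_int_mult[OF int_span_basis]) (use n in simp)
      ultimately show ?thesis by (simp only:)
    qed (rule int_span_basis)
  qed
  finally show ?thesis .
qed

lemma int_span_mult:
  assumes r: "r ^ n = 2" and n: "n \<ge> 1" and x: "x \<in> int_span n r" and y: "y \<in> int_span n r"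
  shows "x * y \<in> int_span n r"
proof -
  have pow: "r ^ k * y \<in> int_span n r" for k
    by (induction k) (use y int_span_mult_root[OF r n] in \<open>auto simp: mult.assoc\<close>)
  obtain c :: "nat \<Rightarrow> int" where "x = (\<Sum>i<n. of_int (c i) * r ^ i)" using x unfolding int_span_def by blast
  hence "x * y = (\<Sum>i<n. of_int (c i) * (r ^ i * y))" by (simp add: sum_distrib_right mult.assoc)
  thus ?thesis using pow by (auto intro!: int_span_sum int_span_int_mult)
qed

lemma int_span_power:
  assumes r: "r ^ n = 2" and n: "n \<ge> 1"
  shows "r ^ k \<in> int_span n r" "x \<in> int_span n r \<Longrightarrow> x ^ k \<in> int_span n r"
proof -
  have one: "1 \<in> int_span n r" using int_span_basis[of 0 n r] n by simp
  show "r ^ k \<in> int_span n r"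
    by (induction k) (use one int_span_mult_root[OF r n] in auto)
  show "x \<in> int_span n r \<Longrightarrow> x ^ k \<in> int_span n r"
    by (induction k) (use one int_span_mult[OF r n] in auto)
qed

text \<open>If an odd integer were divisible by \<open>r\<close> in \<open>Z[r]\<close>, then multiplication by 2 would be onto \<open>Z[r]\<close> up to odd factors.\<close>
lemma even_of_root_multiple:
  assumes r: "r ^ n = 2" and n: "n \<ge> 1" and S: "S \<in> int_span n r" and c: "of_int c = r * S"
  shows "even c"
proof (rule ccontr)
  assume odd: "odd c"
  \<comment> \<open>The \<open>n\<close>-th power replaces the factor \<open>r\<close> by the
    integer 2. Expanding \<open>S ^ n * r ^ i\<close> gives an odd system solved by the powers of
    \<open>r\<close>, the first of which is 1.\<close>
  have "of_int (c ^ n) = 2 * S ^ n" using r by (simp add: c power_mult_distrib)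
  moreover have "S ^ n * r ^ i \<in> int_span n r" for i
    by (intro int_span_mult[OF r n] int_span_power[OF r n] S)
  then obtain A :: "nat \<Rightarrow> nat \<Rightarrow> int" where "\<And>i. S ^ n * r ^ i = (\<Sum>j<n. of_int (A i j) * r ^ j)"
    unfolding int_span_def mem_Collect_eq by metis
  ultimately have "of_int (c ^ n) * r ^ i = 2 * (\<Sum>j<n. of_int (A i j) * r ^ j)" for i
    by (simp add: mult.assoc)
  hence "\<forall>i\<in>{..<n}. r ^ i = 0"
    using odd by (intro odd_system_trivial[where u = "\<lambda>_. c ^ n" and A = A]) auto
  from bspec[OF this, of 0] n show False by simp
qed

section \<open>The eigenvalues as values of a quadratic form\<close>

definition qf :: "real \<Rightarrow> nat \<Rightarrow> (nat \<Rightarrow> nat) \<Rightarrow> real" where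
  "qf t n v = (\<Sum>j<n. (real (v j))\<^sup>2 * t ^ j)"

definition qf_tail :: "real \<Rightarrow> nat \<Rightarrow> (nat \<Rightarrow> nat) \<Rightarrow> real" where
  "qf_tail t n v = (\<Sum>j\<in>{1..<n}. (real (v j))\<^sup>2 * t ^ j)"

lemma qf_split: "n \<ge> 1 \<Longrightarrow> qf t n v = (real (v 0))\<^sup>2 + qf_tail t n v"
proof -
  assume "n \<ge> 1"
  hence "{..<n} = insert 0 {1..<n}" by auto
  thus ?thesis unfolding qf_def qf_tail_def by simp
qed

text \<open>All terms but the first are \<open>r\<close> times an element of \<open>Z[r]\<close>, so
  the difference of the two first squares is such a multiple as well.\<close>

lemma qf_parity:
  assumes r: "r ^ n = 2" and n: "n \<ge> 1" and eq: "qf (r\<^sup>2) n v = qf (r\<^sup>2) n w"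
  shows "even (v 0) \<longleftrightarrow> even (w 0)"
proof -
  define c where "c = int (w 0) ^ 2 - int (v 0) ^ 2"
  define d where "d j = int (v j) ^ 2 - int (w j) ^ 2" for j
  define S where "S = (\<Sum>j\<in>{1..<n}. of_int (d j) * r ^ (2 * j - 1))"
  have S: "S \<in> int_span n r" unfolding S_def by (intro int_span_sum int_span_int_mult int_span_power[OF r n])
  have "r * S = (\<Sum>j\<in>{1..<n}. of_int (d j) * (r\<^sup>2) ^ j)"
    unfolding S_def sum_distrib_left
  proof (rule sum.cong[OF refl])
    fix j assume "j \<in> {1..<n}"
    hence "2 * j = Suc (2 * j - 1)" by auto
    hence "(r\<^sup>2) ^ j = r * r ^ (2 * j - 1)" by (metis power_Suc power_mult)
    thus "r * (of_int (d j) * r ^ (2 * j - 1)) = of_int (d j) * (r\<^sup>2) ^ j" by simp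
  qed
  also have "\<dots> = qf_tail (r\<^sup>2) n v - qf_tail (r\<^sup>2) n w"
    unfolding qf_tail_def d_def by (simp add: sum_subtractf left_diff_distrib)
  also have "\<dots> = of_int c" using eq unfolding qf_split[OF n] c_def by simp
  finally have "even c" using even_of_root_multiple[OF r n S, of c] by simp
  thus ?thesis unfolding c_def by simp
qed

lemma qf_tail_first:
  assumes "n \<ge> 2" shows "qf_tail t n (\<lambda>j. if j = 0 then e else if j = 1 then k else 0) = (real k)\<^sup>2 * t"
proof -
  have "qf_tail t n (\<lambda>j. if j = 0 then e else if j = 1 then k else 0) = (\<Sum>j\<in>{1..<n}. if j = 1 then (real k)\<^sup>2 * t else 0)"
    unfolding qf_tail_def by (rule sum.cong) auto
  thus ?thesis using assms by simp
qed

lemma qf_tail_zero: "qf_tail t n (\<lambda>j. if j = 0 then e else 0) = 0"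
  unfolding qf_tail_def by (rule sum.neutral) auto

lemma qf_tail_two:
  assumes "n \<ge> 2" "2 \<le> p" "p < n"
  shows "qf_tail t n (\<lambda>j. if j = 0 then e else if j = 1 then k else if j = p then 1 else 0) = (real k)\<^sup>2 * t + t ^ p"
proof -
  have "qf_tail t n (\<lambda>j. if j = 0 then e else if j = 1 then k else if j = p then 1 else 0) =
     (\<Sum>j\<in>{1..<n}. (if j = 1 then (real k)\<^sup>2 * t else 0) + (if j = p then t ^ p else 0))"
    unfolding qf_tail_def by (rule sum.cong) (use assms in auto)
  thus ?thesis using assms by (simp add: sum.distrib)
qed

lemma qf_tail_upd0: "qf_tail t n (v(0 := e)) = qf_tail t n v"
  unfolding qf_tail_def by (rule sum.cong) auto

text \<open>An even vector that the injection lowering an odd first entry by one cannot reach, other than \<open>v\<close> lowered by one.\<close>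
definition escaping :: "real \<Rightarrow> nat \<Rightarrow> (nat \<Rightarrow> nat) \<Rightarrow> (nat \<Rightarrow> nat) \<Rightarrow> bool" where
  "escaping t n v z \<longleftrightarrow> even (z 0) \<and> qf t n z < qf t n v \<and> qf t n v \<le> qf t n (z(0 := Suc (z 0))) \<and>
     (\<exists>j<n. z j \<noteq> (v(0 := v 0 - 1)) j)"

lemma escapingI:
  assumes n: "n \<ge> 1" and "even e" "z 0 = e"
    and "(real e)\<^sup>2 + qf_tail t n z < qf t n v" "qf t n v \<le> (real e + 1)\<^sup>2 + qf_tail t n z"
    and ne: "(\<exists>j. 1 \<le> j \<and> j < n \<and> z j \<noteq> v j) \<or> v 0 \<noteq> Suc e"
    and odd: "odd (v 0)"
  shows "escaping t n v z"
proof -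
  have "\<exists>j<n. z j \<noteq> (v(0 := v 0 - 1)) j"
    using ne
  proof
    assume "\<exists>j. 1 \<le> j \<and> j < n \<and> z j \<noteq> v j"
    then obtain j where "1 \<le> j" "j < n" "z j \<noteq> v j" by blast
    thus ?thesis by (intro exI[of _ j]) simp
  next
    assume "v 0 \<noteq> Suc e"
    hence "z 0 \<noteq> v 0 - 1" using assms(3) odd by (cases "v 0") auto
    thus ?thesis using n by (intro exI[of _ 0]) simp
  qed
  thus ?thesis unfolding escaping_def using assms(2-5) by (simp add: qf_split[OF n] qf_tail_upd0 add.commute)
qed

text \<open>With first entry \<open>2 * a - 2\<close> escaping becomes a condition on the tail. The
  strict lower bound excludes the lowered \<open>v\<close>: for \<open>v 0 = 2 * a - 1\<close> its
  tail is exactly the lower end of the window.\<close>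

lemma tail_in_window_escapes:
  assumes n: "n \<ge> 1" and a: "a \<ge> 1" and odd: "odd (v 0)" and z0: "z 0 = 2 * a - 2"
    and w: "qf t n v - (2 * real a - 1)\<^sup>2 < qf_tail t n z" "qf_tail t n z < qf t n v - (2 * real a - 2)\<^sup>2"
  shows "escaping t n v z"
proof (rule escapingI[where e = "2 * a - 2" and v = v and z = z])
  have e: "real (2 * a - 2) = 2 * real a - 2" using a by simp
  show "(real (2 * a - 2))\<^sup>2 + qf_tail t n z < qf t n v" unfolding e using w(2) by simp
  have "real (2 * a - 2) + 1 = 2 * real a - 1" unfolding e by simp
  thus "qf t n v \<le> (real (2 * a - 2) + 1)\<^sup>2 + qf_tail t n z" using w(1) by simp
  show "(\<exists>j. 1 \<le> j \<and> j < n \<and> z j \<noteq> v j) \<or> v 0 \<noteq> Suc (2 * a - 2)"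
  proof (rule ccontr)
    assume "\<not> ?thesis"
    hence *: "\<And>j. 1 \<le> j \<Longrightarrow> j < n \<Longrightarrow> z j = v j" "v 0 = Suc (2 * a - 2)" by auto
    have "qf_tail t n z = qf_tail t n v" unfolding qf_tail_def by (rule sum.cong) (auto simp: *(1))
    moreover have "real (v 0) = 2 * real a - 1" using *(2) a by simp
    hence "qf t n v = (2 * real a - 1)\<^sup>2 + qf_tail t n v" using qf_split[OF n, of t v] by simp
    ultimately show False using w(1) by simp
  qed
qed (use a n z0 odd in auto)

lemma sqrt_bracket:
  assumes "x \<ge> (1::real)" shows "\<exists>c::nat. c \<ge> 1 \<and> (real c - 1)\<^sup>2 < x \<and> x \<le> (real c)\<^sup>2"
proof -
  define c where "c = (LEAST c::nat. x \<le> (real c)\<^sup>2)"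
  obtain k :: nat where "x \<le> real k" using real_arch_simple by blast
  moreover have "real k \<le> (real k)\<^sup>2" by (cases k) (auto simp: power2_eq_square)
  ultimately have ex: "x \<le> (real k)\<^sup>2" by linarith
  have c: "x \<le> (real c)\<^sup>2" unfolding c_def by (rule LeastI[of _ k]) (rule ex)
  have "c \<noteq> 0"
  proof
    assume "c = 0"
    hence "x \<le> 0" using c by simp
    thus False using assms by simp
  qed
  hence c1: "c \<ge> 1" by simp
  have "\<not> x \<le> (real (c - 1))\<^sup>2" using not_less_Least[of "c - 1" "\<lambda>c. x \<le> (real c)\<^sup>2"] c1 unfolding c_def[symmetric] by simp
  hence "(real c - 1)\<^sup>2 < x" using c1 by (simp add: of_nat_diff)
  thus ?thesis using c c1 by blast
qed

section \<open>Escaping vectors, by dimension and size of the eigenvalue\<close>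

lemma base_bounds:
  fixes t :: real
  assumes t: "t > 0" "t ^ n = 4" and n: "n \<ge> 2"
  shows "1 < t" "t \<le> 2" "n = 2 \<Longrightarrow> t = 2" "n \<ge> 3 \<Longrightarrow> t < 8 / 5"
proof -
  show t1: "1 < t"
  proof (rule ccontr)
    assume "\<not> 1 < t"
    hence "t ^ n \<le> 1" using t by (intro power_le_one) auto
    thus False using t by simp
  qed
  show t2: "t \<le> 2"
  proof (rule ccontr)
    assume "\<not> t \<le> 2"
    hence "2 ^ 2 < t ^ 2" by (intro power_strict_mono) auto
    also have "\<dots> \<le> t ^ n" using n t1 by (intro power_increasing) auto
    finally show False using t by simp
  qed
  show "t = 2" if "n = 2"
    using t that by (metis abs_numeral abs_of_pos power2_abs power2_eq_iff_nonneg four_x_squared less_eq_real_def mult_2 numeral_Bit0 one_add_one power2_eq_square real_sqrt_abs real_sqrt_four)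
  show "t < 8 / 5" if "n \<ge> 3"
  proof (rule ccontr)
    assume "\<not> t < 8 / 5"
    \<comment> \<open>The cube of 8/5 is 4.096, just above 4.\<close>
    hence "(8 / 5) ^ 3 \<le> t ^ 3" by (intro power_mono) auto
    also have "\<dots> \<le> t ^ n" using that t1 by (intro power_increasing) auto
    finally show False using t by (simp add: power3_eq_cube)
  qed
qed

text \<open>The tail has a single entry. After the last value \<open>t * k^2\<close> that is at most
  \<open>Y\<close> the next one falls into the window if the step \<open>t * (2 * k + 1)\<close> is
  below the window length \<open>4 * a - 3\<close>. As \<open>Y < 4 * a\<close>, the step is of
  order \<open>sqrt a\<close>; the estimate starts to hold at \<open>a = 4\<close>, where it reads
  120 < 121.\<close>

lemma escape_large:
  assumes n: "n \<ge> 2" and t: "1 < t" "t \<le> 2" and a: "a \<ge> 4" and odd: "odd (v 0)"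
    and X: "(2 * real a - 1)\<^sup>2 < qf t n v" "qf t n v \<le> (2 * real a)\<^sup>2"
  shows "\<exists>z. escaping t n v z"
proof -
  define Y where "Y = qf t n v - (2 * real a - 1)\<^sup>2"
  have Y: "0 < Y" "Y \<le> 4 * real a - 1" using X by (simp_all add: Y_def power2_eq_square algebra_simps)
  \<comment> \<open>An upper bound for the candidates, so that the greatest \<open>k\<close>
    exists.\<close>
  obtain c :: nat where c: "c \<ge> 1" "(real c - 1)\<^sup>2 < Y / t + 1" "Y / t + 1 \<le> (real c)\<^sup>2"
    using sqrt_bracket[of "Y / t + 1"] Y t by auto
  define k where "k = (GREATEST k::nat. t * (real k)\<^sup>2 \<le> Y)"
  have bd: "i \<le> c" if "t * (real i)\<^sup>2 \<le> Y" for i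
  proof -
    have "(real i)\<^sup>2 \<le> Y / t" using that t by (simp add: field_simps)
    hence "(real i)\<^sup>2 \<le> (real c)\<^sup>2" using c(3) by linarith
    thus ?thesis by (simp add: power2_le_iff_abs_le)
  qed
  have k1: "t * (real k)\<^sup>2 \<le> Y"
    unfolding k_def by (rule GreatestI_nat[of _ 0 c]) (use Y bd in auto)
  have k2: "Y < t * (real (Suc k))\<^sup>2"
  proof (rule ccontr)
    assume "\<not> Y < t * (real (Suc k))\<^sup>2"
    hence "Suc k \<le> k" unfolding k_def by (intro Greatest_le_nat[of _ _ c]) (use bd in \<open>auto simp: not_less\<close>)
    thus False by simp
  qed
  have "(2 * t * real k)\<^sup>2 = 4 * t * (t * (real k)\<^sup>2)" by (simp add: power2_eq_square)
  also have "\<dots> \<le> 8 * (4 * real a - 1)"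
  proof -
    have "4 * t * (t * (real k)\<^sup>2) \<le> 8 * (t * (real k)\<^sup>2)" using t by (intro mult_right_mono) auto
    also have "\<dots> \<le> 8 * (4 * real a - 1)" using order_trans[OF k1 Y(2)] by (intro mult_left_mono) auto
    finally show ?thesis .
  qed
  also have "\<dots> < (4 * real a - 5)\<^sup>2"
  proof -
    \<comment> \<open>In terms of \<open>s\<close> the difference has positive coefficients.\<close>
    define s where "s = real a - 4"
    have s: "s \<ge> 0" "real a = s + 4" using a by (simp_all add: s_def)
    have "(4 * real a - 5)\<^sup>2 - 8 * (4 * real a - 1) = 16 * s\<^sup>2 + 56 * s + 1"
      unfolding s(2) by (simp add: power2_eq_square algebra_simps)
    thus ?thesis using s(1) by (smt (verit) zero_le_power2 mult_nonneg_nonneg)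
  qed
  finally have "2 * t * real k < 4 * real a - 5"
    by (rule power2_less_imp_less) (use a in simp)
  hence step: "t * (2 * real k + 1) < 4 * real a - 3" using t by (simp add: algebra_simps)
  let ?z = "\<lambda>j. if j = 0 then 2 * a - 2 else if j = 1 then Suc k else (0::nat)"
  have tz: "qf_tail t n ?z = (real (Suc k))\<^sup>2 * t" by (rule qf_tail_first[OF n])
  have "escaping t n v ?z"
  proof (rule tail_in_window_escapes[where a = a])
    show "qf t n v - (2 * real a - 1)\<^sup>2 < qf_tail t n ?z"
      unfolding tz using k2 by (simp add: Y_def mult.commute)
    have "(real (Suc k))\<^sup>2 * t = t * (real k)\<^sup>2 + t * (2 * real k + 1)"
      by (simp add: power2_eq_square algebra_simps)
    also have "\<dots> < Y + (4 * real a - 3)" using k1 step by linarith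
    also have "\<dots> = qf t n v - (2 * real a - 2)\<^sup>2" by (simp add: Y_def power2_eq_square algebra_simps)
    finally show "qf_tail t n ?z < qf t n v - (2 * real a - 2)\<^sup>2" unfolding tz .
  qed (use n a odd in auto)
  thus ?thesis by blast
qed

text \<open>For \<open>a\<close> up to 3 one entry alone may step over the window, but the last
  entry adds \<open>T = t ^ (n - 1) = 4 / t\<close>, which lies between 5/2 and 4. The window has
  length 5 or 9, and \<open>Y\<close> is at most 7 or 11. The tails \<open>t\<close>,
  \<open>4 * t\<close>, \<open>4 * t + T\<close> suffice for \<open>a = 2\<close>, and
  \<open>t\<close>, \<open>4 * t\<close>, \<open>9 * t\<close>, \<open>9 * t + T\<close> for
  \<open>a = 3\<close>.\<close>

lemma escape_medium:
  assumes n: "n \<ge> 3" and t: "1 < t" "t < 8 / 5" "t ^ n = 4" and a: "a = 2 \<or> a = 3" and odd: "odd (v 0)"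
    and X: "(2 * real a - 1)\<^sup>2 < qf t n v" "qf t n v \<le> (2 * real a)\<^sup>2"
  shows "\<exists>z. escaping t n v z"
proof -
  define Y where "Y = qf t n v - (2 * real a - 1)\<^sup>2"
  have W: "qf t n v - (2 * real a - 2)\<^sup>2 = Y + (4 * real a - 3)" by (simp add: Y_def power2_eq_square algebra_simps)
  have Y: "0 < Y" "Y \<le> 4 * real a - 1" using X by (simp_all add: Y_def power2_eq_square algebra_simps)
  define T where "T = t ^ (n - 1)"
  have tT: "t * T = 4" using t(3) n unfolding T_def by (metis Suc_diff_1 gr0I not_numeral_le_zero power_Suc)
  have Tb: "T < 4" "4 * t + T > 7" "9 * t + T > 11"
  proof -
    have Tpos: "T > 0" using t by (simp add: T_def)
    have "1 * T < t * T" using t Tpos by (intro mult_strict_right_mono) auto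
    thus "T < 4" using tT by simp
    have "T > 5 / 2"
    proof (rule ccontr)
      assume "\<not> T > 5 / 2"
      hence "t * T \<le> t * (5 / 2)" using t by (intro mult_left_mono) auto
      thus False using tT t by simp
    qed
    have "(t - 1) * (T - 4) \<le> 0" using t \<open>T < 4\<close> by (intro mult_nonneg_nonpos) auto
    hence "4 * t + T \<ge> 8" using tT by (simp add: algebra_simps)
    thus "4 * t + T > 7" "9 * t + T > 11" using t by linarith+
  qed
  let ?z1 = "\<lambda>k j. if j = 0 then 2 * a - 2 else if j = 1 then k else (0::nat)"
  let ?z2 = "\<lambda>k j. if j = 0 then 2 * a - 2 else if j = 1 then k else if j = n - 1 then 1 else (0::nat)"
  have z1: "qf_tail t n (?z1 k) = (real k)\<^sup>2 * t" for k by (rule qf_tail_first) (use n in simp)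
  have z2: "qf_tail t n (?z2 k) = (real k)\<^sup>2 * t + T" for k unfolding T_def by (rule qf_tail_two) (use n in auto)
  have e1: "escaping t n v (?z1 k)" if "Y < (real k)\<^sup>2 * t" "(real k)\<^sup>2 * t < Y + (4 * real a - 3)" for k
    by (rule tail_in_window_escapes[where a = a]) (use that a n odd in \<open>auto simp: z1 W Y_def[symmetric]\<close>)
  have e2: "escaping t n v (?z2 k)" if "Y < (real k)\<^sup>2 * t + T" "(real k)\<^sup>2 * t + T < Y + (4 * real a - 3)" for k
    by (rule tail_in_window_escapes[where a = a]) (use that a n odd in \<open>auto simp: z2 W Y_def[symmetric]\<close>)
  consider "Y < t" | "t \<le> Y" "Y < 4 * t" | "4 * t \<le> Y" "Y < 9 * t" "a = 3" | "9 * t \<le> Y" "a = 3" | "4 * t \<le> Y" "a = 2"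
    using a by linarith
  thus ?thesis
  proof cases
    case 1
    thus ?thesis using e1[of 1] Y t a by auto
  next
    case 2
    thus ?thesis using e1[of 2] Y t a by auto
  next
    case 3
    thus ?thesis using e1[of 3] Y t by auto
  next
    case 4
    thus ?thesis using e2[of 3] Y t Tb by auto
  next
    case 5
    thus ?thesis using e2[of 2] Y t Tb by auto
  qed
qed

text \<open>Here \<open>v 0 = 1\<close>, the other entries are 0 or 1, and the window has length 1.
  Moving the last 1 up by one place raises the tail by \<open>t ^ p * (t - 1) < 1\<close>. If it
  already stands in the last place, the bound 3 on the tail forces \<open>n \<le> 4\<close>; then
  \<open>n = 3\<close> is the exception and \<open>n = 4\<close> has a vector of its own.\<close>

lemma escape_small:
  assumes n: "n \<ge> 3" and t: "1 < t" "t < 8 / 5" "t ^ n = 4" and odd: "odd (v 0)"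
    and X: "1 < qf t n v" "qf t n v \<le> 4"
    and ex: "\<not> (n = 3 \<and> v 0 = 1 \<and> v 1 = 0 \<and> v 2 = 1)"
  shows "\<exists>z. escaping t n v z"
proof -
  have n1: "n \<ge> 1" using n by simp
  have v0: "v 0 = 1"
  proof (rule ccontr)
    assume "v 0 \<noteq> 1"
    hence "v 0 \<ge> 3" using odd by (cases "v 0 = 0") (auto elim!: oddE)
    hence "(real (v 0))\<^sup>2 \<ge> 3\<^sup>2" by (intro power_mono) auto
    moreover have "qf_tail t n v \<ge> 0" unfolding qf_tail_def using t by (intro sum_nonneg) auto
    ultimately show False using X qf_split[OF n1, of t v] by simp
  qed
  define Y where "Y = qf_tail t n v"
  have XY: "qf t n v = 1 + Y" using qf_split[OF n1, of t v] v0 by (simp add: Y_def)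
  have Y: "0 < Y" "Y \<le> 3" using X XY by auto
  have term_le: "(real (v j))\<^sup>2 * t ^ j \<le> Y" if "j \<in> {1..<n}" for j
    unfolding Y_def qf_tail_def by (rule member_le_sum) (use that t in auto)
  have two_terms: "(real (v i))\<^sup>2 * t ^ i + (real (v j))\<^sup>2 * t ^ j \<le> Y" if "i \<in> {1..<n}" "j \<in> {1..<n}" "i \<noteq> j" for i j
  proof -
    have "(\<Sum>k\<in>{i, j}. (real (v k))\<^sup>2 * t ^ k) \<le> Y"
      unfolding Y_def qf_tail_def by (rule sum_mono2) (use that t in auto)
    thus ?thesis using that(3) by simp
  qed
  have tj: "t \<le> t ^ j" if "1 \<le> j" for j
    using power_increasing[OF that, of t] t by simp
  have v01: "v j \<le> 1" if "j \<in> {1..<n}" for j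
  proof (rule ccontr)
    assume "\<not> v j \<le> 1"
    hence "(real (v j))\<^sup>2 \<ge> 2\<^sup>2" by (intro power_mono) auto
    hence "(real (v j))\<^sup>2 * t ^ j \<ge> 2\<^sup>2 * t" using tj[of j] that t by (intro mult_mono) auto
    thus False using term_le[OF that] Y t by simp
  qed
  define J where "J = {j \<in> {1..<n}. v j \<noteq> 0}"
  have "J \<noteq> {}"
  proof
    assume "J = {}"
    hence "Y = 0" unfolding Y_def qf_tail_def J_def by (intro sum.neutral) auto
    thus False using Y by simp
  qed
  define p where "p = Max J"
  have "p \<in> J" unfolding p_def using \<open>J \<noteq> {}\<close> by (intro Max_in) (auto simp: J_def)
  hence p: "1 \<le> p" "p < n" "v p = 1" using v01[of p] by (auto simp: J_def)
  have top: "v j = 0" if "p < j" "j < n" for j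
  proof (rule ccontr)
    assume "v j \<noteq> 0"
    hence "j \<in> J" using that p by (auto simp: J_def)
    hence "j \<le> p" unfolding p_def by (intro Max_ge) (auto simp: J_def)
    thus False using that by simp
  qed
  have window: "\<exists>z. escaping t n v z" if z: "z 0 = 0" "Y < qf_tail t n z" "qf_tail t n z < Y + 1" for z
    using tail_in_window_escapes[OF n1, of 1 v z t] odd z XY by auto
  show ?thesis
  proof (cases "p + 1 < n")
    case True
    \<comment> \<open>\<open>t ^ p * t ^ 2\<close> is at most \<open>t ^ n = 4\<close>, and
      \<open>4 * (t - 1) < t ^ 2\<close> says that the square of \<open>t - 2\<close> is
      positive.\<close>
    have small: "t ^ p * (t - 1) < 1"
    proof -
      have "t ^ p \<le> t ^ (n - 2)" using True t by (intro power_increasing) auto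
      moreover have "t ^ (n - 2) * t ^ 2 = 4"
      proof -
        have "t ^ (n - 2) * t ^ 2 = t ^ ((n - 2) + 2)" by (rule power_add[symmetric])
        also have "(n - 2) + 2 = n" using n by simp
        finally show ?thesis using t(3) by simp
      qed
      ultimately have "t ^ p * t ^ 2 \<le> 4" using t by (metis mult_right_mono zero_le_power2)
      moreover have "4 * (t - 1) < t ^ 2"
      proof -
        have "(t - 2)\<^sup>2 > 0" using t by simp
        thus ?thesis by (simp add: power2_eq_square algebra_simps)
      qed
      moreover have "t ^ p * t ^ 2 * (t - 1) \<le> 4 * (t - 1)"
        using \<open>t ^ p * t ^ 2 \<le> 4\<close> t by (intro mult_right_mono) auto
      moreover have "t ^ 2 * (t ^ p * (t - 1)) = t ^ p * t ^ 2 * (t - 1)" by (simp only: mult_ac)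
      ultimately have "t ^ 2 * (t ^ p * (t - 1)) < t ^ 2 * 1" by linarith
      thus ?thesis by (rule mult_left_less_imp_less) (use t in simp)
    qed
    define z where "z = v(0 := 0, p := 0, Suc p := 1)"
    have "qf_tail t n z = (\<Sum>j\<in>{1..<n}. ((real (v j))\<^sup>2 * t ^ j + (if j = p then (-1) * t ^ p else 0)) + (if j = Suc p then t ^ Suc p else 0))"
      unfolding qf_tail_def z_def by (rule sum.cong) (use p top[of "Suc p"] True in auto)
    also have "\<dots> = Y - t ^ p + t ^ Suc p"
      using p True by (simp add: sum.distrib Y_def qf_tail_def)
    finally have tz: "qf_tail t n z = Y + t ^ p * (t - 1)" by (simp add: algebra_simps)
    have "t ^ p * (t - 1) > 0" using t by simp
    thus ?thesis using window[of z] tz small by (simp add: z_def)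
  next
    case False
    hence pn: "p = n - 1" using p by simp
    define T where "T = t ^ (n - 1)"
    have tT: "t * T = 4" using t(3) n unfolding T_def by (metis Suc_diff_1 gr0I not_numeral_le_zero power_Suc)
    have T3: "T \<le> 3" using term_le[of p] p Y unfolding pn T_def by auto
    have Tpos: "T > 0" using t by (simp add: T_def)
    have tlow: "t \<ge> 4 / 3"
    proof (rule ccontr)
      assume "\<not> t \<ge> 4 / 3"
      hence "t * T < 4 / 3 * T" using Tpos by (intro mult_strict_right_mono) auto
      thus False using tT T3 by simp
    qed
    have n4: "n \<le> 4"
    proof (rule ccontr)
      assume "\<not> n \<le> 4"
      \<comment> \<open>The fifth power of 4/3 is 1024/243, which exceeds 4.\<close>
      have "(4 / 3) ^ 5 \<le> t ^ 5" using tlow by (intro power_mono) auto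
      also have "\<dots> \<le> t ^ n" using t \<open>\<not> n \<le> 4\<close> by (intro power_increasing) auto
      finally show False using t(3) by (simp add: power_divide)
    qed
    have T52: "T > 5 / 2"
    proof (rule ccontr)
      assume "\<not> T > 5 / 2"
      hence "t * T \<le> t * (5 / 2)" using t by (intro mult_left_mono) auto
      thus False using tT t by simp
    qed
    \<comment> \<open>A further 1 would add at least 4/3 to \<open>T > 5 / 2\<close> and bring the
      tail above 3.\<close>
    have zero: "v j = 0" if "j \<in> {1..<n}" "j \<noteq> p" for j
    proof (rule ccontr)
      assume "v j \<noteq> 0"
      hence "v j = 1" using v01[OF that(1)] by simp
      hence "t ^ j + T \<le> Y" using two_terms[of j p] that p unfolding pn T_def by auto
      thus False using tj[of j] that tlow T52 Y by auto
    qed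
    have "Y = (\<Sum>j\<in>{1..<n}. if j = p then T else 0)"
      unfolding Y_def qf_tail_def by (rule sum.cong) (use zero p pn in \<open>auto simp: T_def\<close>)
    hence YT: "Y = T" using p by simp
    have "n = 3 \<or> n = 4" using n n4 by auto
    thus ?thesis
    proof
      assume "n = 3"
      thus ?thesis using ex v0 zero[of 1] p pn by auto
    next
      assume n4: "n = 4"
      have "t ^ 2 = 2"
      proof -
        have "(t ^ 2)\<^sup>2 = 2\<^sup>2" using t(3) n4 by (simp add: power_mult[symmetric])
        thus ?thesis by (rule power2_eq_imp_eq) auto
      qed
      hence T: "T = 2 * t" unfolding T_def n4 by (simp add: power3_eq_cube power2_eq_square)
      \<comment> \<open>Now \<open>t = sqrt 2\<close>. The tail of \<open>v\<close> is
        \<open>2 * t\<close>, about 2.83, and this vector has tail \<open>t + 2\<close>, about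
        3.41.\<close>
      let ?z = "\<lambda>j. if j = 0 then 0 else if j = 1 then 1 else if j = 2 then 1 else (0::nat)"
      have "qf_tail t n ?z = (real 1)\<^sup>2 * t + t ^ 2" by (rule qf_tail_two) (use n4 in auto)
      hence "qf_tail t n ?z = t + 2" using \<open>t ^ 2 = 2\<close> by simp
      thus ?thesis using window[of ?z] t T YT by auto
    qed
  qed
qed

text \<open>The value is an integer above 1 and up to 4, above 9 and up to 16, or above 25 and up to
  36. Apart from the two exceptions this leaves four vectors, with value 27 or 33, and (4, 2) or (0,
  4) escapes.\<close>

lemma escape_dim2:
  assumes odd: "odd (v 0)" and v1: "v 1 \<noteq> 0" and X: "(2 * real a - 1)\<^sup>2 < qf 2 2 v" "qf 2 2 v \<le> (2 * real a)\<^sup>2"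
    and a: "a = 1 \<or> a = 2 \<or> a = 3"
    and ex: "\<not> (v 0 = 1 \<and> v 1 = 1)" "\<not> (v 0 = 3 \<and> v 1 = 1)"
  shows "\<exists>z. escaping 2 2 v z"
proof -
  have q: "qf 2 2 w = real ((w 0)\<^sup>2 + 2 * (w 1)\<^sup>2)" for w
    by (simp add: qf_def numeral_2_eq_2)
  define Q where "Q = (v 0)\<^sup>2 + 2 * (v 1)\<^sup>2"
  have Qv: "qf 2 2 v = real Q" unfolding Q_def by (rule q)
  have Q36: "Q \<le> 36"
    using X(2) a unfolding Qv by auto
  have "v 0 \<le> 6"
  proof (rule ccontr)
    assume "\<not> v 0 \<le> 6"
    hence "7\<^sup>2 \<le> (v 0)\<^sup>2" by (intro power_mono) auto
    thus False using Q36 by (simp add: Q_def)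
  qed
  hence v0: "v 0 = 1 \<or> v 0 = 3 \<or> v 0 = 5" using odd by presburger
  have "v 1 \<le> 4"
  proof (rule ccontr)
    assume "\<not> v 1 \<le> 4"
    hence "5\<^sup>2 \<le> (v 1)\<^sup>2" by (intro power_mono) auto
    thus False using Q36 by (simp add: Q_def)
  qed
  hence v1': "v 1 = 1 \<or> v 1 = 2 \<or> v 1 = 3 \<or> v 1 = 4" using v1 by presburger
  have lo: "real ((2 * a - 1)\<^sup>2) < real Q"
    using X(1) a unfolding Qv by auto
  have hi: "real Q \<le> real ((2 * a)\<^sup>2)" using X(2) unfolding Qv by simp
  have cases: "(v 0 = 1 \<and> v 1 = 4) \<or> (v 0 = 3 \<and> v 1 = 3) \<or> (v 0 = 5 \<and> v 1 = 1) \<or> (v 0 = 5 \<and> v 1 = 2)"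
    using v0 v1' a lo hi ex unfolding of_nat_less_iff of_nat_le_iff Q_def by (elim disjE) simp_all
  have esc: "escaping 2 2 v (\<lambda>j. if j = 0 then e else if j = 1 then k else 0)"
    if "even e" "e\<^sup>2 + 2 * k\<^sup>2 < Q" "Q \<le> (Suc e)\<^sup>2 + 2 * k\<^sup>2" "k \<noteq> v 1" for e k
  proof -
    let ?z = "\<lambda>j. if j = 0 then e else if j = 1 then k else (0::nat)"
    have "real (e\<^sup>2 + 2 * k\<^sup>2) < real Q" "real Q \<le> real ((Suc e)\<^sup>2 + 2 * k\<^sup>2)"
      using that by (simp_all only: of_nat_less_iff of_nat_le_iff)
    moreover have "\<exists>j<2. ?z j \<noteq> (v(0 := v 0 - 1)) j" using that(4) by (intro exI[of _ 1]) simp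
    ultimately show ?thesis unfolding escaping_def Qv q[of ?z] q[of "?z(0 := Suc (?z 0))"] using that(1) by simp
  qed
  show ?thesis using cases
  proof (elim disjE conjE)
    assume "v 0 = 1" "v 1 = 4"
    thus ?thesis using esc[of 4 2] by (auto simp: Q_def)
  next
    assume "v 0 = 3" "v 1 = 3"
    thus ?thesis using esc[of 4 2] by (auto simp: Q_def)
  next
    assume "v 0 = 5" "v 1 = 1"
    thus ?thesis using esc[of 4 2] by (auto simp: Q_def)
  next
    assume "v 0 = 5" "v 1 = 2"
    thus ?thesis using esc[of 0 4] by (auto simp: Q_def)
  qed
qed

text \<open>The exceptions are the eigenvalues 1, for \<open>n = 2\<close> also 3 and 11, and for \<open>n = 3\<close> also \<open>1 + t\<^sup>2\<close>.\<close>
lemma exists_escaping: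
  assumes n: "n \<ge> 2" and t: "t > 0" "t ^ n = 4" and odd: "odd (v 0)"
    and ex1: "\<not> (v 0 = 1 \<and> (\<forall>j. 1 \<le> j \<and> j < n \<longrightarrow> v j = 0))"
    and ex2: "\<not> (n = 2 \<and> v 0 = 1 \<and> v 1 = 1)" "\<not> (n = 2 \<and> v 0 = 3 \<and> v 1 = 1)"
    and ex3: "\<not> (n = 3 \<and> v 0 = 1 \<and> v 1 = 0 \<and> v 2 = 1)"
  shows "\<exists>z. escaping t n v z"
proof -
  note b = base_bounds[OF t n]
  have n1: "n \<ge> 1" using n by simp
  have tail0: "qf_tail t n v \<ge> 0" unfolding qf_tail_def using t by (intro sum_nonneg) auto
  have v01: "v 0 \<ge> 1" using odd by (cases "v 0") auto
  hence "(real (v 0))\<^sup>2 \<ge> 1" by (simp add: power2_eq_square mult_ge1_I)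
  hence X1: "qf t n v \<ge> 1" using tail0 qf_split[OF n1, of t v] by linarith
  show ?thesis
  proof (cases "\<forall>j. 1 \<le> j \<and> j < n \<longrightarrow> v j = 0")
    case True
    have tz: "qf_tail t n v = 0" unfolding qf_tail_def by (rule sum.neutral) (use True in auto)
    have X: "qf t n v = (real (v 0))\<^sup>2" using tz qf_split[OF n1, of t v] by simp
    have v3: "v 0 \<ge> 3"
    proof -
      have "v 0 \<noteq> 1" "v 0 \<noteq> 2" using ex1 True odd by auto
      thus ?thesis using v01 by linarith
    qed
    \<comment> \<open>With zero tail, lowering \<open>v 0\<close> leaves room for \<open>t\<close>,
      because \<open>2 * v 0 - 1\<close> is at least 5 and \<open>t\<close> at most 2.\<close>
    let ?z = "\<lambda>j. if j = 0 then v 0 - 1 else if j = 1 then 1 else (0::nat)"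
    have z: "qf_tail t n ?z = t" using qf_tail_first[OF n, of t "v 0 - 1" 1] by simp
    have r: "real (v 0 - 1) = real (v 0) - 1" using v01 by simp
    have "escaping t n v ?z"
    proof (rule escapingI[OF n1, where e = "v 0 - 1"])
      have "(real (v 0) - 1)\<^sup>2 + t = (real (v 0))\<^sup>2 + (t + 1 - 2 * real (v 0))" by (simp add: power2_eq_square algebra_simps)
      moreover have "real (v 0) \<ge> 3" using v3 by simp
      ultimately show "(real (v 0 - 1))\<^sup>2 + qf_tail t n ?z < qf t n v" unfolding z r X using b(2) by linarith
      show "qf t n v \<le> (real (v 0 - 1) + 1)\<^sup>2 + qf_tail t n ?z" unfolding z r X using t by simp
      show "(\<exists>j. 1 \<le> j \<and> j < n \<and> ?z j \<noteq> v j) \<or> v 0 \<noteq> Suc (v 0 - 1)"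
        using True n by (intro disjI1 exI[of _ 1]) auto
    qed (use odd in auto)
    thus ?thesis by blast
  next
    case False
    then obtain i where i: "1 \<le> i" "i < n" "v i \<noteq> 0" by blast
    \<comment> \<open>\<open>c\<close> is the square root of the value rounded up. For odd
      \<open>c\<close> the vector with the single entry \<open>c - 1\<close> escapes, since raising
      it reaches the value; an even \<open>c = 2 * a\<close> requires a tail.\<close>
    obtain c :: nat where c: "c \<ge> 1" "(real c - 1)\<^sup>2 < qf t n v" "qf t n v \<le> (real c)\<^sup>2"
      using sqrt_bracket[OF X1] by blast
    show ?thesis
    proof (cases "odd c")
      case True
      let ?z = "\<lambda>j. if j = 0 then c - 1 else (0::nat)"
      have z: "qf_tail t n ?z = 0" by (rule qf_tail_zero)
      have r: "real (c - 1) = real c - 1" using c(1) by simp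
      have "escaping t n v ?z"
      proof (rule escapingI[OF n1, where e = "c - 1"])
        show "(real (c - 1))\<^sup>2 + qf_tail t n ?z < qf t n v" unfolding z r using c(2) by simp
        show "qf t n v \<le> (real (c - 1) + 1)\<^sup>2 + qf_tail t n ?z" unfolding z r using c(3) by simp
        show "(\<exists>j. 1 \<le> j \<and> j < n \<and> ?z j \<noteq> v j) \<or> v 0 \<noteq> Suc (c - 1)"
          using i by (intro disjI1 exI[of _ i]) auto
      qed (use odd True in auto)
      thus ?thesis by blast
    next
      case False
      then obtain a where a: "c = 2 * a" by (auto elim: evenE)
      have X: "(2 * real a - 1)\<^sup>2 < qf t n v" "qf t n v \<le> (2 * real a)\<^sup>2" using c(2,3) a by simp_all
      have a1: "a \<ge> 1" using a c(1) by simp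
      consider "a \<ge> 4" | "n \<ge> 3" "a = 2 \<or> a = 3" | "n \<ge> 3" "a = 1" | "n = 2" "a = 1 \<or> a = 2 \<or> a = 3"
        using a1 n by linarith
      thus ?thesis
      proof cases
        case 1
        show ?thesis by (rule escape_large[where a = a]) (use n b 1 odd X in auto)
      next
        case 2
        show ?thesis by (rule escape_medium[where a = a]) (use b 2 odd X t in auto)
      next
        case 3
        show ?thesis by (rule escape_small) (use b 3 odd X t ex3 in auto)
      next
        case 4
        have "i = 1" using i 4 by simp
        have "t = 2" using b(3) 4 by blast
        have "\<exists>z. escaping 2 2 v z"
          by (rule escape_dim2[where a = a]) (use odd i \<open>i = 1\<close> X \<open>t = 2\<close> 4 ex2 in auto)
        thus ?thesis using \<open>t = 2\<close> 4 by simp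
      qed
    qed
  qed
qed

subsection \<open>The boxes with edge ratio \<open>2\<^sup>1\<^sup>/\<^sup>n\<close>\<close>

definition ratio :: "nat \<Rightarrow> real" where
  "ratio n = 2 powr (1 / real n)"

text \<open>\<open>ax\<close> lists the axes from the longest edge on and starts at 0, so that axis
  \<open>ax j\<close> contributes the power \<open>t ^ j\<close> in \<open>qf\<close>.\<close>

definition paper_box :: "real^'n \<Rightarrow> real^'n \<Rightarrow> (nat \<Rightarrow> 'n) \<Rightarrow> real \<Rightarrow> bool" where
  "paper_box a b ax L \<longleftrightarrow> bij_betw ax {..<CARD('n)} UNIV \<and> L > 0 \<and>
     (\<forall>j<CARD('n). b $ ax j - a $ ax j = L / ratio CARD('n) ^ j)"

lemma ratio_power: "n \<ge> 1 \<Longrightarrow> ratio n ^ n = 2"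
  unfolding ratio_def by (subst powr_realpow[symmetric]) (auto simp: powr_powr)

lemma ratio_pos: "ratio n > 0"
  by (simp add: ratio_def)

lemma ratio_square_power: "n \<ge> 1 \<Longrightarrow> ((ratio n)\<^sup>2) ^ n = 4"
  by (simp add: power_mult[symmetric] mult.commute[of 2 n]) (simp add: power_mult ratio_power)

lemma paper_box_less:
  fixes a b :: "real^'n"
  assumes "paper_box a b ax L" shows "a $ i < b $ i"
proof -
  obtain j where j: "j < CARD('n)" "ax j = i"
    using assms unfolding paper_box_def bij_betw_def by (metis UNIV_I imageE lessThan_iff)
  have "b $ i - a $ i = L / ratio CARD('n) ^ j" using assms j unfolding paper_box_def by auto
  moreover have "L / ratio CARD('n) ^ j > 0" using assms ratio_pos[of "CARD('n)"] unfolding paper_box_def by simp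
  ultimately show ?thesis by linarith
qed

lemma energy_paper_box:
  fixes a b :: "real^'n"
  assumes "paper_box a b ax L"
  shows "energy a b m = (pi / L)\<^sup>2 * qf ((ratio CARD('n))\<^sup>2) CARD('n) (m \<circ> ax)"
proof -
  let ?n = "CARD('n)" and ?r = "ratio CARD('n)"
  have bij: "bij_betw ax {..<?n} UNIV" and L: "L > 0" and len: "\<And>j. j < ?n \<Longrightarrow> b $ ax j - a $ ax j = L / ?r ^ j"
    using assms unfolding paper_box_def by auto
  have "energy a b m = (\<Sum>j<?n. (real (m (ax j)) * freq a b (ax j))\<^sup>2)"
    unfolding energy_def by (rule sum.reindex_bij_betw[OF bij, symmetric])
  also have "\<dots> = (\<Sum>j<?n. (pi / L)\<^sup>2 * ((real ((m \<circ> ax) j))\<^sup>2 * (?r\<^sup>2) ^ j))"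
  proof (rule sum.cong[OF refl])
    fix j assume "j \<in> {..<?n}"
    hence "freq a b (ax j) = pi / L * ?r ^ j" using len[of j] by (simp add: freq_def)
    moreover have "(?r ^ j)\<^sup>2 = (?r\<^sup>2) ^ j" by (simp add: power_mult[symmetric] mult.commute)
    ultimately show "(real (m (ax j)) * freq a b (ax j))\<^sup>2 = (pi / L)\<^sup>2 * ((real ((m \<circ> ax) j))\<^sup>2 * (?r\<^sup>2) ^ j)"
      by (simp add: power_mult_distrib power_divide mult_ac)
  qed
  finally show ?thesis unfolding qf_def sum_distrib_left .
qed

lemma qf_cong: "(\<And>j. j < n \<Longrightarrow> v j = w j) \<Longrightarrow> qf t n v = qf t n w"
  unfolding qf_def by (rule sum.cong) auto

definition axis_vec :: "(nat \<Rightarrow> 'n) \<Rightarrow> (nat \<Rightarrow> nat) \<Rightarrow> 'n \<Rightarrow> nat" where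
  "axis_vec ax v = v \<circ> inv_into {..<CARD('n)} ax"

lemma axis_vec_nth:
  fixes ax :: "nat \<Rightarrow> 'n::finite"
  assumes "bij_betw ax {..<CARD('n)} UNIV" "j < CARD('n)"
  shows "axis_vec ax v (ax j) = v j"
  using assms by (simp add: axis_vec_def bij_betw_def inv_into_f_f)

lemma axis_eqI:
  fixes ax :: "nat \<Rightarrow> 'n::finite"
  assumes "bij_betw ax {..<CARD('n)} UNIV" "\<And>j. j < CARD('n) \<Longrightarrow> f (ax j) = g (ax j)"
  shows "f = g"
proof
  fix i
  obtain j where "j < CARD('n)" "ax j = i"
    using assms(1) unfolding bij_betw_def by (metis UNIV_I imageE lessThan_iff)
  thus "f i = g i" using assms(2) by blast
qed

lemma qf_axis_vec:
  fixes ax :: "nat \<Rightarrow> 'n::finite"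
  assumes "bij_betw ax {..<CARD('n)} UNIV"
  shows "qf t CARD('n) (axis_vec ax v \<circ> ax) = qf t CARD('n) v"
  by (rule qf_cong) (simp add: axis_vec_nth[OF assms])

text \<open>Half of the longest edge is \<open>L / r ^ n\<close>, the next member of the geometric
  sequence. So the half is a box of the same kind, with longest edge \<open>L / r\<close> and the
  axes shifted cyclically.\<close>

lemma paper_box_halve:
  fixes a b :: "real^'n"
  assumes P: "paper_box a b ax L" and n: "CARD('n) \<ge> 2"
  shows "paper_box a (halve a b (ax 0)) (\<lambda>j. if j = CARD('n) - 1 then ax 0 else ax (Suc j)) (L / ratio CARD('n))"
proof -
  let ?n = "CARD('n)" and ?r = "ratio CARD('n)"
  have bij: "bij_betw ax {..<?n} UNIV" and L: "L > 0" and len: "\<And>j. j < ?n \<Longrightarrow> b $ ax j - a $ ax j = L / ?r ^ j"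
    using P unfolding paper_box_def by auto
  have "bij_betw (\<lambda>j. if j = ?n - 1 then 0 else Suc j) {..<?n} {..<?n}"
    by (rule bij_betw_byWitness[where f' = "\<lambda>j. if j = 0 then ?n - 1 else j - 1"]) (use n in auto)
  from bij_betw_trans[OF this bij]
  have bij': "bij_betw (\<lambda>j. if j = ?n - 1 then ax 0 else ax (Suc j)) {..<?n} UNIV"
    by (simp add: o_def if_distrib[of ax])
  have inj: "ax i = ax j \<longleftrightarrow> i = j" if "i < ?n" "j < ?n" for i j
    using bij that unfolding bij_betw_def inj_on_def by auto
  have "halve a b (ax 0) $ (if j = ?n - 1 then ax 0 else ax (Suc j)) - a $ (if j = ?n - 1 then ax 0 else ax (Suc j)) =
     L / ?r / ?r ^ j" if j: "j < ?n" for j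
  proof (cases "j = ?n - 1")
    case True
    have "?r * ?r ^ j = 2" unfolding power_Suc[symmetric] True using ratio_power[of ?n] by simp
    moreover have "(a $ ax 0 + b $ ax 0) / 2 - a $ ax 0 = (b $ ax 0 - a $ ax 0) / 2" by (simp add: field_simps)
    ultimately show ?thesis using True len[of 0] n by (simp add: halve_nth)
  next
    case False
    hence "Suc j < ?n" using j by simp
    hence "ax (Suc j) \<noteq> ax 0" using inj[of "Suc j" 0] n by simp
    thus ?thesis using False len[OF \<open>Suc j < ?n\<close>] by (simp add: halve_nth)
  qed
  thus ?thesis unfolding paper_box_def using bij' L ratio_pos[of ?n] by simp
qed

text \<open>Lowering the odd entry by one maps the odd modes below \<open>mu\<close> injectively to
  even ones. The image misses the lowered \<open>m0\<close>, because \<open>m0\<close> is not below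
  \<open>mu\<close>, and the mode \<open>y\<close> given by \<open>z\<close>, because raising
  \<open>y\<close> reaches \<open>mu\<close>; \<open>escaping\<close> keeps these two apart.\<close>

lemma even_class_too_large:
  fixes a b :: "real^'n"
  assumes P: "paper_box a b ax L" and m0: "energy a b m0 = mu" "odd (m0 (ax 0))"
    and z: "escaping ((ratio CARD('n))\<^sup>2) CARD('n) (m0 \<circ> ax) z"
  shows "card {m. energy a b m < mu \<and> odd (m (ax 0))} + 2 \<le> card {m. energy a b m < mu \<and> even (m (ax 0))}"
proof -
  let ?n = "CARD('n)" and ?t = "(ratio CARD('n))\<^sup>2" and ?s = "ax 0"
  let ?O = "{m. energy a b m < mu \<and> odd (m ?s)}" and ?E = "{m. energy a b m < mu \<and> even (m ?s)}"
  have bij: "bij_betw ax {..<?n} UNIV" and L: "L > 0" using P unfolding paper_box_def by auto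
  have n0: "0 < ?n" by simp
  note ab = paper_box_less[OF P]
  note en = energy_paper_box[OF P]
  have C: "(pi / L)\<^sup>2 > 0" using L by simp
  define y where "y = axis_vec ax z"
  have yax: "y (ax j) = z j" if "j < ?n" for j unfolding y_def by (rule axis_vec_nth[OF bij that])
  have qy: "qf ?t ?n (y \<circ> ax) = qf ?t ?n z" unfolding y_def by (rule qf_axis_vec[OF bij])
  have inj: "ax i = ax j \<longleftrightarrow> i = j" if "i < ?n" "j < ?n" for i j
    using bij that unfolding bij_betw_def inj_on_def by auto
  have qy': "qf ?t ?n (y(?s := Suc (y ?s)) \<circ> ax) = qf ?t ?n (z(0 := Suc (z 0)))"
    by (rule qf_cong) (use inj[OF _ n0] yax n0 in auto)
  have zE: "even (z 0)" "qf ?t ?n z < qf ?t ?n (m0 \<circ> ax)" "qf ?t ?n (m0 \<circ> ax) \<le> qf ?t ?n (z(0 := Suc (z 0)))"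
    and zne: "\<exists>j<?n. z j \<noteq> ((m0 \<circ> ax)(0 := (m0 \<circ> ax) 0 - 1)) j"
    using z unfolding escaping_def by auto
  define f where "f m = m(?s := m ?s - 1)" for m :: "'n \<Rightarrow> nat"
  have flt: "energy a b (f m) < energy a b m" if "odd (m ?s)" for m
  proof (rule energy_strict_mono[OF ab])
    show "f m i \<le> m i" for i by (simp add: f_def)
    have "f m ?s \<noteq> m ?s" using that by (cases "m ?s") (auto simp: f_def)
    thus "f m \<noteq> m" by metis
  qed
  have fE: "f m \<in> ?E" if "energy a b m \<le> mu" "odd (m ?s)" for m
    using flt[of m, OF that(2)] that by (auto simp: f_def)
  have yE: "y \<in> ?E"
  proof -
    have "energy a b y < mu" unfolding m0(1)[symmetric] en qy using zE(2) C by (rule mult_strict_left_mono)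
    thus ?thesis using zE(1) yax[OF n0] by simp
  qed
  have restore: "(f m)(?s := Suc (f m ?s)) = m" if "odd (m ?s)" for m
    using that by (cases "m ?s") (auto simp: f_def fun_eq_iff)
  have injf: "inj_on f ?O" by (rule inj_onI) (metis (mono_tags, lifting) restore mem_Collect_eq)
  have y_out: "y \<notin> f ` ?O"
  proof
    assume "y \<in> f ` ?O"
    then obtain m where m: "m \<in> ?O" "y = f m" by blast
    hence "y(?s := Suc (y ?s)) = m" using restore[of m] by simp
    moreover have "mu \<le> energy a b (y(?s := Suc (y ?s)))"
      unfolding m0(1)[symmetric] en qy' using zE(3) C by (intro mult_left_mono) auto
    ultimately show False using m(1) by simp
  qed
  have f0_out: "f m0 \<notin> f ` ?O"
  proof
    assume "f m0 \<in> f ` ?O"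
    then obtain m where m: "m \<in> ?O" "f m0 = f m" by blast
    hence "m0 = m" using restore[of m] restore[of m0] m0(2) by simp
    thus False using m(1) m0(1) by simp
  qed
  have yne: "y \<noteq> f m0"
  proof
    assume yf: "y = f m0"
    obtain j where j: "j < ?n" "z j \<noteq> ((m0 \<circ> ax)(0 := (m0 \<circ> ax) 0 - 1)) j" using zne by blast
    have "z j = f m0 (ax j)" using yax[OF j(1)] yf by simp
    thus False using j inj[OF j(1) n0] by (auto simp: f_def split: if_splits)
  qed
  have finO: "finite ?O" and finE: "finite ?E" by (rule finite_energy_less_conj[OF ab])+
  have "card (insert y (insert (f m0) (f ` ?O))) = card ?O + 2"
    using y_out f0_out yne finO by (simp add: card_image[OF injf])
  moreover have "insert y (insert (f m0) (f ` ?O)) \<subseteq> ?E"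
  proof -
    have "f m0 \<in> ?E" by (rule fE) (simp_all add: m0)
    moreover have "f ` ?O \<subseteq> ?E" by (rule image_subsetI, rule fE) auto
    ultimately show ?thesis using yE by blast
  qed
  ultimately show ?thesis using card_mono[OF finE, of "insert y (insert (f m0) (f ` ?O))"] by linarith
qed

lemma paper_box_simple:
  fixes a b :: "real^'n"
  assumes P: "paper_box a b ax L"
    and uniq: "\<And>w. qf ((ratio CARD('n))\<^sup>2) CARD('n) w = qf ((ratio CARD('n))\<^sup>2) CARD('n) v \<Longrightarrow> (\<forall>j<CARD('n). w j = v j)"
  shows "{k. energy a b k = (pi / L)\<^sup>2 * qf ((ratio CARD('n))\<^sup>2) CARD('n) v} = {axis_vec ax v}"
proof -
  let ?n = "CARD('n)" and ?t = "(ratio CARD('n))\<^sup>2"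
  have bij: "bij_betw ax {..<?n} UNIV" and L: "L > 0" using P unfolding paper_box_def by auto
  note en = energy_paper_box[OF P]
  have C: "(pi / L)\<^sup>2 \<noteq> 0" using L by simp
  show ?thesis
  proof (rule set_eqI, rule iffI)
    fix k assume "k \<in> {k. energy a b k = (pi / L)\<^sup>2 * qf ?t ?n v}"
    hence "qf ?t ?n (k \<circ> ax) = qf ?t ?n v" using C unfolding en by simp
    from uniq[OF this] have "k (ax j) = axis_vec ax v (ax j)" if "j < ?n" for j
      using that axis_vec_nth[OF bij that, of v] by simp
    thus "k \<in> {axis_vec ax v}" using axis_eqI[OF bij] by blast
  qed (simp add: en qf_axis_vec[OF bij])
qed

lemma paper_box_not_sharp:
  fixes a b :: "real^'n"
  assumes P: "paper_box a b ax L"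
    and uniq: "\<And>w. qf ((ratio CARD('n))\<^sup>2) CARD('n) w = qf ((ratio CARD('n))\<^sup>2) CARD('n) v \<Longrightarrow> (\<forall>j<CARD('n). w j = v j)"
    and z: "qf ((ratio CARD('n))\<^sup>2) CARD('n) z < qf ((ratio CARD('n))\<^sup>2) CARD('n) v" "j < CARD('n)" "v j < z j"
  shows "\<not> sharp a b ((pi / L)\<^sup>2 * qf ((ratio CARD('n))\<^sup>2) CARD('n) v)"
proof (rule not_sharp_simple[OF paper_box_less[OF P] paper_box_simple[OF P uniq]])
  have bij: "bij_betw ax {..<CARD('n)} UNIV" and L: "L > 0" using P unfolding paper_box_def by auto
  show "energy a b (axis_vec ax z) < (pi / L)\<^sup>2 * qf ((ratio CARD('n))\<^sup>2) CARD('n) v"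
    unfolding energy_paper_box[OF P] qf_axis_vec[OF bij] using z(1) L by (intro mult_strict_left_mono) auto
  show "axis_vec ax v (ax j) < axis_vec ax z (ax j)" unfolding axis_vec_nth[OF bij z(2)] by (rule z(3))
qed

lemma paper_box_sharp:
  fixes a b :: "real^'n"
  assumes P: "paper_box a b ax L"
    and uniq: "\<And>w. qf ((ratio CARD('n))\<^sup>2) CARD('n) w = qf ((ratio CARD('n))\<^sup>2) CARD('n) v \<Longrightarrow> (\<forall>j<CARD('n). w j = v j)"
    and below: "\<And>w. qf ((ratio CARD('n))\<^sup>2) CARD('n) w < qf ((ratio CARD('n))\<^sup>2) CARD('n) v \<Longrightarrow> (\<forall>j<CARD('n). w j \<le> v j)"
    and lam: "lists_neumann_eigenvalues (box a b) lam"
  shows "sharp a b ((pi / L)\<^sup>2 * qf ((ratio CARD('n))\<^sup>2) CARD('n) v)"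
    "lam (\<Prod>j<CARD('n). v j + 1) = (pi / L)\<^sup>2 * qf ((ratio CARD('n))\<^sup>2) CARD('n) v"
proof -
  let ?n = "CARD('n)" and ?t = "(ratio CARD('n))\<^sup>2"
  let ?mu = "(pi / L)\<^sup>2 * qf ?t ?n v"
  have bij: "bij_betw ax {..<?n} UNIV" and L: "L > 0" using P unfolding paper_box_def by auto
  note ab = paper_box_less[OF P] and en = energy_paper_box[OF P]
  have simple: "{k. energy a b k = ?mu} = {axis_vec ax v}"
    by (rule paper_box_simple[OF P]) (rule uniq)
  have C: "(pi / L)\<^sup>2 > 0" using L by simp
  have le: "k i \<le> axis_vec ax v i" if "energy a b k < ?mu" for k i
  proof -
    have "qf ?t ?n (k \<circ> ax) < qf ?t ?n v" using that C unfolding en by simp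
    from below[OF this] have *: "\<And>j. j < ?n \<Longrightarrow> k (ax j) \<le> v j" by simp
    obtain j where "j < ?n" "ax j = i"
      using bij unfolding bij_betw_def by (metis UNIV_I imageE lessThan_iff)
    thus ?thesis using *[of j] axis_vec_nth[OF bij, of j v] by auto
  qed
  show "sharp a b ?mu" by (rule sharp_simple(1)[where m = "axis_vec ax v"]) (rule ab simple le, assumption?)+
  have "card {k. energy a b k < ?mu} + 1 = (\<Prod>i\<in>UNIV. axis_vec ax v i + 1)"
    by (rule sharp_simple(2)[where m = "axis_vec ax v"]) (rule ab simple le, assumption?)+
  also have "\<dots> = (\<Prod>j<?n. axis_vec ax v (ax j) + 1)" by (rule prod.reindex_bij_betw[OF bij, symmetric])
  also have "\<dots> = (\<Prod>j<?n. v j + 1)" by (rule prod.cong) (auto simp: axis_vec_nth[OF bij])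
  finally have card: "card {k. energy a b k < ?mu} + 1 = (\<Prod>j<?n. v j + 1)" .
  show "lam (\<Prod>j<?n. v j + 1) = ?mu"
    by (rule listed_eigenvalue[OF ab lam _ card, of "axis_vec ax v"]) (simp add: en qf_axis_vec[OF bij])
qed

section \<open>Small values of the form and their representations\<close>

lemma qf_term_le:
  assumes "t > 0" "j < n" shows "(real (w j))\<^sup>2 * t ^ j \<le> qf t n w"
  unfolding qf_def by (rule member_le_sum) (use assms in auto)

lemma qf_first_two:
  assumes "n \<ge> 2" shows "qf t n (\<lambda>j. if j = 0 then e else if j = 1 then k else 0) = (real e)\<^sup>2 + (real k)\<^sup>2 * t"
  using qf_split[of n t] qf_tail_first[OF assms, of t e k] assms by simp

lemma real_square_ge: "k \<le> v \<Longrightarrow> (real k)\<^sup>2 \<le> (real v)\<^sup>2"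
  by (intro power_mono) auto

lemma qf_small:
  assumes t: "1 < t" and n: "n \<ge> 2" and w: "qf t n w \<le> t" and j: "2 \<le> j" "j < n"
  shows "w j = 0"
proof (rule ccontr)
  assume "w j \<noteq> 0"
  hence "1 * t ^ 2 \<le> (real (w j))\<^sup>2 * t ^ j"
    using t j real_square_ge[of 1 "w j"] by (intro mult_mono power_increasing) auto
  also have "\<dots> \<le> t" using qf_term_le[of t j n w] t j w by linarith
  finally show False using t by (simp add: power2_eq_square)
qed

lemma qf_eq_first_two:
  assumes n: "n \<ge> 2" and w: "\<And>j. 2 \<le> j \<Longrightarrow> j < n \<Longrightarrow> w j = 0"
  shows "qf t n w = (real (w 0))\<^sup>2 + (real (w 1))\<^sup>2 * t"
proof -
  have "qf t n w = qf t n (\<lambda>j. if j = 0 then w 0 else if j = 1 then w 1 else 0)"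
    by (rule qf_cong) (use w in \<open>auto simp: not_less_eq_eq numeral_2_eq_2\<close>)
  thus ?thesis using qf_first_two[OF n] by simp
qed

text \<open>With second entry 0 the number \<open>t\<close> would be a square of an integer, but it
  lies above 1 and is at most 2.\<close>

lemma qf_eq_t_unique:
  assumes t: "1 < t" "t \<le> 2" and n: "n \<ge> 2"
    and w: "qf t n w = qf t n (\<lambda>j. if j = 0 then 0 else if j = 1 then 1 else 0)" and j: "j < n"
  shows "w j = (if j = 0 then 0 else if j = 1 then 1 else 0)"
proof -
  have qw: "qf t n w = t" using w qf_first_two[OF n, of t 0 1] by simp
  have z: "w i = 0" if "2 \<le> i" "i < n" for i by (rule qf_small[OF t(1) n _ that]) (simp add: qw)
  have eq: "(real (w 0))\<^sup>2 + (real (w 1))\<^sup>2 * t = t" using qf_eq_first_two[OF n z] qw by simp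
  have w1: "w 1 \<le> 1"
  proof (rule ccontr)
    assume "\<not> w 1 \<le> 1"
    hence "4 * t \<le> (real (w 1))\<^sup>2 * t" using real_square_ge[of 2 "w 1"] t by (intro mult_right_mono) auto
    moreover have "(real (w 0))\<^sup>2 \<ge> 0" by simp
    ultimately show False using eq t by linarith
  qed
  have "w 1 = 1"
  proof (rule ccontr)
    assume "w 1 \<noteq> 1"
    hence "w 1 = 0" using w1 by simp
    hence sq: "(real (w 0))\<^sup>2 = t" using eq by simp
    show False
    proof (cases "w 0 \<le> 1")
      case True
      hence "(real (w 0))\<^sup>2 \<le> 1" using real_square_ge[of "w 0" 1] by simp
      thus False using sq t by simp
    next
      case False
      hence "2\<^sup>2 \<le> (real (w 0))\<^sup>2" using real_square_ge[of 2 "w 0"] by simp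
      thus False using sq t by simp
    qed
  qed
  moreover have "w 0 = 0" using eq calculation by simp
  ultimately show ?thesis using z[of j] j by (cases "j = 0"; cases "j = 1") auto
qed

lemma qf_dim2: "qf 2 2 w = real ((w 0)\<^sup>2 + 2 * (w 1)\<^sup>2)"
  by (simp add: qf_def numeral_2_eq_2)

text \<open>12 is the value at (2, 2), the largest one examined in dimension 2.\<close>

lemma quadratic_small:
  assumes "(x::nat)\<^sup>2 + 2 * y\<^sup>2 \<le> 12" shows "x \<in> {0, 1, 2, 3}" "y \<in> {0, 1, 2}"
proof -
  have "x \<le> 3"
  proof (rule ccontr)
    assume "\<not> x \<le> 3"
    hence "4\<^sup>2 \<le> x\<^sup>2" by (intro power_mono) auto
    thus False using assms by simp
  qed
  thus "x \<in> {0, 1, 2, 3}" by auto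
  have "y \<le> 2"
  proof (rule ccontr)
    assume "\<not> y \<le> 2"
    hence "3\<^sup>2 \<le> y\<^sup>2" by (intro power_mono) auto
    thus False using assms by simp
  qed
  thus "y \<in> {0, 1, 2}" by auto
qed

lemma qf_dim2_unique:
  assumes w: "qf 2 2 w = qf 2 2 v" and v: "(v 0, v 1) \<in> {(1, 1), (2, 1), (3, 1), (2, 2)}"
  shows "\<forall>j<2. w j = v j"
proof -
  have eq: "(w 0)\<^sup>2 + 2 * (w 1)\<^sup>2 = (v 0)\<^sup>2 + 2 * (v 1)\<^sup>2" using w unfolding qf_dim2 of_nat_eq_iff .
  have "(w 0)\<^sup>2 + 2 * (w 1)\<^sup>2 \<le> 12" unfolding eq using v by auto
  from quadratic_small[OF this] eq v have "w 0 = v 0 \<and> w 1 = v 1" by auto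
  thus ?thesis by (auto simp: less_2_cases_iff)
qed

lemma qf_dim2_below:
  assumes w: "qf 2 2 w < qf 2 2 v" and v: "(v 0, v 1) \<in> {(1, 1), (2, 1)}"
  shows "\<forall>j<2. w j \<le> v j"
proof -
  have lt: "(w 0)\<^sup>2 + 2 * (w 1)\<^sup>2 < (v 0)\<^sup>2 + 2 * (v 1)\<^sup>2" using w unfolding qf_dim2 of_nat_less_iff .
  have "(w 0)\<^sup>2 + 2 * (w 1)\<^sup>2 \<le> 12" using lt v by auto
  from quadratic_small[OF this] lt v have "w 0 \<le> v 0 \<and> w 1 \<le> v 1" by auto
  thus ?thesis by (auto simp: less_2_cases_iff)
qed

text \<open>Since \<open>1 < t < t * t < 3\<close>, an entry 2 overshoots, and among the vectors of
  zeros and ones a single one has the right value.\<close>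

lemma qf_dim3_unique:
  assumes t: "1 < t" "t < 8 / 5" and v: "v 0 = 1" "v 1 = 0" "v 2 = 1"
    and w: "qf t 3 w = qf t 3 v"
  shows "\<forall>j<3. w j = v j"
proof -
  define T where "T = t * t"
  have T: "t < T" "T < 3"
  proof -
    show "t < T" unfolding T_def using t by simp
    have "t * t \<le> (8 / 5) * (8 / 5)" using t by (intro mult_mono) auto
    thus "T < 3" by (simp add: T_def)
  qed
  have q: "qf t 3 u = (real (u 0))\<^sup>2 + (real (u 1))\<^sup>2 * t + (real (u 2))\<^sup>2 * T" for u
    by (simp add: qf_def T_def numeral_3_eq_3 numeral_2_eq_2)
  have eq: "(real (w 0))\<^sup>2 + (real (w 1))\<^sup>2 * t + (real (w 2))\<^sup>2 * T = 1 + T"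
    using w unfolding q v by simp
  have nn: "(real (w 0))\<^sup>2 \<ge> 0" "(real (w 1))\<^sup>2 * t \<ge> 0" "(real (w 2))\<^sup>2 * T \<ge> 0" using t T by auto
  have "w 0 \<le> 1"
  proof (rule ccontr)
    assume "\<not> w 0 \<le> 1"
    hence "2\<^sup>2 \<le> (real (w 0))\<^sup>2" using real_square_ge[of 2 "w 0"] by simp
    thus False using eq nn T by simp
  qed
  moreover have "w 1 \<le> 1"
  proof (rule ccontr)
    assume "\<not> w 1 \<le> 1"
    hence "4 * t \<le> (real (w 1))\<^sup>2 * t" using real_square_ge[of 2 "w 1"] t by (intro mult_right_mono) auto
    thus False using eq nn T t by linarith
  qed
  moreover have "w 2 \<le> 1"
  proof (rule ccontr)
    assume "\<not> w 2 \<le> 1"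
    hence "4 * T \<le> (real (w 2))\<^sup>2 * T" using real_square_ge[of 2 "w 2"] T t by (intro mult_right_mono) auto
    thus False using eq nn T t by linarith
  qed
  ultimately have "w 0 \<in> {0, 1}" "w 1 \<in> {0, 1}" "w 2 \<in> {0, 1}" by auto
  hence "w 0 = 1 \<and> w 1 = 0 \<and> w 2 = 1" using eq t T by auto
  thus ?thesis using v by (auto simp: less_Suc_eq numeral_3_eq_3 numeral_2_eq_2)
qed

lemma qf_less_one:
  assumes t: "1 < t" and w: "qf t n w < 1" and j: "j < n"
  shows "w j = 0"
proof (rule ccontr)
  assume "w j \<noteq> 0"
  hence "1 * 1 \<le> (real (w j))\<^sup>2 * t ^ j"
    using t real_square_ge[of 1 "w j"] by (intro mult_mono one_le_power) auto
  also have "\<dots> \<le> qf t n w" using qf_term_le[of t j n w] t j by simp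
  finally show False using w by simp
qed

lemma qf_eq_one_unique:
  assumes t: "1 < t" and n: "n \<ge> 1" and w: "qf t n w = 1" and j: "j < n"
  shows "w j = (if j = 0 then 1 else 0)"
proof -
  have z: "w i = 0" if "1 \<le> i" "i < n" for i
  proof (rule ccontr)
    assume "w i \<noteq> 0"
    hence "1 * t ^ 1 \<le> (real (w i))\<^sup>2 * t ^ i"
      using t that real_square_ge[of 1 "w i"] by (intro mult_mono power_increasing) auto
    thus False using qf_term_le[of t i n w] t that w by simp
  qed
  have "qf_tail t n w = 0" unfolding qf_tail_def by (rule sum.neutral) (use z in auto)
  hence "(real (w 0))\<^sup>2 = 1" using qf_split[OF n, of t w] w by simp
  hence "w 0 = 1" by (simp add: power2_eq_1_iff)
  thus ?thesis using z[of j] j by (cases "j = 0") auto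
qed

text \<open>The descent. An odd eigenvalue must be one of the exceptions without escaping vector. An
  even one passes to the half box with \<open>X\<close> divided by \<open>t\<close>, which lowers
  \<open>K\<close>; going back up, \<open>t\<close> and, for \<open>n = 2\<close>, 12 are ruled out
  by counting, while 6 survives.\<close>

lemma sharp_paper_box_cases:
  fixes a b :: "real^'n"
  assumes "paper_box a b ax L" "CARD('n) \<ge> 2" "sharp a b ((pi / L)\<^sup>2 * X)" "0 < X" "X < ((ratio CARD('n))\<^sup>2) ^ K"
  shows "X = 1 \<or> (CARD('n) = 2 \<and> (X = 3 \<or> X = 6))"
  using assms
proof (induction K arbitrary: a b ax L X)
  case (0 a b ax L X)
  let ?t = "(ratio CARD('n))\<^sup>2"
  have "?t > 0" "?t ^ CARD('n) = 4" using ratio_pos[of "CARD('n)"] by (simp_all add: ratio_square_power)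
  hence t1: "1 < ?t" by (rule base_bounds(1)[OF _ _ 0(2)])
  obtain m0 where "energy a b m0 = (pi / L)\<^sup>2 * X" using 0(3) unfolding sharp_def by blast
  hence q: "qf ?t CARD('n) (m0 \<circ> ax) = X"
    using 0(1) unfolding energy_paper_box[OF 0(1)] paper_box_def by simp
  \<comment> \<open>Below 1 only the zero vector is left, whose value is 0.\<close>
  have "qf ?t CARD('n) (m0 \<circ> ax) = 0"
    unfolding qf_def using qf_less_one[OF t1, of "CARD('n)" "m0 \<circ> ax"] q 0(5) by (intro sum.neutral) auto
  thus ?case using q 0(4) by simp
next
  case (Suc K a b ax L X)
  let ?n = "CARD('n)" and ?r = "ratio CARD('n)" and ?C = "(pi / L)\<^sup>2"
  define t where "t = ?r\<^sup>2"
  note P = Suc.prems(1) and n2 = Suc.prems(2) and sh = Suc.prems(3)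
  have n1: "?n \<ge> 1" by simp
  have tpow: "t ^ ?n = 4" unfolding t_def by (rule ratio_square_power[OF n1])
  have tpos: "t > 0" unfolding t_def using ratio_pos[of ?n] by simp
  note tb = base_bounds[OF tpos tpow n2]
  have L: "L > 0" using P unfolding paper_box_def by auto
  have C: "?C > 0" using L by simp
  note ab = paper_box_less[OF P] and en = energy_paper_box[OF P, folded t_def]
  obtain m0 where m0: "energy a b m0 = ?C * X" using sh unfolding sharp_def by blast
  define v where "v = m0 \<circ> ax"
  have qv: "qf t ?n v = X" using m0 C unfolding en v_def by simp
  have parity: "even (m (ax 0)) \<longleftrightarrow> even (m0 (ax 0))" if "energy a b m = ?C * X" for m
  proof -
    have "qf (?r\<^sup>2) ?n (m \<circ> ax) = qf (?r\<^sup>2) ?n (m0 \<circ> ax)"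
      using that m0 C unfolding en t_def[symmetric] by simp
    from qf_parity[OF ratio_power[OF n1] n1 this] show ?thesis by simp
  qed
  have not_sharp: False
    if "\<And>w. qf t ?n w = qf t ?n u \<Longrightarrow> (\<forall>j<?n. w j = u j)" "qf t ?n u = X" "qf t ?n z < X" "j < ?n" "u j < z j" for u z j
  proof -
    have "\<not> sharp a b (?C * qf t ?n u)"
    proof (rule paper_box_not_sharp[OF P, folded t_def, where v = u and z = z and j = j])
      show "\<forall>j<?n. w j = u j" if "qf t ?n w = qf t ?n u" for w using that by (rule \<open>\<And>w. qf t ?n w = qf t ?n u \<Longrightarrow> \<forall>j<?n. w j = u j\<close>)
      show "qf t ?n z < qf t ?n u" using that(2,3) by simp
    qed (rule that(4) that(5))+
    thus False using sh unfolding that(2) by contradiction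
  qed
  show ?case
  proof (cases "odd (m0 (ax 0))")
    case True
    have no: "\<not> (\<exists>z. escaping t ?n v z)"
    proof
      assume "\<exists>z. escaping t ?n v z"
      then obtain z where "escaping t ?n v z" by blast
      hence "card {m. energy a b m < ?C * X \<and> odd (m (ax 0))} + 2 \<le> card {m. energy a b m < ?C * X \<and> even (m (ax 0))}"
        unfolding t_def v_def by (rule even_class_too_large[OF P m0 True])
      moreover have "card {m. energy a b m < ?C * X \<and> even (m (ax 0))} \<le> card {m. energy a b m < ?C * X \<and> odd (m (ax 0))} + 1"
        by (rule sharp_odd[OF ab sh]) (use parity True in blast)
      ultimately show False by linarith
    qed
    have odd: "odd (v 0)" using True by (simp add: v_def)
    consider "v 0 = 1" "\<forall>j. 1 \<le> j \<and> j < ?n \<longrightarrow> v j = 0" | "?n = 2" "v 0 = 1" "v 1 = 1"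
      | "?n = 2" "v 0 = 3" "v 1 = 1" | "?n = 3" "v 0 = 1" "v 1 = 0" "v 2 = 1"
    proof -
      assume *: "\<lbrakk>v 0 = 1; \<forall>j. 1 \<le> j \<and> j < ?n \<longrightarrow> v j = 0\<rbrakk> \<Longrightarrow> thesis" "\<lbrakk>?n = 2; v 0 = 1; v 1 = 1\<rbrakk> \<Longrightarrow> thesis"
        "\<lbrakk>?n = 2; v 0 = 3; v 1 = 1\<rbrakk> \<Longrightarrow> thesis" "\<lbrakk>?n = 3; v 0 = 1; v 1 = 0; v 2 = 1\<rbrakk> \<Longrightarrow> thesis"
      show thesis
      proof (rule ccontr)
        assume neg: "\<not> thesis"
        have "\<exists>z. escaping t ?n v z"
        proof (rule exists_escaping[where v = v and t = t and n = ?n, OF n2 tpos tpow odd])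
          show "\<not> (v 0 = 1 \<and> (\<forall>j. 1 \<le> j \<and> j < ?n \<longrightarrow> v j = 0))" using *(1) neg by blast
          show "\<not> (?n = 2 \<and> v 0 = 1 \<and> v 1 = 1)" using *(2) neg by blast
          show "\<not> (?n = 2 \<and> v 0 = 3 \<and> v 1 = 1)" using *(3) neg by blast
          show "\<not> (?n = 3 \<and> v 0 = 1 \<and> v 1 = 0 \<and> v 2 = 1)" using *(4) neg by blast
        qed
        thus False using no by contradiction
      qed
    qed
    thus ?thesis
    proof cases
      case 1
      have "qf_tail t ?n v = 0" unfolding qf_tail_def by (rule sum.neutral) (use 1 in auto)
      thus ?thesis using qf_split[OF n1, of t v] qv 1 by simp
    next
      case 2
      have "t = 2" using tb(3) 2 by blast
      hence "X = 3" using qv 2 qf_dim2[of v] by simp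
      thus ?thesis using 2 by simp
    next
      case 3
      have t2: "t = 2" using tb(3) 3 by blast
      \<comment> \<open>(0, 2) has value 8, below the value 11 of (3, 1), and is larger in the
        second entry.\<close>
      define z :: "nat \<Rightarrow> nat" where "z j = (if j = 0 then 0 else if j = 1 then 2 else 0)" for j
      have uq: "\<forall>j<?n. w j = v j" if "qf t ?n w = qf t ?n v" for w
        unfolding 3(1) by (rule qf_dim2_unique) (use that 3 t2 in simp_all)
      have zX: "qf t ?n z < X" unfolding qv[symmetric] 3(1) t2 qf_dim2 using 3(2,3) by (simp add: z_def)
      have "1 < ?n" "v 1 < z 1" using 3 by (simp_all add: z_def)
      hence False by (intro not_sharp[of v z 1]) (rule uq qv zX, assumption?)+
      thus ?thesis ..
    next
      case 4
      have tb': "1 < t" "t < 8 / 5" using tb(1,4) 4 by simp_all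
      \<comment> \<open>(0, 1, 0) has value \<open>t\<close>, below \<open>1 + t * t\<close>, and is
        larger than \<open>v\<close> in the second entry.\<close>
      define z :: "nat \<Rightarrow> nat" where "z j = (if j = 0 then 0 else if j = 1 then 1 else 0)" for j
      have qz: "qf t 3 z = t" unfolding z_def[abs_def] using qf_first_two[of 3 t 0 1] by simp
      have "t * 1 < t * t" using tb'(1) by (intro mult_strict_left_mono) auto
      moreover have "qf t 3 v = 1 + t * t" using 4 by (simp add: qf_def numeral_3_eq_3 numeral_2_eq_2)
      ultimately have zX: "qf t ?n z < X" unfolding qv[symmetric] 4(1) qz by simp
      have uq: "\<forall>j<?n. w j = v j" if "qf t ?n w = qf t ?n v" for w
        unfolding 4(1) by (rule qf_dim3_unique[OF tb' 4(2-4)]) (use that 4(1) in simp)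
      have "1 < ?n" "v 1 < z 1" using 4 by (simp_all add: z_def)
      hence False by (intro not_sharp[of v z 1]) (rule uq qv zX, assumption?)+
      thus ?thesis ..
    qed
  next
    case False
    have sh': "sharp a (halve a b (ax 0)) (?C * X)"
      by (rule sharp_even[OF ab sh]) (use parity False in blast)
    have rpos: "?r > 0" by (rule ratio_pos)
    \<comment> \<open>The same eigenvalue in the units of the half, whose longest edge is
      \<open>L / ?r\<close>.\<close>
    have Xeq: "(pi / (L / ?r))\<^sup>2 * (X / t) = ?C * X"
      using rpos L by (simp add: t_def power_divide power_mult_distrib)
    have "X / t = 1 \<or> ?n = 2 \<and> (X / t = 3 \<or> X / t = 6)"
    proof (rule Suc.IH[OF paper_box_halve[OF P n2] n2])
      show "sharp a (halve a b (ax 0)) ((pi / (L / ?r))\<^sup>2 * (X / t))" unfolding Xeq by (rule sh')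
      show "0 < X / t" using Suc.prems(4) tpos by simp
      show "X / t < (?r\<^sup>2) ^ K" using Suc.prems(5) tpos unfolding t_def[symmetric] by (simp add: field_simps)
    qed
    thus ?thesis
    proof (elim disjE conjE)
      assume "X / t = 1"
      hence X: "X = t" using tpos by simp
      \<comment> \<open>The value \<open>t\<close> is taken by (0, 1, 0, ...) alone, and (1, 0, 0,
        ...) lies below it with value 1.\<close>
      define u z :: "nat \<Rightarrow> nat" where "u j = (if j = 0 then 0 else if j = 1 then 1 else 0)"
        and "z j = (if j = 0 then 1 else (if j = 1 then 0 else 0))" for j
      have qu: "qf t ?n u = t" and qz: "qf t ?n z = 1"
        unfolding u_def[abs_def] z_def[abs_def] using qf_first_two[OF n2, of t 0 1] qf_first_two[OF n2, of t 1 0] by simp_all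
      have uq: "\<forall>j<?n. w j = u j" if "qf t ?n w = qf t ?n u" for w
        using qf_eq_t_unique[OF tb(1,2) n2 that[unfolded u_def[abs_def]]] by (simp add: u_def)
      have qu': "qf t ?n u = X" and zX: "qf t ?n z < X" using qu qz X tb(1) by simp_all
      have "0 < ?n" "u 0 < z 0" by (simp_all add: u_def z_def)
      hence False by (intro not_sharp[of u z 0]) (rule uq qu' zX, assumption?)+
      thus ?thesis ..
    next
      assume n: "?n = 2" and X3: "X / t = 3"
      have "t = 2" using tb(3) n by blast
      thus ?thesis using n X3 by simp
    next
      assume n: "?n = 2" and X6: "X / t = 6"
      have t2: "t = 2" using tb(3) n by blast
      hence X: "X = 12" using X6 by simp
      \<comment> \<open>The value 12 is taken by (2, 2) alone, and (3, 0) lies below it with value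
        9.\<close>
      define u z :: "nat \<Rightarrow> nat" where "u j = (if j = 0 then 2 else if j = 1 then 2 else 0)"
        and "z j = (if j = 0 then 3 else (if j = 1 then 0 else 0))" for j
      have qu: "qf t ?n u = X" and zX: "qf t ?n z < X" unfolding n t2 qf_dim2 X by (simp_all add: u_def z_def)
      have uq: "\<forall>j<?n. w j = u j" if "qf t ?n w = qf t ?n u" for w
        unfolding n by (rule qf_dim2_unique[where v = u]) (use that n t2 in \<open>simp_all add: u_def\<close>)
      have "0 < ?n" "u 0 < z 0" by (simp_all add: u_def z_def)
      hence False by (intro not_sharp[of u z 0]) (rule uq qu zX, assumption?)+
      thus ?thesis ..
    qed
  qed
qed

theorem theorem1p2:
  fixes n :: nat and a b :: "real ^ 'n" and ax :: "nat \<Rightarrow> 'n" and l lam :: "nat \<Rightarrow> real"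
  assumes "CARD('n) = n" and "n \<ge> 2"
    and "bij_betw ax {1..n} UNIV"
    and "\<forall>j\<in>{1..n}. l j > 0 \<and> b $ ax j - a $ ax j = l j"
    and "\<forall>j\<in>{1..n - 1}. l j / l (j + 1) = 2 powr (1 / real n)"
    and "lists_neumann_eigenvalues (box a b) lam"
  shows "(n = 2 \<longrightarrow> {\<mu>. courant_sharp_eigenvalue (box a b) lam \<mu>} = {lam 1, lam 2, lam 4, lam 6}) \<and>
         (n \<ge> 3 \<longrightarrow> {\<mu>. courant_sharp_eigenvalue (box a b) lam \<mu>} = {lam 1, lam 2})"
proof -
  define L where "L = l 1"
  define t where "t = (ratio n)\<^sup>2"
  let ?C = "(pi / L)\<^sup>2"
  have L: "L > 0" using assms(2,4) by (simp add: L_def)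
  have C: "?C > 0" using L by simp
  have rpos: "ratio n > 0" by (rule ratio_pos)
  have len: "l (Suc j) = L / ratio n ^ j" if "j < n" for j
    using that
  proof (induction j)
    case (Suc j)
    have lpos: "l (Suc j + 1) > 0" using assms(4) Suc.prems by simp
    have "l (Suc j) / l (Suc j + 1) = ratio n" using assms(5) Suc.prems unfolding ratio_def by simp
    hence "l (Suc j) = ratio n * l (Suc j + 1)" using lpos by (simp add: field_simps)
    thus ?case using Suc rpos by (simp add: field_simps)
  qed (simp add: L_def)
  have "bij_betw Suc {..<n} {1..n}"
    by (rule bij_betw_byWitness[where f' = "\<lambda>j. j - 1"]) auto
  from bij_betw_trans[OF this assms(3)] have bij: "bij_betw (\<lambda>j. ax (Suc j)) {..<n} UNIV" by (simp add: o_def)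
  have P: "paper_box a b (\<lambda>j. ax (Suc j)) L"
    unfolding paper_box_def assms(1) using bij L len assms(4) by auto
  note ab = paper_box_less[OF P]
  have n1: "n \<ge> 1" using assms(2) by simp
  have tpow: "t ^ n = 4" unfolding t_def by (rule ratio_square_power[OF n1])
  have tpos: "t > 0" unfolding t_def using rpos by simp
  note tb = base_bounds[OF tpos tpow assms(2)]
  have iff: "courant_sharp_eigenvalue (box a b) lam \<mu> \<longleftrightarrow> sharp a b \<mu>" for \<mu>
    by (rule courant_sharp_eigenvalue_iff[OF ab assms(6)])
  note simple = paper_box_sharp[OF P _ _ assms(6), unfolded assms(1), folded t_def]
  \<comment> \<open>The constant mode and the first mode along the longest edge. Their places 1 and
    2 in the list are the products of the entries plus one.\<close>
  define v0 v1 :: "nat \<Rightarrow> nat" where "v0 j = 0" and "v1 j = (if j = 0 then 1 else 0)" for j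
  have q0: "qf t n v0 = 0" unfolding qf_def v0_def by simp
  have q1: "qf t n v1 = 1" unfolding v1_def[abs_def] using qf_split[OF n1, of t "\<lambda>j. if j = 0 then 1 else 0"] by (simp add: qf_tail_zero)
  have u0: "\<forall>j<n. w j = v0 j" if "qf t n w = qf t n v0" for w
    using qf_less_one[OF tb(1), of n w] that q0 by (simp add: v0_def)
  have b0: "\<forall>j<n. w j \<le> v0 j" if "qf t n w < qf t n v0" for w
    using qf_less_one[OF tb(1), of n w] that q0 by (simp add: v0_def)
  have u1: "\<forall>j<n. w j = v1 j" if "qf t n w = qf t n v1" for w
    using qf_eq_one_unique[OF tb(1) n1, of w] that q1 by (simp add: v1_def)
  have b1: "\<forall>j<n. w j \<le> v1 j" if "qf t n w < qf t n v1" for w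
    using qf_less_one[OF tb(1), of n w] that q1 by simp
  have p0: "(\<Prod>j<n. v0 j + 1) = 1" by (simp add: v0_def)
  have p1: "(\<Prod>j<n. v1 j + 1) = 2"
  proof -
    have "(\<Prod>j<n. v1 j + 1) = (\<Prod>j<n. if j = 0 then 2 else 1)" by (rule prod.cong) (auto simp: v1_def)
    thus ?thesis using n1 by simp
  qed
  have s0: "sharp a b 0" "lam 1 = 0" using simple[OF u0 b0] unfolding q0 p0 by simp_all
  have s1: "sharp a b ?C" "lam 2 = ?C" using simple[OF u1 b1] unfolding q1 p1 by simp_all
  have cases: "\<mu> = 0 \<or> \<mu> = ?C \<or> (n = 2 \<and> (\<mu> = ?C * 3 \<or> \<mu> = ?C * 6))" if sh: "sharp a b \<mu>" for \<mu>
  proof (cases "\<mu> = 0")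
    case False
    define X where "X = \<mu> / ?C"
    have mu: "\<mu> = ?C * X" using C by (simp add: X_def)
    obtain m where "energy a b m = \<mu>" using sh unfolding sharp_def by blast
    hence "\<mu> > 0" using energy_nonneg[of a b m] False by simp
    hence X: "X > 0" using C by (simp add: X_def)
    \<comment> \<open>A bound for the length of the descent, which exists because
      \<open>t > 1\<close>.\<close>
    obtain K where "X < t ^ K" using real_arch_pow[OF tb(1)] by blast
    hence "X = 1 \<or> (n = 2 \<and> (X = 3 \<or> X = 6))"
      using sharp_paper_box_cases[OF P, unfolded assms(1), folded t_def, OF assms(2) sh[unfolded mu] X] by blast
    thus ?thesis unfolding mu by auto
  qed simp
  show ?thesis
  proof (intro conjI impI)
    assume n: "n = 2"
    have t2: "t = 2" using tb(3) n by blast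
    \<comment> \<open>(1, 1) has value 3 and place \<open>2 * 2\<close>, and (2, 1) has value 6 and
      place \<open>3 * 2\<close>; in both cases the smaller values come from vectors componentwise
      below.\<close>
    define v4 v6 :: "nat \<Rightarrow> nat" where "v4 j = 1" and "v6 j = (if j = 0 then 2 else 1)" for j
    have q: "qf 2 2 v4 = 3" "qf 2 2 v6 = 6" by (simp_all add: qf_dim2 v4_def v6_def)
    have u4: "\<forall>j<n. w j = v4 j" if "qf t n w = qf t n v4" for w
      using qf_dim2_unique[of w v4] that unfolding n t2 by (simp add: v4_def)
    have b4: "\<forall>j<n. w j \<le> v4 j" if "qf t n w < qf t n v4" for w
      using qf_dim2_below[of w v4] that unfolding n t2 by (simp add: v4_def)
    have u6: "\<forall>j<n. w j = v6 j" if "qf t n w = qf t n v6" for w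
      using qf_dim2_unique[of w v6] that unfolding n t2 by (simp add: v6_def)
    have b6: "\<forall>j<n. w j \<le> v6 j" if "qf t n w < qf t n v6" for w
      using qf_dim2_below[of w v6] that unfolding n t2 by (simp add: v6_def)
    have p: "(\<Prod>j<2. v4 j + 1) = 4" "(\<Prod>j<2. v6 j + 1) = 6"
      by (simp_all add: v4_def v6_def numeral_2_eq_2)
    have s4: "sharp a b (?C * 3)" "lam 4 = ?C * 3" using simple[OF u4 b4] unfolding n t2 q p by simp_all
    have s6: "sharp a b (?C * 6)" "lam 6 = ?C * 6" using simple[OF u6 b6] unfolding n t2 q p by simp_all
    show "{\<mu>. courant_sharp_eigenvalue (box a b) lam \<mu>} = {lam 1, lam 2, lam 4, lam 6}"
      unfolding iff s0(2) s1(2) s4(2) s6(2) using cases s0(1) s1(1) s4(1) s6(1) by blast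
  next
    assume n: "3 \<le> n"
    hence "n \<noteq> 2" by simp
    thus "{\<mu>. courant_sharp_eigenvalue (box a b) lam \<mu>} = {lam 1, lam 2}"
      unfolding iff s0(2) s1(2) using cases s0(1) s1(1) by blast
  qed
qed

end
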